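(* There exists $\Theta_0\in(0,+\infty)$ such that: (1) for all $\Theta\in(0,\Theta_0)$ one has $m_\Theta<2\pi\,\widehat{m}_{\Theta/\sqrt{2\pi}}$, and every minimizer $(u_\Theta,v_\Theta)$ of $m_\Theta$ (i.e. $(u_\Theta,v_\Theta)\in V_\Theta$ with $I(u_\Theta,v_\Theta)=m_\Theta$) satisfies $(\partial_y u_\Theta,\partial_y v_\Theta)\neq(0,0)$; (2) for all $\Theta\in(\Theta_0,+\infty)$ one has $m_\Theta=2\pi\,\widehat{m}_{\Theta/\sqrt{2\pi}}$, and every minimizer $(u_\Theta,v_\Theta)$ of $m_\Theta$ satisfies $\partial_y u_\Theta=\partial_y v_\Theta=0$.
   Context: $\mathbb{T}=\mathbb{R}/2\pi\mathbb{Z}$; points of $\mathbb{R}^3\times\mathbb{T}$ are $(x,y)$; $\nabla_x$ is the gradient in $x$, $\nabla_{x,y}$ the full gradient, $\partial_y$ the $y$-derivative. Functions are real-valued, $H^1=H^1(\mathbb{R}^3\times\mathbb{T})$ and $\|\cdot\|_2$ is the $L^2(\mathbb{R}^3\times\mathbb{T})$ norm. For $\Theta>0$ let $S_\Theta=\{u\in H^1:\|u\|_2=\Theta\}$. For $(u,v)\in H^1\times H^1$ set $I(u,v)=\frac12\int_{\mathbb{R}^3\times\mathbb{T}}(|\nabla_{x,y}u|^2+|\nabla_{x,y}v|^2)\,dx\,dy-\frac14\int_{\mathbb{R}^3\times\mathbb{T}}(|u|^4+2|u|^2|v|^2+|v|^4)\,dx\,dy$, $Q(u,v)=\int_{\mathbb{R}^3\times\mathbb{T}}(|\nabla_xu|^2+|\nabla_xv|^2)\,dx\,dy-\frac34\int_{\mathbb{R}^3\times\mathbb{T}}(|u|^4+2|u|^2|v|^2+|v|^4)\,dx\,dy$,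 $V_\Theta=\{(u,v)\in S_\Theta\times S_\Theta: Q(u,v)=0\}$ and $m_\Theta=\inf_{V_\Theta}I$. On $\mathbb{R}^3$: for $(u,v)\in H^1(\mathbb{R}^3)\times H^1(\mathbb{R}^3)$ let $\widehat I(u,v)=\frac12\int_{\mathbb{R}^3}(|\nabla u|^2+|\nabla v|^2)dx-\frac14\int_{\mathbb{R}^3}(|u|^4+2|u|^2|v|^2+|v|^4)dx$ and $\widehat Q(u,v)=\int_{\mathbb{R}^3}(|\nabla u|^2+|\nabla v|^2)dx-\frac34\int_{\mathbb{R}^3}(|u|^4+2|u|^2|v|^2+|v|^4)dx$; for $\rho>0$, $\widehat m_\rho=\inf\{\widehat I(u,v): u,v\in H^1(\mathbb{R}^3),\ \|u\|_{L^2(\mathbb{R}^3)}=\|v\|_{L^2(\mathbb{R}^3)}=\rho,\ \widehat Q(u,v)=0\}$. *)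

theory Defs
  imports "HOL-Analysis.Analysis"
begin

(* Test functions: C^1 functions with bounded support (C^1 test functions give the
   same weak derivatives as C_c^infinity ones). *)
definition test_fun :: "('a::euclidean_space \<Rightarrow> real) \<Rightarrow> bool" where
  "test_fun \<phi> \<longleftrightarrow> \<phi> differentiable_on UNIV \<and>
     (\<forall>b\<in>Basis. continuous_on UNIV (\<lambda>z. frechet_derivative \<phi> (at z) b)) \<and>
     (\<exists>r. \<forall>z. norm z > r \<longrightarrow> \<phi> z = 0)"

definition weak_grad :: "('a::euclidean_space \<Rightarrow> real) \<Rightarrow> ('a \<Rightarrow> 'a) \<Rightarrow> bool" where
  "weak_grad f G \<longleftrightarrow> (\<forall>\<phi>. test_fun \<phi> \<longrightarrow> (\<forall>b\<in>Basis.
      (LINT z|lborel. f z * frechet_derivative \<phi> (at z) b) = - (LINT z|lborel. (G z \<bullet> b) * \<phi> z)))"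

type_synonym pt = "(real^3) \<times> real"

definition periodic_y :: "(pt \<Rightarrow> 'b) \<Rightarrow> bool" where
  "periodic_y f \<longleftrightarrow> (\<forall>x y. f (x, y + 2*pi) = f (x, y))"

definition cell :: "pt set" where
  "cell = UNIV \<times> {0..2*pi}"

definition intT :: "(pt \<Rightarrow> real) \<Rightarrow> real" where
  "intT f = (LINT z:cell|lborel. f z)"

definition H1T :: "(pt \<Rightarrow> real) set" where
  "H1T = {u. periodic_y u \<and> u \<in> borel_measurable lborel \<and>
            set_integrable lborel cell (\<lambda>z. (u z)^2) \<and>
            (\<exists>G. weak_grad u G \<and> periodic_y G \<and> G \<in> borel_measurable lborel \<and>
                 set_integrable lborel cell (\<lambda>z. (norm (G z))^2))}"

definition gradT :: "(pt \<Rightarrow> real) \<Rightarrow> (pt \<Rightarrow> pt)" where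
  "gradT u = (SOME G. weak_grad u G \<and> periodic_y G \<and> G \<in> borel_measurable lborel \<and>
                 set_integrable lborel cell (\<lambda>z. (norm (G z))^2))"

(* nabla_x u = fst (gradT u z), partial_y u = snd (gradT u z) *)

definition S_T :: "real \<Rightarrow> (pt \<Rightarrow> real) set" where
  "S_T \<Theta> = {u \<in> H1T. sqrt (intT (\<lambda>z. (u z)^2)) = \<Theta>}"

definition I_T :: "(pt \<Rightarrow> real) \<Rightarrow> (pt \<Rightarrow> real) \<Rightarrow> real" where
  "I_T u v = 1/2 * intT (\<lambda>z. (norm (gradT u z))^2 + (norm (gradT v z))^2)
             - 1/4 * intT (\<lambda>z. \<bar>u z\<bar>^4 + 2 * \<bar>u z\<bar>^2 * \<bar>v z\<bar>^2 + \<bar>v z\<bar>^4)"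

definition Q_T :: "(pt \<Rightarrow> real) \<Rightarrow> (pt \<Rightarrow> real) \<Rightarrow> real" where
  "Q_T u v = intT (\<lambda>z. (norm (fst (gradT u z)))^2 + (norm (fst (gradT v z)))^2)
             - 3/4 * intT (\<lambda>z. \<bar>u z\<bar>^4 + 2 * \<bar>u z\<bar>^2 * \<bar>v z\<bar>^2 + \<bar>v z\<bar>^4)"

definition V_T :: "real \<Rightarrow> ((pt \<Rightarrow> real) \<times> (pt \<Rightarrow> real)) set" where
  "V_T \<Theta> = {(u, v). u \<in> S_T \<Theta> \<and> v \<in> S_T \<Theta> \<and> Q_T u v = 0}"

definition m_T :: "real \<Rightarrow> real" where
  "m_T \<Theta> = Inf ((\<lambda>(u, v). I_T u v) ` V_T \<Theta>)"

definition minimizer_T :: "real \<Rightarrow> (pt \<Rightarrow> real) \<Rightarrow> (pt \<Rightarrow> real) \<Rightarrow> bool" where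
  "minimizer_T \<Theta> u v \<longleftrightarrow> (u, v) \<in> V_T \<Theta> \<and> I_T u v = m_T \<Theta>"

definition dy_zero :: "(pt \<Rightarrow> real) \<Rightarrow> bool" where
  "dy_zero u \<longleftrightarrow> (AE z in lborel. snd (gradT u z) = 0)"

definition H1R :: "(real^3 \<Rightarrow> real) set" where
  "H1R = {u. u \<in> borel_measurable lborel \<and> integrable lborel (\<lambda>x. (u x)^2) \<and>
            (\<exists>G. weak_grad u G \<and> G \<in> borel_measurable lborel \<and>
                 integrable lborel (\<lambda>x. (norm (G x))^2))}"

definition gradR :: "(real^3 \<Rightarrow> real) \<Rightarrow> (real^3 \<Rightarrow> real^3)" where
  "gradR u = (SOME G. weak_grad u G \<and> G \<in> borel_measurable lborel \<and>
                 integrable lborel (\<lambda>x. (norm (G x))^2))"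

definition I_R :: "(real^3 \<Rightarrow> real) \<Rightarrow> (real^3 \<Rightarrow> real) \<Rightarrow> real" where
  "I_R u v = 1/2 * (LINT x|lborel. (norm (gradR u x))^2 + (norm (gradR v x))^2)
             - 1/4 * (LINT x|lborel. \<bar>u x\<bar>^4 + 2 * \<bar>u x\<bar>^2 * \<bar>v x\<bar>^2 + \<bar>v x\<bar>^4)"

definition Q_R :: "(real^3 \<Rightarrow> real) \<Rightarrow> (real^3 \<Rightarrow> real) \<Rightarrow> real" where
  "Q_R u v = (LINT x|lborel. (norm (gradR u x))^2 + (norm (gradR v x))^2)
             - 3/4 * (LINT x|lborel. \<bar>u x\<bar>^4 + 2 * \<bar>u x\<bar>^2 * \<bar>v x\<bar>^2 + \<bar>v x\<bar>^4)"

definition m_R :: "real \<Rightarrow> real" where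
  "m_R \<rho> = Inf {I_R u v | u v. u \<in> H1R \<and> v \<in> H1R \<and>
                 sqrt (LINT x|lborel. (u x)^2) = \<rho> \<and> sqrt (LINT x|lborel. (v x)^2) = \<rho> \<and>
                 Q_R u v = 0}"

end

theory Submission
  imports Defs
begin

text \<open>
  For a pair \<open>(u,v)\<close> write \<open>A\<close> and \<open>D\<close> for the total squared \<open>L\<^sup>2\<close> norms of the \<open>x\<close>-gradients and of the
  \<open>y\<close>-derivatives, \<open>B\<close> for the integral of \<open>(u\<^sup>2 + v\<^sup>2)\<^sup>2\<close> and \<open>s\<close> for the total mass. On \<open>V\<^sub>\<Theta>\<close> one has
  \<open>B = 4A/3\<close> and \<open>I = A/6 + D/2\<close>. Dilating in \<open>x\<close> and multiplying by a constant moves a pair of masses \<open>p\<close>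
  onto \<open>V\<^sub>\<Theta>\<close>, where \<open>\<Theta>\<^sup>2 I = (8/27) p A\<^sup>3/B\<^sup>2 + \<Theta>\<^sup>4 D/(2p)\<close>. Hence \<open>\<Theta>\<^sup>2 m\<^sub>\<Theta>\<close> is nondecreasing, it is bounded by
  its value \<open>c\<close> over \<open>y\<close>-independent pairs, and \<open>\<Theta>\<^sub>0\<close> is the supremum of the \<open>\<Theta>\<close> with \<open>\<Theta>\<^sup>2 m\<^sub>\<Theta> < c\<close>. For small \<open>\<Theta>\<close> the
  trial functions \<open>f(x) cos y\<close> give strict inequality.

  The threshold is finite because \<open>B \<le> A\<^bsup>3/2\<^esup> (k + C D/k)\<close>, with \<open>k\<close> a multiple of \<open>\<surd>s\<close> given by the sharp
  constant on \<open>\<real>\<^sup>3\<close>. To see this, split \<open>(u,v)\<close> into its \<open>y\<close>-average and a remainder of zero mean in \<open>y\<close>. The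
  average obeys the sharp inequality on \<open>\<real>\<^sup>3\<close>; a rotation of the pair removes the constraint of equal masses.
  The remainder obeys the anisotropic critical Sobolev inequality
  \<open>(\<integral>r\<^sup>4)\<^sup>2 \<le> const \<cdot> A\<^sub>r\<^sup>3 D\<close>, the cross term cubic in the average vanishes, and Young's inequality
  absorbs the other terms into the part of \<open>A\<close> that belongs to the remainder. No minimizers are needed.
\<close>

section \<open>Weak derivatives and convolution\<close>

text \<open>The circle has a fixed length, so only x can be dilated. Under this dilation
  \<open>A^3/B^2\<close> is invariant while \<open>D\<close> scales like the mass; hence lowering
  the mass never raises \<open>\<Theta>^2 I\<close>, and it lowers it strictly as soon as
  \<open>D > 0\<close>. This strictness also settles the minimizers above the threshold.

  For a finite threshold the correction to the sharp inequality has to be of first order in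
  \<open>D\<close>: the energy contains \<open>D/2\<close>, which for small \<open>D\<close> could
  not pay for a loss of lower order such as \<open>sqrt D\<close>. Estimating the cubic cross term
  by Hoelder would produce a loss of lower order, so its exact cancellation is decisive.

  The anisotropic inequality is the classical argument along coordinate lines in four variables,
  except that in y one starts from a zero of the slice instead of from infinity. Zeros and slice
  means require continuous functions, so pairs are mollified first, split into mean and remainder
  afterwards, and Fatou's lemma closes the argument. The same inequality, applied to antiperiodic
  functions, yields the Gagliardo-Nirenberg inequality on R^3 and thereby
  \<open>m_R 1 > 0\<close>.\<close>

definition wderiv :: "('a::euclidean_space \<Rightarrow> real) \<Rightarrow> ('a \<Rightarrow> real) \<Rightarrow> 'a \<Rightarrow> bool" where
  "wderiv f g b \<longleftrightarrow> (\<forall>\<phi>. test_fun \<phi> \<longrightarrow>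
     (LINT z|lborel. f z * frechet_derivative \<phi> (at z) b) = - (LINT z|lborel. g z * \<phi> z))"

lemma weak_grad_iff: "weak_grad f G \<longleftrightarrow> (\<forall>b\<in>Basis. wderiv f (\<lambda>z. G z \<bullet> b) b)"
  unfolding weak_grad_def wderiv_def by blast

definition loc_int :: "('a::euclidean_space \<Rightarrow> real) \<Rightarrow> bool" where
  "loc_int f \<longleftrightarrow> f \<in> borel_measurable borel \<and> (\<forall>r. set_integrable lborel (cball 0 r) f)"

definition ckernel :: "('a::euclidean_space \<Rightarrow> real) \<Rightarrow> bool" where
  "ckernel K \<longleftrightarrow> continuous_on UNIV K \<and> (\<exists>r. \<forall>z. norm z > r \<longrightarrow> K z = 0)"

definition conv :: "('a::euclidean_space \<Rightarrow> real) \<Rightarrow> ('a \<Rightarrow> real) \<Rightarrow> 'a \<Rightarrow> real" where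
  "conv f K z = (LINT w|lborel. f w * K (z - w))"

text \<open>Continuous differentiability in one direction only: convolution produces it one
  direction at a time, and integration along lines asks for no more.\<close>

definition C1dir :: "('a::euclidean_space \<Rightarrow> real) \<Rightarrow> ('a \<Rightarrow> real) \<Rightarrow> 'a \<Rightarrow> bool" where
  "C1dir f f' b \<longleftrightarrow> continuous_on UNIV f \<and> continuous_on UNIV f' \<and>
     (\<forall>z. ((\<lambda>t. f (z + t *\<^sub>R b)) has_real_derivative f' z) (at 0))"

lemma loc_int_measurable [measurable_dest]: "loc_int f \<Longrightarrow> f \<in> borel_measurable borel"
  by (simp add: loc_int_def)

lemma ckernel_measurable [measurable_dest]: "ckernel K \<Longrightarrow> K \<in> borel_measurable borel"
  by (auto simp: ckernel_def intro: borel_measurable_continuous_onI)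

lemma ckernel_bounded:
  assumes "ckernel K" obtains M where "\<And>z. \<bar>K z\<bar> \<le> M" "M \<ge> 0"
proof -
  obtain r where r: "\<And>z. norm z > r \<Longrightarrow> K z = 0" and c: "continuous_on UNIV K"
    using assms by (auto simp: ckernel_def)
  have "bounded (K ` cball 0 r)"
    by (intro compact_imp_bounded compact_continuous_image continuous_on_subset[OF c]) auto
  then obtain M where M: "\<And>z. z \<in> cball 0 r \<Longrightarrow> \<bar>K z\<bar> \<le> M"
    unfolding bounded_iff real_norm_def by (metis imageI)
  have "\<bar>K z\<bar> \<le> max M 0" for z
    using M[of z] r[of z] by (cases "norm z \<le> r") auto
  then show ?thesis using that[of "max M 0"] by auto
qed

lemma ckernel_reflect: "ckernel K \<Longrightarrow> ckernel (\<lambda>w. K (z - w))"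
proof -
  assume K: "ckernel K"
  then obtain r where r: "\<And>z. norm z > r \<Longrightarrow> K z = 0" by (auto simp: ckernel_def)
  have "K (z - w) = 0" if "norm w > r + norm z" for w
    by (rule r) (use that norm_triangle_ineq2[of w z] in \<open>simp add: norm_minus_commute\<close>)
  moreover have "continuous_on UNIV (\<lambda>w. K (z - w))"
    by (rule continuous_on_compose2[of UNIV K]) (use K in \<open>auto simp: ckernel_def intro!: continuous_intros\<close>)
  ultimately show ?thesis unfolding ckernel_def by blast
qed

lemma loc_int_dominate:
  assumes "loc_int f"
  shows "integrable lborel (\<lambda>w. M * (indicator (cball 0 r) w * \<bar>f w\<bar>))"
proof -
  have "set_integrable lborel (cball 0 r) f" using assms by (simp add: loc_int_def)
  then have "integrable lborel (\<lambda>w. \<bar>indicator (cball 0 r) w * f w\<bar>)"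
    unfolding set_integrable_def by (simp add: integrable_abs)
  then show ?thesis by (simp add: abs_mult)
qed

lemma loc_int_ckernel_integrable:
  assumes f: "loc_int f" and K: "ckernel K"
  shows "integrable lborel (\<lambda>w. f w * K w)"
proof -
  obtain M where M: "\<And>z. \<bar>K z\<bar> \<le> M" "M \<ge> 0" using ckernel_bounded[OF K] by blast
  obtain r where r: "\<And>z. norm z > r \<Longrightarrow> K z = 0" using K by (auto simp: ckernel_def)
  note [measurable] = loc_int_measurable[OF f] ckernel_measurable[OF K]
  show ?thesis
  proof (rule Bochner_Integration.integrable_bound[OF loc_int_dominate[OF f, of M r]])
    show "AE w in lborel. norm (f w * K w) \<le> norm (M * (indicator (cball 0 r) w * \<bar>f w\<bar>))"
      using r M by (intro AE_I2) (auto simp: indicator_def abs_mult mult.commute intro!: mult_mono)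
  qed simp
qed

lemma conv_integrable:
  "loc_int f \<Longrightarrow> ckernel K \<Longrightarrow> integrable lborel (\<lambda>w. f w * K (z - w))"
  by (intro loc_int_ckernel_integrable ckernel_reflect)

lemma continuous_conv:
  assumes f: "loc_int f" and K: "ckernel K"
  shows "continuous_on UNIV (conv f K)"
proof (rule continuous_on_sequentiallyI)
  fix X and z :: 'a assume X: "X \<longlonglongrightarrow> z"
  obtain M where M: "\<And>z. \<bar>K z\<bar> \<le> M" "M \<ge> 0" using ckernel_bounded[OF K] by blast
  obtain r where r: "\<And>z. norm z > r \<Longrightarrow> K z = 0" using K by (auto simp: ckernel_def)
  note [measurable] = loc_int_measurable[OF f] ckernel_measurable[OF K]
  obtain C where C: "\<And>n. norm (X n) \<le> C"
    using convergent_imp_bounded[OF X] by (auto simp: bounded_iff)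
  have "(\<lambda>n. LINT w|lborel. f w * K (X n - w)) \<longlonglongrightarrow> (LINT w|lborel. f w * K (z - w))"
  proof (rule integral_dominated_convergence[OF _ _ loc_int_dominate[OF f, of M "C + r"]])
    show "AE w in lborel. (\<lambda>n. f w * K (X n - w)) \<longlonglongrightarrow> f w * K (z - w)"
    proof (intro AE_I2 tendsto_intros)
      fix w show "(\<lambda>n. K (X n - w)) \<longlonglongrightarrow> K (z - w)"
        by (rule continuous_on_tendsto_compose[of UNIV K])
           (use K X in \<open>auto simp: ckernel_def intro!: tendsto_intros\<close>)
    qed
    show "AE w in lborel. norm (f w * K (X n - w)) \<le> M * (indicator (cball 0 (C + r)) w * \<bar>f w\<bar>)" for n
    proof (intro AE_I2)
      fix w
      have "K (X n - w) = 0" if "norm w > C + r"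
        by (rule r) (use that C[of n] norm_triangle_ineq2[of w "X n"] in \<open>simp add: norm_minus_commute\<close>)
      then show "norm (f w * K (X n - w)) \<le> M * (indicator (cball 0 (C + r)) w * \<bar>f w\<bar>)"
        using M(1)[of "X n - w"] M(2)
        by (auto simp: indicator_def abs_mult mult.commute[of M] not_le intro!: mult_left_mono)
    qed
  qed simp_all
  then show "(\<lambda>n. conv f K (X n)) \<longlonglongrightarrow> conv f K z" by (simp add: conv_def)
qed

lemma C1dir_line:
  assumes "C1dir f f' b"
  shows "((\<lambda>t. f (z + t *\<^sub>R b)) has_real_derivative f' (z + t *\<^sub>R b)) (at t)"
proof -
  have "((\<lambda>s. f ((z + t *\<^sub>R b) + s *\<^sub>R b)) has_real_derivative f' (z + t *\<^sub>R b)) (at 0)"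
    using assms by (simp add: C1dir_def)
  then have "((\<lambda>s. f ((z + t *\<^sub>R b) + s *\<^sub>R b)) has_real_derivative f' (z + t *\<^sub>R b)) (at (t + - t))"
    by simp
  then have "((\<lambda>s. f ((z + t *\<^sub>R b) + (s + - t) *\<^sub>R b)) has_real_derivative f' (z + t *\<^sub>R b)) (at t)"
    by (subst (asm) DERIV_shift)
  then show ?thesis by (simp add: algebra_simps)
qed

lemma C1dir_lipschitz:
  assumes c: "C1dir f f' b" and M: "\<And>z. \<bar>f' z\<bar> \<le> M"
  shows "\<bar>f (z + t *\<^sub>R b) - f z\<bar> \<le> M * \<bar>t\<bar>"
proof -
  have "norm (f (z + t *\<^sub>R b) - f (z + 0 *\<^sub>R b)) \<le> M * norm (t - 0)"
    by (rule field_differentiable_bound[where S=UNIV and f'="\<lambda>t. f' (z + t *\<^sub>R b)"])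
       (use M C1dir_line[OF c] in auto)
  then show ?thesis by simp
qed

text \<open>The derivative falls on the kernel. Its difference quotients converge pointwise and are
  bounded by a bound of \<open>K'\<close> through the mean value inequality, so local integrability
  of \<open>f\<close> suffices for dominated convergence.\<close>

lemma conv_has_derivative:
  assumes f: "loc_int f" and K: "ckernel K" and K': "ckernel K'" and c: "C1dir K K' b"
  shows "((\<lambda>t. conv f K (z + t *\<^sub>R b)) has_real_derivative conv f K' z) (at 0)"
  unfolding has_field_derivative_iff tendsto_at_iff_sequentially
proof (intro allI impI)
  fix X :: "nat \<Rightarrow> real" assume X0: "\<forall>i. X i \<in> UNIV - {0}" and X: "X \<longlonglongrightarrow> 0"
  obtain M where M: "\<And>z. \<bar>K' z\<bar> \<le> M" "M \<ge> 0" using ckernel_bounded[OF K'] by blast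
  obtain r0 where r0: "\<And>z. norm z > r0 \<Longrightarrow> K z = 0" using K by (auto simp: ckernel_def)
  note [measurable] = loc_int_measurable[OF f] ckernel_measurable[OF K] ckernel_measurable[OF K']
  obtain C where C: "\<And>n. \<bar>X n\<bar> \<le> C"
    using convergent_imp_bounded[OF X] by (auto simp: bounded_iff)
  have C0: "C \<ge> 0" using C[of 0] by linarith
  \<comment> \<open>All difference quotients with step at most \<open>C\<close> vanish for
    \<open>w\<close> outside the ball of this radius, so one dominating function serves the whole
    sequence.\<close>
  define \<rho> where "\<rho> = norm z + C * norm b + r0"
  have lim: "(\<lambda>n. LINT w|lborel. f w * ((K (z - w + X n *\<^sub>R b) - K (z - w)) / X n)) \<longlonglongrightarrow> (LINT w|lborel. f w * K' (z - w))"
  proof (rule integral_dominated_convergence[OF _ _ loc_int_dominate[OF f, of M \<rho>]])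
    show "AE w in lborel. (\<lambda>n. f w * ((K (z - w + X n *\<^sub>R b) - K (z - w)) / X n)) \<longlonglongrightarrow> f w * K' (z - w)"
    proof (intro AE_I2 tendsto_intros)
      fix w
      have "((\<lambda>t. K (z - w + t *\<^sub>R b)) has_real_derivative K' (z - w)) (at 0)"
        using c by (simp add: C1dir_def)
      then show "(\<lambda>n. (K (z - w + X n *\<^sub>R b) - K (z - w)) / X n) \<longlonglongrightarrow> K' (z - w)"
        unfolding has_field_derivative_iff tendsto_at_iff_sequentially
        using X0 X by (simp add: o_def)
    qed
    show "AE w in lborel. norm (f w * ((K (z - w + X n *\<^sub>R b) - K (z - w)) / X n))
        \<le> M * (indicator (cball 0 \<rho>) w * \<bar>f w\<bar>)" for n
    proof (intro AE_I2)
      fix w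
      have xb: "norm (X n *\<^sub>R b) \<le> C * norm b" using C[of n] by (simp add: mult_right_mono)
      have cb: "0 \<le> C * norm b" using C0 by simp
      have "K (z - w + X n *\<^sub>R b) = 0 \<and> K (z - w) = 0" if "norm w > \<rho>"
      proof -
        have "norm w \<le> norm (z - w) + norm z"
          using norm_triangle_ineq[of "w - z" z] by (simp add: norm_minus_commute)
        moreover have "norm (z - w) \<le> norm (z - w + X n *\<^sub>R b) + norm (X n *\<^sub>R b)"
          using norm_triangle_ineq4[of "z - w + X n *\<^sub>R b" "X n *\<^sub>R b"] by simp
        ultimately show ?thesis
          using that xb cb by (intro conjI r0) (simp_all add: \<rho>_def)
      qed
      moreover have "\<bar>(K (z - w + X n *\<^sub>R b) - K (z - w)) / X n\<bar> \<le> M"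
        using C1dir_lipschitz[OF c M(1), of "z - w" "X n"] X0[rule_format, of n]
        by (simp add: divide_le_eq)
      ultimately show "norm (f w * ((K (z - w + X n *\<^sub>R b) - K (z - w)) / X n))
        \<le> M * (indicator (cball 0 \<rho>) w * \<bar>f w\<bar>)"
        by (cases "norm w \<le> \<rho>")
           (simp_all add: indicator_def abs_mult mult.commute[of M] not_le mult_left_mono
              del: abs_divide times_divide_eq_right)
    qed
  qed simp_all
  have q: "(conv f K (z + X n *\<^sub>R b) - conv f K z) / X n
      = (LINT w|lborel. f w * ((K (z - w + X n *\<^sub>R b) - K (z - w)) / X n))" for n
  proof -
    have "conv f K (z + X n *\<^sub>R b) - conv f K z = (LINT w|lborel. f w * K (z + X n *\<^sub>R b - w) - f w * K (z - w))"
      unfolding conv_def by (rule Bochner_Integration.integral_diff[symmetric])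
        (intro conv_integrable f K)+
    then show ?thesis
      by (simp flip: integral_divide_zero add: algebra_simps)
  qed
  show "((\<lambda>y. (conv f K (z + y *\<^sub>R b) - conv f K (z + 0 *\<^sub>R b)) / (y - 0)) \<circ> X) \<longlonglongrightarrow> conv f K' z"
    using lim unfolding q[symmetric] by (simp add: o_def conv_def)
qed

lemma loc_int_continuous: "continuous_on UNIV f \<Longrightarrow> loc_int f"
  unfolding loc_int_def set_integrable_def
  using borel_measurable_continuous_onI borel_integrable_compact[OF compact_cball continuous_on_subset]
  by blast

lemma integral_ckernel_shift:
  fixes K :: "'a::euclidean_space \<Rightarrow> real"
  assumes [measurable]: "K \<in> borel_measurable borel"
  shows "(LINT w|lborel. K (z - w)) = (LINT w|lborel. K w)"
    "(\<integral>\<^sup>+w. ennreal (K (z - w)) \<partial>lborel) = (\<integral>\<^sup>+w. ennreal (K w) \<partial>lborel)"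
proof -
  have *: "lborel = distr lborel borel (\<lambda>w::'a. z - w)"
    using lborel_affine[of "-1" z] by (simp add: density_1)
  show "(LINT w|lborel. K (z - w)) = (LINT w|lborel. K w)"
    by (subst (2) *, subst integral_distr) simp_all
  show "(\<integral>\<^sup>+w. ennreal (K (z - w)) \<partial>lborel) = (\<integral>\<^sup>+w. ennreal (K w) \<partial>lborel)"
    by (subst (2) *, subst nn_integral_distr) simp_all
qed

text \<open>Convolving the constant 1 with \<open>K\<close> gives a constant function, and its
  derivative is the integral of \<open>K'\<close>. This is the integration by parts behind the weak
  derivatives of smooth functions.\<close>

lemma integral_deriv_zero:
  assumes K: "ckernel K" and K': "ckernel K'" and c: "C1dir K K' b"
  shows "(LINT z|lborel. K' z) = 0"
proof -
  have one: "loc_int (\<lambda>_. 1)" by (rule loc_int_continuous) simp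
  have "conv (\<lambda>_. 1) K = (\<lambda>_. LINT w|lborel. K w)" if "ckernel K" for K :: "'a \<Rightarrow> real"
    using integral_ckernel_shift(1)[OF ckernel_measurable[OF that]] by (simp add: conv_def fun_eq_iff)
  from conv_has_derivative[OF one K K' c, of 0, unfolded this[OF K] this[OF K']]
  show ?thesis by (rule DERIV_unique) simp
qed

lemma C1dir_mult:
  "C1dir f f' b \<Longrightarrow> C1dir g g' b \<Longrightarrow> C1dir (\<lambda>z. f z * g z) (\<lambda>z. f' z * g z + f z * g' z) b"
  unfolding C1dir_def
  by (intro conjI allI continuous_on_add continuous_on_mult) (auto intro!: derivative_eq_intros)

lemma test_fun_C1dir:
  assumes t: "test_fun \<phi>" and b: "b \<in> Basis"
  shows "C1dir \<phi> (\<lambda>z. frechet_derivative \<phi> (at z) b) b" and "ckernel \<phi>"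
    and "ckernel (\<lambda>z. frechet_derivative \<phi> (at z) b)"
proof -
  have d: "\<And>z. (\<phi> has_derivative frechet_derivative \<phi> (at z)) (at z)"
    using t by (simp add: test_fun_def differentiable_on_def frechet_derivative_works)
  then have c: "continuous_on UNIV \<phi>"
    by (meson continuous_at_imp_continuous_on has_derivative_continuous)
  have c': "continuous_on UNIV (\<lambda>z. frechet_derivative \<phi> (at z) b)" using t b by (simp add: test_fun_def)
  obtain r where r: "\<And>z. norm z > r \<Longrightarrow> \<phi> z = 0" using t by (auto simp: test_fun_def)
  then show "ckernel \<phi>" using c by (auto simp: ckernel_def)
  have "frechet_derivative \<phi> (at z) b = 0" if "norm z > r" for z
  proof -
    have "open {z::'a. norm z > r}" by (intro open_Collect_less continuous_on_const continuous_on_norm_id)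
    then have "(\<phi> has_derivative (\<lambda>_. 0)) (at z)"
      using that r by (rule_tac has_derivative_transform_within_open[of "\<lambda>_. 0" _ z UNIV "{z. norm z > r}"]) auto
    then have "(\<lambda>_. 0) = frechet_derivative \<phi> (at z)" by (rule frechet_derivative_at)
    then show ?thesis by (metis)
  qed
  then show "ckernel (\<lambda>z. frechet_derivative \<phi> (at z) b)" using c' by (auto simp: ckernel_def)
  have "((\<lambda>t. \<phi> (z + t *\<^sub>R b)) has_real_derivative frechet_derivative \<phi> (at z) b) (at 0)" for z
  proof -
    have 1: "((\<lambda>t. z + t *\<^sub>R b) has_derivative (\<lambda>t. t *\<^sub>R b)) (at 0)" by (auto intro!: derivative_eq_intros)
    have "((\<lambda>t. \<phi> (z + t *\<^sub>R b)) has_derivative (\<lambda>t. frechet_derivative \<phi> (at z) (t *\<^sub>R b))) (at 0)"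
      using has_derivative_compose[OF 1, of \<phi>] d by simp
    moreover have "(\<lambda>t. frechet_derivative \<phi> (at z) (t *\<^sub>R b)) = (*) (frechet_derivative \<phi> (at z) b)"
      using linear_cmul[OF has_derivative_linear[OF d]] by (simp add: fun_eq_iff)
    ultimately show ?thesis by (simp add: has_field_derivative_def)
  qed
  then show "C1dir \<phi> (\<lambda>z. frechet_derivative \<phi> (at z) b) b" using c c' by (simp add: C1dir_def)
qed

lemma ckernel_mult: "continuous_on UNIV f \<Longrightarrow> ckernel K \<Longrightarrow> ckernel (\<lambda>z. f z * K z)"
  unfolding ckernel_def by (auto intro: continuous_on_mult)

text \<open>The product rule for \<open>f \<phi>\<close>, which has bounded support, reduces the
  claim to \<open>integral_deriv_zero\<close>.\<close>

lemma C1dir_wderiv: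
  assumes f: "C1dir f f' b" and b: "b \<in> Basis"
  shows "wderiv f f' b"
  unfolding wderiv_def
proof (intro allI impI)
  fix \<phi> :: "'a \<Rightarrow> real" assume t: "test_fun \<phi>"
  let ?\<phi>' = "\<lambda>z. frechet_derivative \<phi> (at z) b"
  note \<phi> = test_fun_C1dir[OF t b]
  have c: "continuous_on UNIV f" "continuous_on UNIV f'" using f by (auto simp: C1dir_def)
  have k: "ckernel (\<lambda>z. f' z * \<phi> z)" "ckernel (\<lambda>z. f z * ?\<phi>' z)" "ckernel (\<lambda>z. f z * \<phi> z)"
    using c \<phi> by (auto intro: ckernel_mult)
  have "ckernel (\<lambda>z. f' z * \<phi> z + f z * ?\<phi>' z)"
  proof -
    obtain r1 r2 where "\<And>z. norm z > r1 \<Longrightarrow> f' z * \<phi> z = 0" "\<And>z. norm z > r2 \<Longrightarrow> f z * ?\<phi>' z = 0"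
      using k(1,2) unfolding ckernel_def by blast
    then have "\<forall>z. norm z > max r1 r2 \<longrightarrow> f' z * \<phi> z + f z * ?\<phi>' z = 0"
      by (metis add_0 max_less_iff_conj)
    moreover have "continuous_on UNIV (\<lambda>z. f' z * \<phi> z + f z * ?\<phi>' z)"
      using k(1,2) unfolding ckernel_def by (intro continuous_on_add) auto
    ultimately show ?thesis unfolding ckernel_def by blast
  qed
  from integral_deriv_zero[OF k(3) this C1dir_mult[OF f \<phi>(1)]]
  have "(LINT z|lborel. f' z * \<phi> z + f z * ?\<phi>' z) = 0" .
  moreover have "(LINT z|lborel. f' z * \<phi> z + f z * ?\<phi>' z)
     = (LINT z|lborel. f' z * \<phi> z) + (LINT z|lborel. f z * ?\<phi>' z)"
    using c \<phi> by (intro Bochner_Integration.integral_add loc_int_ckernel_integrable loc_int_continuous) auto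
  ultimately show "(LINT z|lborel. f z * ?\<phi>' z) = - (LINT z|lborel. f' z * \<phi> z)" by simp
qed

section \<open>Mollifiers\<close>

text \<open>The lower bound on \<open>L\<close> keeps the support bounded. \<open>L\<close> may map
  into a larger space: besides reflections and dilations this covers the restriction of a test
  function to a slice.\<close>

lemma test_fun_affine:
  fixes \<phi> :: "'a::euclidean_space \<Rightarrow> real" and L :: "'b::euclidean_space \<Rightarrow> 'a"
  assumes t: "test_fun \<phi>" and L: "linear L" and k: "\<And>w. norm w \<le> k * norm (L w)" "k > 0"
  shows "test_fun (\<lambda>w. \<phi> (a + L w))"
    and "frechet_derivative (\<lambda>w. \<phi> (a + L w)) (at w) b = frechet_derivative \<phi> (at (a + L w)) (L b)"
proof -
  have d: "\<And>z. (\<phi> has_derivative frechet_derivative \<phi> (at z)) (at z)"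
    using t by (simp add: test_fun_def differentiable_on_def frechet_derivative_works)
  have "((\<lambda>w. a + L w) has_derivative L) (at w)" for w
    using has_derivative_add[OF has_derivative_const[of a] linear_imp_has_derivative[OF L, of "at w"]] by simp
  then have D: "((\<lambda>w. \<phi> (a + L w)) has_derivative (\<lambda>b. frechet_derivative \<phi> (at (a + L w)) (L b))) (at w)" for w
    using has_derivative_compose d by blast
  have F: "frechet_derivative (\<lambda>w. \<phi> (a + L w)) (at w) b = frechet_derivative \<phi> (at (a + L w)) (L b)" for w b
    using fun_cong[OF frechet_derivative_at[OF D[of w]], of b] by simp
  then show "frechet_derivative (\<lambda>w. \<phi> (a + L w)) (at w) b = frechet_derivative \<phi> (at (a + L w)) (L b)" .
  have diff: "(\<lambda>w. \<phi> (a + L w)) differentiable_on UNIV"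
    using D unfolding differentiable_on_def differentiable_def by blast
  have cont: "continuous_on UNIV (\<lambda>w. frechet_derivative \<phi> (at (a + L w)) (L b))" for b
  proof -
    \<comment> \<open>Continuity is given for derivatives along basis vectors only, so the direction
      \<open>L b\<close> is expanded in the basis.\<close>
    have "frechet_derivative \<phi> (at z) (L b) = (\<Sum>j\<in>Basis. (L b \<bullet> j) * frechet_derivative \<phi> (at z) j)" for z
    proof -
      interpret linear "frechet_derivative \<phi> (at z)" using has_derivative_linear[OF d] .
      have "frechet_derivative \<phi> (at z) (\<Sum>j\<in>Basis. (L b \<bullet> j) *\<^sub>R j) = (\<Sum>j\<in>Basis. (L b \<bullet> j) * frechet_derivative \<phi> (at z) j)"
        by (simp add: sum scale)
      then show ?thesis by (simp add: euclidean_representation)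
    qed
    moreover have "continuous_on UNIV (\<lambda>w. frechet_derivative \<phi> (at (a + L w)) j)" if "j \<in> Basis" for j
      by (rule continuous_on_compose2[of UNIV "\<lambda>z. frechet_derivative \<phi> (at z) j"])
         (use t that continuous_on_add[OF continuous_on_const linear_continuous_on[OF L[unfolded linear_conv_bounded_linear]]] in \<open>auto simp: test_fun_def\<close>)
    ultimately show ?thesis
      by (simp add: continuous_on_sum continuous_on_mult_left)
  qed
  obtain r where r: "\<And>z. norm z > r \<Longrightarrow> \<phi> z = 0" using t by (auto simp: test_fun_def)
  have "\<phi> (a + L w) = 0" if "norm w > k * (r + norm a)" for w
  proof (rule r)
    have "k * (r + norm a) < k * norm (L w)" using k(1)[of w] that by simp
    then have "r + norm a < norm (L w)" using k(2) by simp
    then show "r < norm (a + L w)"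
      using norm_triangle_ineq4[of "a + L w" a] by simp
  qed
  then show "test_fun (\<lambda>w. \<phi> (a + L w))"
    unfolding test_fun_def F using diff cont by blast
qed

lemma test_fun_cmult:
  assumes t: "test_fun \<phi>"
  shows "test_fun (\<lambda>w. c * \<phi> w)"
proof -
  have d: "\<And>z. (\<phi> has_derivative frechet_derivative \<phi> (at z)) (at z)"
    using t by (simp add: test_fun_def differentiable_on_def frechet_derivative_works)
  have D: "((\<lambda>w. c * \<phi> w) has_derivative (\<lambda>b. c * frechet_derivative \<phi> (at w) b)) (at w)" for w
    using has_derivative_mult_right[OF d] .
  have F: "frechet_derivative (\<lambda>w. c * \<phi> w) (at w) b = c * frechet_derivative \<phi> (at w) b" for w b
    using fun_cong[OF frechet_derivative_at[OF D[of w]], of b] by simp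
  have diff: "(\<lambda>w. c * \<phi> w) differentiable_on UNIV"
    using D unfolding differentiable_on_def differentiable_def by blast
  show ?thesis
    unfolding test_fun_def F using diff t unfolding test_fun_def by (auto intro!: continuous_on_mult_left)
qed

text \<open>Squaring the positive part makes it continuously differentiable across the unit sphere,
  which is the smoothness that \<open>test_fun\<close> asks for.\<close>

lemma test_fun_radial_bump: "test_fun (\<lambda>w::'a::euclidean_space. (max 0 (1 - w \<bullet> w))\<^sup>2)"
proof -
  have q: "((\<lambda>s::real. (max 0 s)\<^sup>2) has_real_derivative 2 * max 0 s) (at s)" for s
  proof (cases "s = 0")
    case False
    then show ?thesis
    proof (cases "s > 0")
      case True
      have "((\<lambda>s::real. s\<^sup>2) has_real_derivative 2 * max 0 s) (at s)"
        using True by (auto intro!: derivative_eq_intros)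
      then show ?thesis
        by (rule has_field_derivative_transform_within_open[of _ _ _ "{0<..}"]) (use True in auto)
    next
      case False
      have "((\<lambda>s::real. 0) has_real_derivative 2 * max 0 s) (at s)"
        using False by (auto intro!: derivative_eq_intros)
      then show ?thesis
        by (rule has_field_derivative_transform_within_open[of _ _ _ "{..<0}"]) (use False \<open>s \<noteq> 0\<close> in auto)
    qed
  next
    case True
    have "((\<lambda>h::real. ((max 0 h)\<^sup>2 - 0) / h) \<longlongrightarrow> 0) (at 0)"
    proof (rule Lim_null_comparison)
      show "\<forall>\<^sub>F h::real in at 0. norm (((max 0 h)\<^sup>2 - 0) / h) \<le> \<bar>h\<bar>"
        by (rule always_eventually) (auto simp: max_def power2_eq_square)
      show "((\<lambda>h::real. \<bar>h\<bar>) \<longlongrightarrow> 0) (at 0)"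
        by (rule tendsto_eq_intros | simp)+
    qed
    then show ?thesis using True by (simp add: has_field_derivative_iff)
  qed
  let ?f = "\<lambda>w::'a. (max 0 (1 - w \<bullet> w))\<^sup>2"
  have D: "(?f has_derivative (\<lambda>b. (2 * max 0 (1 - w \<bullet> w)) * (- (2 * (w \<bullet> b))))) (at w)" for w
  proof -
    have "((\<lambda>w::'a. 1 - w \<bullet> w) has_derivative (\<lambda>b. - (2 * (w \<bullet> b)))) (at w)"
      by (auto intro!: derivative_eq_intros simp: inner_commute)
    from has_derivative_compose[OF this q[of "1 - w \<bullet> w", unfolded has_field_derivative_def]]
    show ?thesis by simp
  qed
  have F: "frechet_derivative ?f (at w) b = (2 * max 0 (1 - w \<bullet> w)) * (- (2 * (w \<bullet> b)))" for w b
    using fun_cong[OF frechet_derivative_at[OF D[of w]], of b] by simp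
  have diff: "?f differentiable_on UNIV"
    using D unfolding differentiable_on_def differentiable_def by blast
  have "?f w = 0" if "norm w > 1" for w
  proof -
    have "1 < (norm w)\<^sup>2" using that by simp
    then show ?thesis by (simp add: power2_norm_eq_inner max_def)
  qed
  then show ?thesis
    unfolding test_fun_def F using diff
    by (auto intro!: continuous_intros exI[of _ 1])
qed

text \<open>The kernel is supported in the box \<open>[-1,0]\<^sup>n\<close>, so that its dilates average over the corner
  boxes for which the library provides the Lebesgue differentiation theorem.\<close>

definition bump :: "'a::euclidean_space \<Rightarrow> real" where
  "bump w = (max 0 (1 - (2 *\<^sub>R w + One) \<bullet> (2 *\<^sub>R w + One)))\<^sup>2"

definition mol :: "real \<Rightarrow> 'a::euclidean_space \<Rightarrow> real" where
  "mol h w = bump (w /\<^sub>R h) / (h ^ DIM('a) * (LINT w|lborel. bump (w::'a)))"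

lemma test_fun_bump: "test_fun (bump :: 'a::euclidean_space \<Rightarrow> real)"
proof -
  have "test_fun (\<lambda>w::'a. (\<lambda>w. (max 0 (1 - w \<bullet> w))\<^sup>2) (One + 2 *\<^sub>R w))"
    by (rule test_fun_affine(1)[where k=1, OF test_fun_radial_bump]) (auto intro!: linear_compose_scale_right linear_ident)
  then show ?thesis by (simp add: bump_def[abs_def] add.commute)
qed

lemma bump_support: "bump (w::'a::euclidean_space) \<noteq> 0 \<Longrightarrow> w \<in> cbox (- One) 0"
proof -
  assume "bump w \<noteq> 0"
  then have "(2 *\<^sub>R w + One) \<bullet> (2 *\<^sub>R w + One) < 1" by (simp add: bump_def max_def split: if_splits)
  then have n: "norm (2 *\<^sub>R w + One) < 1"
    by (metis norm_eq_sqrt_inner real_sqrt_lt_1_iff)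
  show ?thesis
    unfolding mem_box
  proof (intro ballI conjI)
    fix i :: 'a assume i: "i \<in> Basis"
    have "\<bar>(2 *\<^sub>R w + One) \<bullet> i\<bar> < 1" using Basis_le_norm[OF i, of "2 *\<^sub>R w + One"] n by linarith
    then have "\<bar>2 * (w \<bullet> i) + 1\<bar> < 1" using i by (simp add: inner_simps)
    then show "- One \<bullet> i \<le> w \<bullet> i" "w \<bullet> i \<le> 0 \<bullet> i" using i by (simp_all add: inner_simps)
  qed
qed

lemma bump_nonneg: "bump w \<ge> 0" by (simp add: bump_def)
lemma bump_le_1: "bump w \<le> 1"
  unfolding bump_def by (rule power_le_one) auto

lemma kernel_integrable: "ckernel K \<Longrightarrow> integrable lborel K"
  using loc_int_ckernel_integrable[OF loc_int_continuous[of "\<lambda>_. 1"], of K] by simp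

lemma continuous_AE_zero:
  fixes f :: "'a::euclidean_space \<Rightarrow> real"
  assumes "continuous_on UNIV f" "AE z in lborel. f z = 0" shows "f z = 0"
proof -
  have "closed {z. f z = 0}"
    using continuous_closed_vimage[of "{0}" f] assms(1) by (simp add: vimage_def continuous_on_eq_continuous_at)
  moreover have "AE z in lebesgue. z \<in> {z. f z = 0}" using assms(2) by (simp add: AE_completion)
  ultimately show ?thesis using mem_closed_if_AE_lebesgue by blast
qed

lemma bump_integral_pos: "(LINT w|lborel. bump (w::'a::euclidean_space)) > 0"
proof -
  have k: "ckernel (bump :: 'a \<Rightarrow> real)"
    using test_fun_C1dir(2)[OF test_fun_bump] SOME_Basis by blast
  have "(LINT w|lborel. bump (w::'a)) \<noteq> 0"
  proof
    assume "(LINT w|lborel. bump (w::'a)) = 0"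
    then have "AE w in lborel. bump (w::'a) = 0"
      using integral_nonneg_eq_0_iff_AE[OF kernel_integrable[OF k]] bump_nonneg by auto
    \<comment> \<open>This point is the centre of the support, where \<open>bump\<close> equals
      1.\<close>
    from continuous_AE_zero[OF _ this, of "(-1/2) *\<^sub>R One"] show False
      using k by (simp add: bump_def ckernel_def)
  qed
  moreover have "(LINT w|lborel. bump (w::'a)) \<ge> 0" by (simp add: bump_nonneg)
  ultimately show ?thesis by simp
qed

lemma test_fun_mol: "h > 0 \<Longrightarrow> test_fun (mol h :: 'a::euclidean_space \<Rightarrow> real)"
proof -
  assume h: "h > 0"
  have "test_fun (\<lambda>w::'a. bump (0 + w /\<^sub>R h))"
    by (rule test_fun_affine(1)[where k=h, OF test_fun_bump]) (use h in \<open>auto intro!: linear_compose_scale_right linear_ident simp: field_simps\<close>)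
  from test_fun_cmult[OF this, of "1 / (h ^ DIM('a) * (LINT w|lborel. bump (w::'a)))"]
  show ?thesis by (simp add: mol_def[abs_def])
qed

lemma ckernel_mol: "h > 0 \<Longrightarrow> ckernel (mol h :: 'a::euclidean_space \<Rightarrow> real)"
  using test_fun_C1dir(2)[OF test_fun_mol] SOME_Basis by blast

lemma mol_nonneg: "h > 0 \<Longrightarrow> mol h (w::'a::euclidean_space) \<ge> 0"
  using bump_integral_pos[where 'a='a] by (simp add: mol_def bump_nonneg)

lemma mol_bound: "h > 0 \<Longrightarrow> mol h (w::'a::euclidean_space) \<le> 1 / (h ^ DIM('a) * (LINT w|lborel. bump (w::'a)))"
  using bump_integral_pos[where 'a='a] by (simp add: mol_def divide_right_mono bump_le_1)

lemma mol_support: "h > 0 \<Longrightarrow> mol h (w::'a::euclidean_space) \<noteq> 0 \<Longrightarrow> w \<in> cbox (- h *\<^sub>R One) 0"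
  using bump_support[of "w /\<^sub>R h"]
  by (auto simp: mol_def mem_box inner_simps field_simps)

lemma mol_integral: "h > 0 \<Longrightarrow> (LINT w|lborel. mol h (w::'a::euclidean_space)) = 1"
proof -
  assume h: "h > 0"
  have [measurable]: "(bump :: 'a \<Rightarrow> real) \<in> borel_measurable borel"
    using test_fun_C1dir(2)[OF test_fun_bump] SOME_Basis ckernel_measurable by blast
  have l: "(lborel :: 'a measure) = density (distr lborel borel (\<lambda>x. 0 + inverse h *\<^sub>R x)) (\<lambda>_. ennreal (\<bar>inverse h\<bar> ^ DIM('a)))"
    by (rule lborel_affine) (use h in auto)
  have "(LINT w|lborel. bump (w::'a)) = inverse h ^ DIM('a) * (LINT w|lborel. bump ((w::'a) /\<^sub>R h))"
    by (subst l, subst integral_density) (use h in \<open>auto simp: integral_distr\<close>)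
  then have "(LINT w|lborel. bump ((w::'a) /\<^sub>R h)) = h ^ DIM('a) * (LINT w|lborel. bump (w::'a))"
    using h by (simp add: field_simps power_inverse)
  then show ?thesis
    using h bump_integral_pos[where 'a='a] by (simp add: mol_def)
qed

section \<open>Lebesgue points and uniqueness of weak derivatives\<close>

lemma loc_int_set_integrable:
  assumes f: "loc_int f" and S: "bounded S" "S \<in> sets borel"
  shows "set_integrable lborel S f"
proof -
  obtain r where "\<forall>x\<in>S. norm x \<le> r" using S(1) by (auto simp: bounded_iff)
  then have "S \<subseteq> cball 0 r" by auto
  then show ?thesis
    using f S(2) by (rule_tac set_integrable_subset[of _ "cball 0 r"]) (auto simp: loc_int_def)
qed

lemma loc_int_diff_const_abs:
  assumes f: "loc_int f" shows "loc_int (\<lambda>w. \<bar>f w - q\<bar>)"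
  unfolding loc_int_def
proof (intro conjI allI)
  note [measurable] = loc_int_measurable[OF f]
  show "(\<lambda>w. \<bar>f w - q\<bar>) \<in> borel_measurable borel" by measurable
  fix r
  have "set_integrable lborel (cball (0::'a) r) (\<lambda>_. q)"
    using loc_int_continuous[of "\<lambda>_::'a. q"] by (simp add: loc_int_def)
  then have "set_integrable lborel (cball 0 r) (\<lambda>w. f w - q)"
    using f by (intro set_integral_diff(1)) (auto simp: loc_int_def)
  then show "set_integrable lborel (cball 0 r) (\<lambda>w. \<bar>f w - q\<bar>)"
    by (rule set_integrable_abs)
qed

text \<open>Convergence of plain averages would not control weighted ones. Hence the differentiation
  theorem is applied to \<open>\<bar>f - q\<bar>\<close> for every rational \<open>q\<close>; the
  union of the exceptional sets is still negligible, and a rational close to \<open>f z\<close> can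
  stand in for \<open>f z\<close>.\<close>

lemma lebesgue_points:
  fixes f :: "'a::euclidean_space \<Rightarrow> real"
  assumes f: "loc_int f"
  shows "AE z in lborel. \<forall>e>0. \<exists>d>0. \<forall>h. 0 < h \<and> h < d \<longrightarrow>
    (LINT w:cbox z (z + h *\<^sub>R One)|lborel. \<bar>f w - f z\<bar>) < e * h ^ DIM('a)"
proof -
  have "\<exists>N. negligible N \<and> (\<forall>x e. x \<notin> N \<and> 0 < e \<longrightarrow> (\<exists>d>0. \<forall>h. 0 < h \<and> h < d \<longrightarrow>
      norm (integral (cbox x (x + h *\<^sub>R One)) (\<lambda>w. \<bar>f w - q\<bar>) /\<^sub>R h ^ DIM('a) - \<bar>f x - q\<bar>) < e))" for q :: real
  proof -
    have "(\<lambda>w. \<bar>f w - q\<bar>) integrable_on cbox a b" for a b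
      by (rule set_borel_integral_eq_integral(1))
         (intro loc_int_set_integrable loc_int_diff_const_abs f; simp)
    from integrable_ccontinuous_explicit[of "\<lambda>w. \<bar>f w - q\<bar>", OF this] show ?thesis by metis
  qed
  then obtain N where N: "\<And>q::real. negligible (N q)" and
    NN: "\<And>q x e. x \<notin> N q \<Longrightarrow> 0 < e \<Longrightarrow> (\<exists>d>0. \<forall>h. 0 < h \<and> h < d \<longrightarrow>
      norm (integral (cbox x (x + h *\<^sub>R One)) (\<lambda>w. \<bar>f w - q\<bar>) /\<^sub>R h ^ DIM('a) - \<bar>f x - q\<bar>) < e)"
    by metis
  have "negligible (\<Union>q\<in>\<rat>. N q)"
    by (rule negligible_countable_Union) (auto simp: N countable_rat)
  then have "AE z in lebesgue. z \<notin> (\<Union>q\<in>\<rat>. N q)"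
    using AE_not_in by (simp only: negligible_iff_null_sets)
  then have "AE z in lborel. z \<notin> (\<Union>q\<in>\<rat>. N q)"
    by (simp add: AE_completion_iff)
  then show ?thesis
  proof (rule AE_mp, intro AE_I2 impI allI)
    fix z :: 'a and e :: real assume z: "z \<notin> (\<Union>q\<in>\<rat>. N q)" and e: "e > 0"
    \<comment> \<open>The distance from \<open>q\<close> to \<open>f z\<close> is paid twice, in the
      limit of the averages and in replacing \<open>q\<close> by \<open>f z\<close>; the last third
      of \<open>e\<close> is for the convergence.\<close>
    obtain q where q: "q \<in> \<rat>" "f z - e/3 < q" "q < f z"
      using Rats_dense_in_real[of "f z - e/3" "f z"] e by auto
    have zq: "z \<notin> N q" using z q by auto
    obtain d where d: "d > 0" and D: "\<And>h. 0 < h \<Longrightarrow> h < d \<Longrightarrow>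
      norm (integral (cbox z (z + h *\<^sub>R One)) (\<lambda>w. \<bar>f w - q\<bar>) /\<^sub>R h ^ DIM('a) - \<bar>f z - q\<bar>) < e/3"
      using NN[OF zq, of "e/3"] e by auto
    show "\<exists>d>0. \<forall>h. 0 < h \<and> h < d \<longrightarrow> (LINT w:cbox z (z + h *\<^sub>R One)|lborel. \<bar>f w - f z\<bar>) < e * h ^ DIM('a)"
    proof (intro exI conjI allI impI, rule d)
      fix h assume h: "0 < h \<and> h < d"
      let ?B = "cbox z (z + h *\<^sub>R One)"
      have si: "set_integrable lborel ?B (\<lambda>w. \<bar>f w - c\<bar>)" for c
        by (intro loc_int_set_integrable loc_int_diff_const_abs f; simp)
      have sc: "set_integrable lborel ?B (\<lambda>w. c::real)" for c
        by (intro loc_int_set_integrable loc_int_continuous; simp)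
      have m: "measure lborel ?B = h ^ DIM('a)"
        using h by (simp add: content_cbox_cases inner_simps)
      have "(LINT w:?B|lborel. \<bar>f w - f z\<bar>) \<le> (LINT w:?B|lborel. \<bar>f w - q\<bar> + e/3)"
        using q by (intro set_integral_mono set_integral_add(1) si sc) auto
      also have "\<dots> = (LINT w:?B|lborel. \<bar>f w - q\<bar>) + e/3 * h ^ DIM('a)"
        by (subst set_integral_add(2)[OF si sc]) (simp add: set_lebesgue_integral_def m)
      also have "(LINT w:?B|lborel. \<bar>f w - q\<bar>) = integral ?B (\<lambda>w. \<bar>f w - q\<bar>)"
        by (rule set_borel_integral_eq_integral(2)[OF si])
      also have "\<dots> < (2*e/3) * h ^ DIM('a)"
      proof -
        have "\<bar>integral ?B (\<lambda>w. \<bar>f w - q\<bar>) / h ^ DIM('a) - \<bar>f z - q\<bar>\<bar> < e/3"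
          using D[of h] h by (simp only: divide_inverse_commute real_norm_def real_scaleR_def simp_thms)
        then have "integral ?B (\<lambda>w. \<bar>f w - q\<bar>) / h ^ DIM('a) < 2*e/3"
          using q by linarith
        then show ?thesis using h by (simp add: divide_less_eq)
      qed
      finally show "(LINT w:?B|lborel. \<bar>f w - f z\<bar>) < e * h ^ DIM('a)" by (simp add: algebra_simps)
    qed
  qed
qed

text \<open>As \<open>mol h\<close> integrates to 1, is supported in a box of side \<open>h\<close>
  and is at most a constant times \<open>h^-n\<close>, the error is bounded by a constant times the
  average of \<open>\<bar>f - f z\<bar>\<close> over a corner box at \<open>z\<close>.\<close>

lemma conv_mol_tendsto:
  fixes f :: "'a::euclidean_space \<Rightarrow> real"
  assumes f: "loc_int f"
  shows "AE z in lborel. (\<lambda>n. conv f (mol (inverse (real (Suc n)))) z) \<longlonglongrightarrow> f z"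
  using lebesgue_points[OF f]
proof (rule AE_mp, intro AE_I2 impI)
  fix z :: 'a
  let ?n = "DIM('a)"
  assume L: "\<forall>e>0. \<exists>d>0. \<forall>h. 0 < h \<and> h < d \<longrightarrow>
    (LINT w:cbox z (z + h *\<^sub>R One)|lborel. \<bar>f w - f z\<bar>) < e * h ^ ?n"
  define c where "c = (LINT w|lborel. bump (w::'a))"
  have c: "c > 0" using bump_integral_pos[where 'a='a] by (simp add: c_def)
  note [measurable] = loc_int_measurable[OF f]
  have est: "\<bar>conv f (mol h) z - f z\<bar> \<le> (LINT w:cbox z (z + h *\<^sub>R One)|lborel. \<bar>f w - f z\<bar>) / (h ^ ?n * c)"
    if h: "h > 0" for h
  proof -
    note k = ckernel_mol[OF h, where 'a='a]
    note [measurable] = ckernel_measurable[OF k]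
    have i1: "integrable lborel (\<lambda>w. f w * mol h (z - w))" by (intro conv_integrable f k)
    have i2: "integrable lborel (\<lambda>w. f z * mol h (z - w))"
      by (rule conv_integrable[OF loc_int_continuous k]) simp
    have "(LINT w|lborel. f z * mol h (z - w)) = f z"
      using integral_ckernel_shift(1)[OF ckernel_measurable[OF k], of z] mol_integral[OF h, where 'a='a] by simp
    then have "conv f (mol h) z - f z = (LINT w|lborel. f w * mol h (z - w) - f z * mol h (z - w))"
      using i1 i2 by (simp add: conv_def)
    also have "\<bar>\<dots>\<bar> \<le> (LINT w|lborel. \<bar>f w * mol h (z - w) - f z * mol h (z - w)\<bar>)"
      by (rule integral_abs_bound)
    also have "\<dots> \<le> (LINT w|lborel. (indicator (cbox z (z + h *\<^sub>R One)) w *\<^sub>R \<bar>f w - f z\<bar>) / (h ^ ?n * c))"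
    proof (rule integral_mono)
      show "integrable lborel (\<lambda>w. \<bar>f w * mol h (z - w) - f z * mol h (z - w)\<bar>)"
        using i1 i2 by (intro integrable_abs Bochner_Integration.integrable_diff)
      have "set_integrable lborel (cbox z (z + h *\<^sub>R One)) (\<lambda>w. \<bar>f w - f z\<bar>)"
        by (intro loc_int_set_integrable loc_int_diff_const_abs f; simp)
      then show "integrable lborel (\<lambda>w. (indicator (cbox z (z + h *\<^sub>R One)) w *\<^sub>R \<bar>f w - f z\<bar>) / (h ^ ?n * c))"
        unfolding set_integrable_def by (rule integrable_divide)
      fix w
      have e: "\<bar>f w * mol h (z - w) - f z * mol h (z - w)\<bar> = \<bar>f w - f z\<bar> * mol h (z - w)"
        using mol_nonneg[OF h, of "z - w"] by (simp add: left_diff_distrib[symmetric] abs_mult)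
      show "\<bar>f w * mol h (z - w) - f z * mol h (z - w)\<bar> \<le> (indicator (cbox z (z + h *\<^sub>R One)) w *\<^sub>R \<bar>f w - f z\<bar>) / (h ^ ?n * c)"
      proof (cases "mol h (z - w) = 0")
        case True then show ?thesis using h c by (simp add: e)
      next
        case False
        from mol_support[OF h False] have "w \<in> cbox z (z + h *\<^sub>R One)"
          by (auto simp: mem_box inner_simps algebra_simps)
        then show ?thesis
          using mult_left_mono[OF mol_bound[OF h, of "z - w"], of "\<bar>f w - f z\<bar>"] by (simp add: e c_def)
      qed
    qed
    also have "\<dots> = (LINT w:cbox z (z + h *\<^sub>R One)|lborel. \<bar>f w - f z\<bar>) / (h ^ ?n * c)"
      by (simp add: set_lebesgue_integral_def)
    finally show ?thesis .
  qed
  have lim0: "(\<lambda>n. inverse (real (Suc n))) \<longlonglongrightarrow> 0" by (rule LIMSEQ_inverse_real_of_nat)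
  show "(\<lambda>n. conv f (mol (inverse (real (Suc n)))) z) \<longlonglongrightarrow> f z"
  proof (rule LIMSEQ_I)
    fix e :: real assume e: "e > 0"
    with c have "e * c > 0" by simp
    then obtain d where d: "d > 0" and D: "\<And>h. 0 < h \<Longrightarrow> h < d \<Longrightarrow>
        (LINT w:cbox z (z + h *\<^sub>R One)|lborel. \<bar>f w - f z\<bar>) < (e * c) * h ^ ?n" using L by blast
    obtain m where m: "\<And>n. n \<ge> m \<Longrightarrow> inverse (real (Suc n)) < d"
      using order_tendstoD(2)[OF lim0 d] by (auto simp: eventually_sequentially)
    show "\<exists>m. \<forall>n\<ge>m. norm (conv f (mol (inverse (real (Suc n)))) z - f z) < e"
    proof (intro exI allI impI)
      fix n assume n: "n \<ge> m"
      define h where "h = inverse (real (Suc n))"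
      have h: "h > 0" "h < d" using m[OF n] by (auto simp: h_def)
      have "(LINT w:cbox z (z + h *\<^sub>R One)|lborel. \<bar>f w - f z\<bar>) / (h ^ ?n * c) < e"
        using D[OF h] h c by (simp add: divide_less_eq mult_ac)
      then show "norm (conv f (mol (inverse (real (Suc n)))) z - f z) < e"
        using est[OF h(1)] by (simp add: h_def)
    qed
  qed
qed

lemma test_fun_reflect:
  fixes \<phi> :: "'a::euclidean_space \<Rightarrow> real"
  assumes "test_fun \<phi>"
  shows "test_fun (\<lambda>w. \<phi> (z - w))"
    and "b \<in> Basis \<Longrightarrow> frechet_derivative (\<lambda>w. \<phi> (z - w)) (at w) b = - frechet_derivative \<phi> (at (z - w)) b"
proof -
  have l: "linear (uminus :: 'a \<Rightarrow> 'a)" by (simp add: linear_uminus)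
  note A = test_fun_affine[where k=1 and a=z, OF assms l]
  show "test_fun (\<lambda>w. \<phi> (z - w))" using A(1) by simp
  have "\<phi> differentiable at (z - w)" using assms by (simp add: test_fun_def differentiable_on_def)
  then have "linear (frechet_derivative \<phi> (at (z - w)))" by (rule linear_frechet_derivative)
  then show "frechet_derivative (\<lambda>w. \<phi> (z - w)) (at w) b = - frechet_derivative \<phi> (at (z - w)) b"
    using A(2)[of w b] by (simp add: linear_neg)
qed

text \<open>A reflected and translated mollifier is a test function, so both candidates have the
  same mollifications, and these determine them almost everywhere.\<close>

lemma wderiv_unique:
  assumes "loc_int g" "loc_int g'" "wderiv f g b" "wderiv f g' b"
  shows "AE z in lborel. g z = g' z"
proof -
  have "conv g (mol h) z = conv g' (mol h) z" if "h > 0" for h z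
    using assms(3,4) test_fun_reflect(1)[OF test_fun_mol[OF that], of z]
    unfolding wderiv_def conv_def by (metis neg_equal_iff_equal)
  then have e: "conv g (mol (inverse (real (Suc n)))) z = conv g' (mol (inverse (real (Suc n)))) z" for n z
    by simp
  show ?thesis
    using conv_mol_tendsto[OF assms(1)] conv_mol_tendsto[OF assms(2)]
    by eventually_elim (use e LIMSEQ_unique in auto)
qed

text \<open>The derivative is first put on the kernel and then moved to \<open>f\<close> by the
  definition of the weak derivative; the sign there cancels the one from the reflection
  \<open>z - w\<close>.\<close>

lemma conv_C1dir:
  assumes f: "loc_int f" and g: "loc_int g" and w: "wderiv f g b" and b: "b \<in> Basis" and t: "test_fun \<eta>"
  shows "C1dir (conv f \<eta>) (conv g \<eta>) b"
proof -
  note k = test_fun_C1dir[OF t b]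
  have "conv f (\<lambda>z. frechet_derivative \<eta> (at z) b) z = conv g \<eta> z" for z
  proof -
    have "(LINT w|lborel. f w * (- frechet_derivative \<eta> (at (z - w)) b)) = - (LINT w|lborel. g w * \<eta> (z - w))"
      using w[unfolded wderiv_def, rule_format, OF test_fun_reflect(1)[OF t, of z]]
      by (simp add: test_fun_reflect(2)[OF t b])
    then show ?thesis by (simp add: conv_def)
  qed
  then show ?thesis
    using conv_has_derivative[OF f k(2,3,1)] continuous_conv[OF f k(2)] continuous_conv[OF g k(2)]
    unfolding C1dir_def by simp
qed

text \<open>Jensen's inequality for the probability density \<open>mol h (z - w)\<close>, read off
  from the nonnegative variance.\<close>

lemma conv_square_le:
  assumes f: "loc_int f" and f2: "loc_int (\<lambda>w. (f w)\<^sup>2)" and h: "h > 0"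
  shows "(conv f (mol h) z)\<^sup>2 \<le> conv (\<lambda>w. (f w)\<^sup>2) (mol h) z"
proof -
  note k = ckernel_mol[OF h, where 'a='a]
  let ?c = "conv f (mol h) z" and ?m = "\<lambda>w. mol h (z - w)"
  have i1: "integrable lborel (\<lambda>w. f w * ?m w)" "integrable lborel (\<lambda>w. (f w)\<^sup>2 * ?m w)"
    by (intro conv_integrable f f2 k)+
  have i2: "integrable lborel (\<lambda>w. ?m w)"
    using conv_integrable[OF loc_int_continuous k, of "\<lambda>_. 1" z] by simp
  have m1: "(LINT w|lborel. ?m w) = 1"
    using integral_ckernel_shift(1)[OF ckernel_measurable[OF k], of z] mol_integral[OF h, where 'a='a] by simp
  have "0 \<le> (LINT w|lborel. (f w - ?c)\<^sup>2 * ?m w)"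
    by (intro Bochner_Integration.integral_nonneg) (simp add: mol_nonneg[OF h])
  also have "\<dots> = (LINT w|lborel. (f w)\<^sup>2 * ?m w - 2 * ?c * (f w * ?m w) + ?c\<^sup>2 * ?m w)"
    by (simp add: power2_eq_square algebra_simps)
  also have "\<dots> = conv (\<lambda>w. (f w)\<^sup>2) (mol h) z - 2 * ?c * ?c + ?c\<^sup>2"
    using i1 i2 by (simp add: m1 conv_def)
  finally show ?thesis by (simp add: power2_eq_square)
qed

section \<open>Linear combinations and dilations of weak derivatives\<close>

lemma wderiv_lin:
  assumes l: "loc_int f1" "loc_int f2" "loc_int g1" "loc_int g2"
    and w: "wderiv f1 g1 b" "wderiv f2 g2 b" and b: "b \<in> Basis"
  shows "wderiv (\<lambda>z. \<alpha> * f1 z + \<beta> * f2 z) (\<lambda>z. \<alpha> * g1 z + \<beta> * g2 z) b"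
  unfolding wderiv_def
proof (intro allI impI)
  fix \<phi> :: "'a \<Rightarrow> real" assume t: "test_fun \<phi>"
  let ?d = "\<lambda>z. frechet_derivative \<phi> (at z) b"
  note k = test_fun_C1dir[OF t b]
  note I = loc_int_ckernel_integrable
  have e: "(LINT z|lborel. (\<alpha> * f z + \<beta> * g z) * \<psi> z) = \<alpha> * (LINT z|lborel. f z * \<psi> z) + \<beta> * (LINT z|lborel. g z * \<psi> z)"
    if "loc_int f" "loc_int g" "ckernel \<psi>" for f g \<psi> :: "'a \<Rightarrow> real"
    using I[OF that(1,3)] I[OF that(2,3)] by (simp add: distrib_right mult.assoc)
  show "(LINT z|lborel. (\<alpha> * f1 z + \<beta> * f2 z) * ?d z) = - (LINT z|lborel. (\<alpha> * g1 z + \<beta> * g2 z) * \<phi> z)"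
    using w[unfolded wderiv_def, rule_format, OF t] by (simp add: e l k)
qed

text \<open>Each coordinate has its own factor because on the cell only the x-directions are
  stretched; equal factors give the scaling on R^3.\<close>

definition dil :: "('a::euclidean_space \<Rightarrow> real) \<Rightarrow> 'a \<Rightarrow> 'a" where
  "dil c z = (\<Sum>j\<in>Basis. (c j * (z \<bullet> j)) *\<^sub>R j)"

lemma dil_inner: "b \<in> Basis \<Longrightarrow> dil c z \<bullet> b = c b * (z \<bullet> b)"
  by (simp add: dil_def inner_sum_left_Basis)

lemma linear_dil: "linear (dil c)"
  by (rule linearI; rule euclidean_eqI; simp add: dil_inner inner_add_left distrib_left)

lemma dil_measurable [measurable]: "dil c \<in> borel_measurable borel"
  by (rule borel_measurable_continuous_onI, rule linear_continuous_on)
     (use linear_dil[of c] in \<open>simp only: linear_conv_bounded_linear\<close>)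

lemma dil_dil: "(\<And>j. j \<in> Basis \<Longrightarrow> c j * d j = 1) \<Longrightarrow> dil c (dil d z) = z"
  by (rule euclidean_eqI) (simp add: dil_inner mult.assoc[symmetric])

lemma dil_density:
  assumes "\<And>j::'a::euclidean_space. j \<in> Basis \<Longrightarrow> c j > 0"
  shows "(lborel :: 'a measure) = density (distr lborel borel (dil c)) (\<lambda>_. ennreal (prod c Basis))"
proof -
  have "(lborel :: 'a measure) = density (distr lborel borel (\<lambda>x. 0 + (\<Sum>j\<in>Basis. (c j * (x \<bullet> j)) *\<^sub>R j))) (\<lambda>_. ennreal (\<Prod>j\<in>Basis. \<bar>c j\<bar>))"
    by (rule lborel_affine_euclidean) (use assms in \<open>auto simp: less_imp_neq[symmetric]\<close>)
  moreover have "(\<Prod>j\<in>Basis. \<bar>c j\<bar>) = prod c Basis" using assms by (intro prod.cong) (auto simp: less_imp_le)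
  ultimately show ?thesis by (simp add: dil_def[abs_def])
qed

lemma dil_integral:
  fixes f :: "'a::euclidean_space \<Rightarrow> real"
  assumes c: "\<And>j::'a. j \<in> Basis \<Longrightarrow> c j > 0" and [measurable]: "f \<in> borel_measurable borel"
  shows "(LINT z|lborel. f (dil c z)) = (LINT z|lborel. f z) / prod c Basis"
    and "integrable lborel (\<lambda>z. f (dil c z)) \<longleftrightarrow> integrable lborel f"
proof -
  have p: "prod c Basis > 0" using c by (rule prod_pos)
  have "(LINT z|lborel. f z) = prod c Basis * (LINT z|lborel. f (dil c z))"
    by (subst dil_density[of c], use c in simp, subst integral_density) (use p in \<open>auto simp: integral_distr\<close>)
  then show "(LINT z|lborel. f (dil c z)) = (LINT z|lborel. f z) / prod c Basis"
    using p by (metis nonzero_mult_div_cancel_left less_irrefl)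
  have "integrable lborel f \<longleftrightarrow> integrable lborel (\<lambda>z. prod c Basis * f (dil c z))"
    by (subst dil_density[of c], use c in simp, subst integrable_density) (use p in \<open>auto simp: integrable_distr_eq\<close>)
  then show "integrable lborel (\<lambda>z. f (dil c z)) \<longleftrightarrow> integrable lborel f"
    using less_imp_neq[OF p] by (simp only: integrable_mult_right_iff) auto
qed

text \<open>A change of variables moves the dilation from \<open>f\<close> to the test function,
  whose derivative along \<open>b\<close> then carries the factor \<open>1 / c b\<close>.\<close>

lemma wderiv_dil:
  fixes f g :: "'a::euclidean_space \<Rightarrow> real"
  assumes c: "\<And>j::'a. j \<in> Basis \<Longrightarrow> c j > 0" and w: "wderiv f g b" and b: "b \<in> Basis"
    and [measurable]: "f \<in> borel_measurable borel" "g \<in> borel_measurable borel"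
  shows "wderiv (\<lambda>z. k * f (dil c z)) (\<lambda>z. k * c b * g (dil c z)) b"
  unfolding wderiv_def
proof (intro allI impI)
  fix \<phi> :: "'a \<Rightarrow> real" assume t: "test_fun \<phi>"
  let ?d = "\<lambda>z. frechet_derivative \<phi> (at z) b"
  define c' where "c' = (\<lambda>j. 1 / c j)"
  have cc: "dil c' (dil c z) = z" "dil c (dil c' z) = z" for z
    by (rule dil_dil; use c in \<open>force simp: c'_def\<close>)+
  obtain C where C: "C > 0" "\<And>z. norm (dil c z) \<le> C * norm z"
    using linear_bounded_pos[OF linear_dil[of c]] by blast
  have nb: "norm z \<le> C * norm (dil c' z)" for z using C(2)[of "dil c' z"] by (simp add: cc)
  note A = test_fun_affine[where a=0 and k=C, OF t linear_dil[of c'] nb C(1)]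
  have [measurable]: "\<phi> \<in> borel_measurable borel" "?d \<in> borel_measurable borel"
    using test_fun_C1dir(2,3)[OF t b] ckernel_measurable by auto
  have lin: "linear (frechet_derivative \<phi> (at z))" for z
    using t by (intro linear_frechet_derivative) (simp add: test_fun_def differentiable_on_def)
  have cb: "dil c' b = c' b *\<^sub>R b"
    by (rule euclidean_eqI) (use b in \<open>simp add: dil_inner inner_Basis c'_def\<close>)
  have p: "prod c Basis > 0" using c by (rule prod_pos)
  have "(LINT z|lborel. (k * f (dil c z)) * ?d z) = (LINT z|lborel. (\<lambda>z. k * f z * ?d (dil c' z)) (dil c z))"
    by (simp add: cc)
  also have "\<dots> = (LINT z|lborel. k * f z * ?d (dil c' z)) / prod c Basis"
    by (rule dil_integral(1)) (use c in auto)
  also have "(LINT z|lborel. k * f z * ?d (dil c' z)) = k * c b * (LINT z|lborel. f z * frechet_derivative (\<lambda>w. \<phi> (0 + dil c' w)) (at z) b)"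
    unfolding A(2) cb using c[OF b] by (simp add: linear_scale[OF lin] c'_def mult.assoc)
  also have "(LINT z|lborel. f z * frechet_derivative (\<lambda>w. \<phi> (0 + dil c' w)) (at z) b) = - (LINT z|lborel. g z * \<phi> (dil c' z))"
    using w[unfolded wderiv_def, rule_format, OF A(1)] by simp
  also have "k * c b * (- (LINT z|lborel. g z * \<phi> (dil c' z))) / prod c Basis
      = - ((LINT z|lborel. k * c b * g z * \<phi> (dil c' z)) / prod c Basis)"
    by (simp add: mult.assoc)
  also have "(LINT z|lborel. k * c b * g z * \<phi> (dil c' z)) / prod c Basis
      = (LINT z|lborel. (\<lambda>z. k * c b * g z * \<phi> (dil c' z)) (dil c z))"
    by (rule dil_integral(1)[symmetric]) (use c in auto)
  finally show "(LINT z|lborel. (k * f (dil c z)) * ?d z) = - (LINT z|lborel. (k * c b * g (dil c z)) * \<phi> z)"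
    by (simp add: cc)
qed

section \<open>The Loomis-Whitney inequality\<close>

text \<open>The value at \<open>top\<close> is fixed by hand, since \<open>enn2real top\<close> is
  0. With extended values the Hoelder and Loomis-Whitney inequalities hold without integrability
  assumptions.\<close>

definition cbrt :: "ennreal \<Rightarrow> ennreal" where
  "cbrt x = (if x = top then top else ennreal (root 3 (enn2real x)))"

lemma cbrt_measurable [measurable]: "cbrt \<in> borel_measurable borel"
  unfolding cbrt_def[abs_def] by measurable

lemma cbrt_ennreal: "x \<ge> 0 \<Longrightarrow> cbrt (ennreal x) = ennreal (root 3 x)"
  by (simp add: cbrt_def)

lemma cbrt_top [simp]: "cbrt top = top" by (simp add: cbrt_def)
lemma cbrt_0 [simp]: "cbrt 0 = 0" by (simp add: cbrt_def)

lemma cbrt_pow3: "cbrt x ^ 3 = x"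
proof (cases x)
  case (real r)
  then show ?thesis by (simp add: cbrt_ennreal ennreal_power odd_real_root_pow)
qed (simp add: power3_eq_cube)

lemma cbrt_of_pow3: "cbrt (x ^ 3) = x"
proof (cases x)
  case (real r)
  then show ?thesis by (simp add: cbrt_ennreal ennreal_power odd_real_root_power_cancel)
qed (simp add: power3_eq_cube)

lemma cbrt_mono: "x \<le> y \<Longrightarrow> cbrt x \<le> cbrt y"
  by (cases x; cases y) (auto simp: cbrt_ennreal top_unique ennreal_leI)

lemma cbrt_mult: "cbrt (x * y) = cbrt x * cbrt y"
  using cbrt_of_pow3[of "cbrt x * cbrt y"] by (simp add: power_mult_distrib cbrt_pow3)

lemma le_cbrt: "x ^ 3 \<le> y \<Longrightarrow> x \<le> cbrt y"
  using cbrt_mono[of "x ^ 3" y] by (simp add: cbrt_of_pow3)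

lemma cbrt_eq_0: "cbrt x = 0 \<longleftrightarrow> x = 0"
  by (metis cbrt_0 cbrt_pow3 zero_power zero_less_numeral)

lemma amgm3_real: "0 \<le> p \<Longrightarrow> 0 \<le> q \<Longrightarrow> 0 \<le> r \<Longrightarrow> 3 * (p * q * r) \<le> p ^ 3 + q ^ 3 + r ^ 3" for p q r :: real
proof -
  assume "0 \<le> p" "0 \<le> q" "0 \<le> r"
  then have "0 \<le> (p + q + r) * ((p - q)\<^sup>2 + (q - r)\<^sup>2 + (r - p)\<^sup>2) / 2" by simp
  also have "\<dots> = p ^ 3 + q ^ 3 + r ^ 3 - 3 * (p * q * r)"
    by (simp add: power2_eq_square power3_eq_cube field_simps)
  finally show ?thesis by simp
qed

lemma amgm3_ennreal: "3 * (p * q * r) \<le> p ^ 3 + q ^ 3 + r ^ 3" for p q r :: ennreal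
proof (cases "p = top \<or> q = top \<or> r = top")
  case True then show ?thesis by (auto simp: power3_eq_cube ennreal_mult_top)
next
  case False
  then obtain x y z where "p = ennreal x" "q = ennreal y" "r = ennreal z" "0 \<le> x" "0 \<le> y" "0 \<le> z"
    by (metis ennreal_cases)
  then have "3 * (p * q * r) = ennreal (3 * (x * y * z))" "p ^ 3 + q ^ 3 + r ^ 3 = ennreal (x ^ 3 + y ^ 3 + z ^ 3)"
    by (simp_all add: ennreal_mult ennreal_power)
  then show ?thesis
    using amgm3_real[of x y z] \<open>0 \<le> x\<close> \<open>0 \<le> y\<close> \<open>0 \<le> z\<close> by (simp add: ennreal_leI del: ennreal_plus)
qed

text \<open>Dividing each function by its integral reduces the claim to the pointwise inequality of
  arithmetic and geometric means. If an integral is 0 the left side vanishes; otherwise, if one is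
  infinite, the right side is \<open>top\<close>.\<close>

lemma holder3:
  assumes [measurable]: "f \<in> borel_measurable M" "g \<in> borel_measurable M" "h \<in> borel_measurable M"
  shows "(\<integral>\<^sup>+x. cbrt (f x) * cbrt (g x) * cbrt (h x) \<partial>M)
    \<le> cbrt (\<integral>\<^sup>+x. f x \<partial>M) * cbrt (\<integral>\<^sup>+x. g x \<partial>M) * cbrt (\<integral>\<^sup>+x. h x \<partial>M)"
proof -
  define X Y Z where "X = (\<integral>\<^sup>+x. f x \<partial>M)" and "Y = (\<integral>\<^sup>+x. g x \<partial>M)" and "Z = (\<integral>\<^sup>+x. h x \<partial>M)"
  consider "X = 0 \<or> Y = 0 \<or> Z = 0" | "X \<noteq> 0" "Y \<noteq> 0" "Z \<noteq> 0" "X = top \<or> Y = top \<or> Z = top"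
    | "X \<noteq> 0" "Y \<noteq> 0" "Z \<noteq> 0" "X \<noteq> top" "Y \<noteq> top" "Z \<noteq> top" by blast
  then show ?thesis
  proof cases
    case 1
    then have "(AE x in M. f x = 0) \<or> (AE x in M. g x = 0) \<or> (AE x in M. h x = 0)"
      by (simp add: X_def Y_def Z_def nn_integral_0_iff_AE)
    then have "AE x in M. cbrt (f x) * cbrt (g x) * cbrt (h x) = 0"
      by (elim disjE; force elim: AE_mp)
    then have "(\<integral>\<^sup>+x. cbrt (f x) * cbrt (g x) * cbrt (h x) \<partial>M) = 0"
      by (subst nn_integral_0_iff_AE) auto
    then show ?thesis by simp
  next
    case 2
    then have "cbrt X * cbrt Y * cbrt Z = top"
      by (auto simp: ennreal_mult_eq_top_iff cbrt_eq_0)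
    then show ?thesis by (simp add: X_def Y_def Z_def)
  next
    case 3
    have c: "W * (w / W) = w" if "W \<noteq> 0" "W \<noteq> top" for w W :: ennreal
      using that by (metis ennreal_times_divide mult.commute ennreal_mult_divide_eq)
    let ?K = "cbrt X * cbrt Y * cbrt Z"
    let ?p = "\<lambda>x. cbrt (f x / X) * cbrt (g x / Y) * cbrt (h x / Z)"
    have eq: "cbrt (f x) * cbrt (g x) * cbrt (h x) = ?K * ?p x" for x
    proof -
      have "cbrt (f x) = cbrt X * cbrt (f x / X)" "cbrt (g x) = cbrt Y * cbrt (g x / Y)"
        "cbrt (h x) = cbrt Z * cbrt (h x / Z)"
        using 3 by (simp_all add: c cbrt_mult[symmetric])
      then show ?thesis by (simp add: mult_ac)
    qed
    have "3 * (\<integral>\<^sup>+x. ?p x \<partial>M) = (\<integral>\<^sup>+x. 3 * ?p x \<partial>M)" by (subst nn_integral_cmult) auto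
    also have "\<dots> \<le> (\<integral>\<^sup>+x. f x / X + g x / Y + h x / Z \<partial>M)"
      by (rule nn_integral_mono) (use amgm3_ennreal in \<open>metis cbrt_pow3\<close>)
    also have "\<dots> = X / X + Y / Y + Z / Z"
      by (simp add: nn_integral_add nn_integral_divide X_def Y_def Z_def)
    also have "\<dots> = 3 * 1" using 3 by (simp add: ennreal_divide_self less_top)
    finally have "(\<integral>\<^sup>+x. ?p x \<partial>M) \<le> 1"
      by (subst (asm) ennreal_mult_le_mult_iff) auto
    then have "?K * (\<integral>\<^sup>+x. ?p x \<partial>M) \<le> ?K * 1" by (rule mult_left_mono) simp
    then show ?thesis unfolding eq X_def[symmetric] Y_def[symmetric] Z_def[symmetric]
      by (subst nn_integral_cmult) auto
  qed
qed

text \<open>The form in which Hoelder's inequality enters \<open>loomis_whitney\<close>: of four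
  factors one, \<open>k\<close>, is constant in the variable of integration.\<close>

lemma holder3_const:
  assumes [measurable]: "f \<in> borel_measurable M" "g \<in> borel_measurable M" "h \<in> borel_measurable M"
    and le: "\<And>x. x \<in> space M \<Longrightarrow> F x \<le> k * (cbrt (f x) * cbrt (g x) * cbrt (h x))"
  shows "(\<integral>\<^sup>+x. F x \<partial>M) \<le> k * (cbrt (\<integral>\<^sup>+x. f x \<partial>M) * cbrt (\<integral>\<^sup>+x. g x \<partial>M) * cbrt (\<integral>\<^sup>+x. h x \<partial>M))"
proof -
  have "(\<integral>\<^sup>+x. F x \<partial>M) \<le> (\<integral>\<^sup>+x. k * (cbrt (f x) * cbrt (g x) * cbrt (h x)) \<partial>M)"
    by (rule nn_integral_mono) (rule le)
  also have "\<dots> = k * (\<integral>\<^sup>+x. cbrt (f x) * cbrt (g x) * cbrt (h x) \<partial>M)"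
    by (rule nn_integral_cmult) measurable
  also have "\<dots> \<le> k * (cbrt (\<integral>\<^sup>+x. f x \<partial>M) * cbrt (\<integral>\<^sup>+x. g x \<partial>M) * cbrt (\<integral>\<^sup>+x. h x \<partial>M))"
    by (rule mult_left_mono[OF holder3]) auto
  finally show ?thesis .
qed

section \<open>Lebesgue measure on one period\<close>

definition tau :: "real measure" where
  "tau = density lborel (indicator {0..2*pi})"

lemma sets_tau [measurable_cong, simp]: "sets tau = sets borel" and space_tau [simp]: "space tau = UNIV"
  by (simp_all add: tau_def)

lemma nn_integral_tau:
  "f \<in> borel_measurable borel \<Longrightarrow> (\<integral>\<^sup>+y. f y \<partial>tau) = (\<integral>\<^sup>+y. f y * indicator {0..2*pi} y \<partial>lborel)"
  unfolding tau_def by (subst nn_integral_density) (auto simp: mult.commute)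

lemma emeasure_tau: "emeasure tau UNIV = ennreal (2*pi)"
  using nn_integral_tau[of "\<lambda>_. 1"] by (simp add: nn_integral_indicator)

lemma finite_tau: "finite_measure tau"
  by (rule finite_measureI) (simp add: emeasure_tau)

interpretation tau: finite_measure tau by (rule finite_tau)
interpretation lborel_tau: pair_sigma_finite "lborel :: 'a::euclidean_space measure" tau ..

lemma AE_tau: "AE y in tau. y \<in> {0..2*pi}"
  unfolding tau_def by (subst AE_density) (auto simp: indicator_def)

text \<open>\<open>F^4\<close> is a product of four copies of \<open>F\<close>, each bounded by the
  cube root of a different \<open>P_i\<close>. Since \<open>P_i\<close> is free of the i-th
  variable, in each of the four integrations one factor comes out as a constant and the other three
  are treated by Hoelder's inequality with exponents 3.\<close>

lemma loomis_whitney: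
  assumes [measurable]: "F \<in> borel_measurable (borel \<Otimes>\<^sub>M borel \<Otimes>\<^sub>M borel \<Otimes>\<^sub>M borel)"
    and m [measurable]: "P1 \<in> borel_measurable (borel \<Otimes>\<^sub>M borel \<Otimes>\<^sub>M borel)" "P2 \<in> borel_measurable (borel \<Otimes>\<^sub>M borel \<Otimes>\<^sub>M borel)"
     "P3 \<in> borel_measurable (borel \<Otimes>\<^sub>M borel \<Otimes>\<^sub>M borel)" "P4 \<in> borel_measurable (borel \<Otimes>\<^sub>M borel \<Otimes>\<^sub>M borel)"
    and le: "\<And>a b c d. d \<in> {0..2*pi} \<Longrightarrow> F (a,b,c,d) ^ 3 \<le> P1 (b,c,d)"
      "\<And>a b c d. d \<in> {0..2*pi} \<Longrightarrow> F (a,b,c,d) ^ 3 \<le> P2 (a,c,d)"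
      "\<And>a b c d. d \<in> {0..2*pi} \<Longrightarrow> F (a,b,c,d) ^ 3 \<le> P3 (a,b,d)"
      "\<And>a b c d. d \<in> {0..2*pi} \<Longrightarrow> F (a,b,c,d) ^ 3 \<le> P4 (a,b,c)"
  shows "(\<integral>\<^sup>+d. \<integral>\<^sup>+c. \<integral>\<^sup>+b. \<integral>\<^sup>+a. F (a,b,c,d) ^ 4 \<partial>lborel \<partial>lborel \<partial>lborel \<partial>tau) ^ 3
    \<le> (\<integral>\<^sup>+d. \<integral>\<^sup>+c. \<integral>\<^sup>+b. P1 (b,c,d) \<partial>lborel \<partial>lborel \<partial>tau)
     * (\<integral>\<^sup>+d. \<integral>\<^sup>+c. \<integral>\<^sup>+a. P2 (a,c,d) \<partial>lborel \<partial>lborel \<partial>tau)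
     * (\<integral>\<^sup>+d. \<integral>\<^sup>+b. \<integral>\<^sup>+a. P3 (a,b,d) \<partial>lborel \<partial>lborel \<partial>tau)
     * (\<integral>\<^sup>+c. \<integral>\<^sup>+b. \<integral>\<^sup>+a. P4 (a,b,c) \<partial>lborel \<partial>lborel \<partial>lborel)"
proof -
  have s0: "F (a,b,c,d) ^ 4 \<le> cbrt (P1 (b,c,d)) * (cbrt (P2 (a,c,d)) * cbrt (P3 (a,b,d)) * cbrt (P4 (a,b,c)))"
    if "d \<in> {0..2*pi}" for a b c d
  proof -
    have "F (a,b,c,d) * (F (a,b,c,d) * F (a,b,c,d) * F (a,b,c,d))
       \<le> cbrt (P1 (b,c,d)) * (cbrt (P2 (a,c,d)) * cbrt (P3 (a,b,d)) * cbrt (P4 (a,b,c)))"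
      using le[OF that] by (intro mult_mono le_cbrt) auto
    then show ?thesis by (simp add: power4_eq_xxxx mult_ac)
  qed
  let ?P2 = "\<lambda>c d. \<integral>\<^sup>+a. P2 (a,c,d) \<partial>lborel" and ?P3 = "\<lambda>b d. \<integral>\<^sup>+a. P3 (a,b,d) \<partial>lborel"
    and ?P4 = "\<lambda>b c. \<integral>\<^sup>+a. P4 (a,b,c) \<partial>lborel"
  have s1: "(\<integral>\<^sup>+a. F (a,b,c,d) ^ 4 \<partial>lborel) \<le> cbrt (P1 (b,c,d)) * (cbrt (?P2 c d) * cbrt (?P3 b d) * cbrt (?P4 b c))"
    if "d \<in> {0..2*pi}" for b c d
    by (rule holder3_const) (use s0[OF that] in auto)
  let ?Q1 = "\<lambda>c d. \<integral>\<^sup>+b. P1 (b,c,d) \<partial>lborel" and ?Q3 = "\<lambda>d. \<integral>\<^sup>+b. ?P3 b d \<partial>lborel"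
    and ?Q4 = "\<lambda>c. \<integral>\<^sup>+b. ?P4 b c \<partial>lborel"
  have s2: "(\<integral>\<^sup>+b. \<integral>\<^sup>+a. F (a,b,c,d) ^ 4 \<partial>lborel \<partial>lborel) \<le> cbrt (?P2 c d) * (cbrt (?Q1 c d) * cbrt (?Q3 d) * cbrt (?Q4 c))"
    if "d \<in> {0..2*pi}" for c d
  proof (rule holder3_const)
    show "(\<integral>\<^sup>+a. F (a,b,c,d) ^ 4 \<partial>lborel) \<le> cbrt (?P2 c d) * (cbrt (P1 (b,c,d)) * cbrt (?P3 b d) * cbrt (?P4 b c))" for b
      using s1[OF that, of b c] by (simp add: mult_ac)
  qed measurable
  let ?R1 = "\<lambda>d. \<integral>\<^sup>+c. ?Q1 c d \<partial>lborel" and ?R2 = "\<lambda>d. \<integral>\<^sup>+c. ?P2 c d \<partial>lborel"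
    and ?R4 = "\<integral>\<^sup>+c. ?Q4 c \<partial>lborel"
  have s3: "(\<integral>\<^sup>+c. \<integral>\<^sup>+b. \<integral>\<^sup>+a. F (a,b,c,d) ^ 4 \<partial>lborel \<partial>lborel \<partial>lborel) \<le> cbrt (?Q3 d) * (cbrt (?R1 d) * cbrt (?R2 d) * cbrt ?R4)"
    if "d \<in> {0..2*pi}" for d
  proof (rule holder3_const)
    show "(\<integral>\<^sup>+b. \<integral>\<^sup>+a. F (a,b,c,d) ^ 4 \<partial>lborel \<partial>lborel) \<le> cbrt (?Q3 d) * (cbrt (?Q1 c d) * cbrt (?P2 c d) * cbrt (?Q4 c))" for c
      using s2[OF that, of c] by (simp add: mult_ac)
  qed measurable
  have "(\<integral>\<^sup>+d. \<integral>\<^sup>+c. \<integral>\<^sup>+b. \<integral>\<^sup>+a. F (a,b,c,d) ^ 4 \<partial>lborel \<partial>lborel \<partial>lborel \<partial>tau)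
     \<le> (\<integral>\<^sup>+d. cbrt ?R4 * (cbrt (?R1 d) * cbrt (?R2 d) * cbrt (?Q3 d)) \<partial>tau)"
  \<comment> \<open>The bounds hold for \<open>d\<close> in the period only, which is almost
    everywhere for \<open>tau\<close>; this is why \<open>d\<close> is integrated last.\<close>
  proof (rule nn_integral_mono_AE, rule AE_mp[OF AE_tau], intro AE_I2 impI)
    fix d :: real assume "d \<in> {0..2*pi}"
    from s3[OF this] show "(\<integral>\<^sup>+c. \<integral>\<^sup>+b. \<integral>\<^sup>+a. F (a,b,c,d) ^ 4 \<partial>lborel \<partial>lborel \<partial>lborel)
      \<le> cbrt ?R4 * (cbrt (?R1 d) * cbrt (?R2 d) * cbrt (?Q3 d))" by (simp add: mult_ac)
  qed
  also have "\<dots> \<le> cbrt ?R4 * (cbrt (\<integral>\<^sup>+d. ?R1 d \<partial>tau) * cbrt (\<integral>\<^sup>+d. ?R2 d \<partial>tau) * cbrt (\<integral>\<^sup>+d. ?Q3 d \<partial>tau))"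
    by (rule holder3_const) auto
  finally have "(\<integral>\<^sup>+d. \<integral>\<^sup>+c. \<integral>\<^sup>+b. \<integral>\<^sup>+a. F (a,b,c,d) ^ 4 \<partial>lborel \<partial>lborel \<partial>lborel \<partial>tau) ^ 3
    \<le> (cbrt ?R4 * (cbrt (\<integral>\<^sup>+d. ?R1 d \<partial>tau) * cbrt (\<integral>\<^sup>+d. ?R2 d \<partial>tau) * cbrt (\<integral>\<^sup>+d. ?Q3 d \<partial>tau))) ^ 3"
    by (rule power_mono) auto
  then show ?thesis
    by (simp add: power_mult_distrib cbrt_pow3 mult_ac)
qed

text \<open>The fundamental theorem of calculus for \<open>g^3\<close>. The third power is what
  \<open>loomis_whitney\<close> asks for in four variables, and with it Cauchy-Schwarz gives back
  the integral of \<open>g^4\<close>.\<close>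

lemma cube_le_line_integral:
  fixes g g' :: "real \<Rightarrow> real"
  assumes d: "\<And>t. (g has_real_derivative g' t) (at t)" and c: "continuous_on UNIV g'"
    and st: "s \<in> {\<alpha>..\<beta>}" "t \<in> {\<alpha>..\<beta>}"
  shows "ennreal (\<bar>g s\<bar> ^ 3) \<le> ennreal (\<bar>g t\<bar> ^ 3) + (\<integral>\<^sup>+x. ennreal (3 * (g x)\<^sup>2 * \<bar>g' x\<bar>) * indicator {\<alpha>..\<beta>} x \<partial>lborel)"
proof -
  have cg: "continuous_on UNIV g" using d by (meson DERIV_continuous continuous_at_imp_continuous_on)
  let ?h = "\<lambda>x. 3 * (g x)\<^sup>2 * \<bar>g' x\<bar>"
  have ch: "continuous_on S ?h" for S
    by (intro continuous_intros continuous_on_subset[OF cg] continuous_on_subset[OF c]) auto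
  have d3: "((\<lambda>x. g x ^ 3) has_real_derivative 3 * (g x)\<^sup>2 * g' x) (at x)" for x
    by (auto intro!: derivative_eq_intros d)
  have main: "\<bar>g q ^ 3 - g p ^ 3\<bar> \<le> integral {p..q} ?h" if "p \<le> q" for p q
  proof -
    have "((\<lambda>x. 3 * (g x)\<^sup>2 * g' x) has_integral (g q ^ 3 - g p ^ 3)) {p..q}"
      using that d3 by (intro fundamental_theorem_of_calculus)
        (auto simp: has_real_derivative_iff_has_vector_derivative[symmetric] intro: has_field_derivative_at_within)
    then have "(g q ^ 3 - g p ^ 3) = integral {p..q} (\<lambda>x. 3 * (g x)\<^sup>2 * g' x)" by (simp add: integral_unique)
    also have "norm \<dots> \<le> integral {p..q} ?h"
      using ch continuous_on_subset[OF cg] continuous_on_subset[OF c]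
      by (intro integral_norm_bound_integral integrable_continuous_real continuous_intros) (auto simp: abs_mult)
    finally show ?thesis by simp
  qed
  have nn: "ennreal (integral {p..q} ?h) \<le> (\<integral>\<^sup>+x. ennreal (?h x) * indicator {\<alpha>..\<beta>} x \<partial>lborel)"
    if "p \<in> {\<alpha>..\<beta>}" "q \<in> {\<alpha>..\<beta>}" for p q
  proof -
    have si: "set_integrable lborel {p..q} ?h"
      unfolding set_integrable_def by (intro borel_integrable_compact ch) auto
    have "ennreal (integral {p..q} ?h) = ennreal (LINT x|lborel. indicator {p..q} x *\<^sub>R ?h x)"
      using set_borel_integral_eq_integral(2)[OF si] by (simp add: set_lebesgue_integral_def)
    also have "\<dots> = (\<integral>\<^sup>+x. ennreal (indicator {p..q} x *\<^sub>R ?h x) \<partial>lborel)"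
      using si unfolding set_integrable_def by (subst nn_integral_eq_integral) auto
    also have "\<dots> \<le> (\<integral>\<^sup>+x. ennreal (?h x) * indicator {\<alpha>..\<beta>} x \<partial>lborel)"
      using that by (intro nn_integral_mono) (auto simp: indicator_def)
    finally show ?thesis .
  qed
  have "\<bar>g s\<bar> ^ 3 \<le> \<bar>g t\<bar> ^ 3 + integral {min s t..max s t} ?h"
  proof -
    have "\<bar>g s ^ 3 - g t ^ 3\<bar> \<le> integral {min s t..max s t} ?h"
      using main[of s t] main[of t s] by (cases "s \<le> t") (auto simp: min_def max_def abs_minus_commute)
    moreover have "\<bar>g s\<bar> ^ 3 = \<bar>g s ^ 3\<bar>" "\<bar>g t\<bar> ^ 3 = \<bar>g t ^ 3\<bar>" by (simp_all add: power_abs)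
    ultimately show ?thesis by linarith
  qed
  then have "ennreal (\<bar>g s\<bar> ^ 3) \<le> ennreal (\<bar>g t\<bar> ^ 3 + integral {min s t..max s t} ?h)" by (rule ennreal_leI)
  also have "\<dots> \<le> ennreal (\<bar>g t\<bar> ^ 3) + ennreal (integral {min s t..max s t} ?h)"
    by (subst ennreal_plus) (auto intro!: integral_nonneg integrable_continuous_real ch)
  also have "\<dots> \<le> ennreal (\<bar>g t\<bar> ^ 3) + (\<integral>\<^sup>+x. ennreal (?h x) * indicator {\<alpha>..\<beta>} x \<partial>lborel)"
    using st by (intro add_left_mono nn) (auto simp: min_def max_def)
  finally show ?thesis .
qed

text \<open>The base point is one where \<open>g\<close> is nearly zero; it stands in for the value
  at infinity.\<close>

lemma cube_le_full_line_integral: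
  fixes g g' :: "real \<Rightarrow> real"
  assumes d: "\<And>t. (g has_real_derivative g' t) (at t)" and c: "continuous_on UNIV g'"
    and small: "\<And>e. e > 0 \<Longrightarrow> \<exists>t. \<bar>g t\<bar> < e"
  shows "ennreal (\<bar>g s\<bar> ^ 3) \<le> (\<integral>\<^sup>+x. ennreal (3 * (g x)\<^sup>2 * \<bar>g' x\<bar>) \<partial>lborel)"
proof (rule ennreal_le_epsilon)
  fix e :: real assume e: "e > 0"
  \<comment> \<open>Capping at 1 gives \<open>\<bar>g t\<bar>^3 \<le> \<bar>g t\<bar>\<close>, so
    that the cube is below \<open>e\<close> as well.\<close>
  define \<delta> where "\<delta> = min 1 e"
  obtain t where t: "\<bar>g t\<bar> < \<delta>" using small[of \<delta>] e by (auto simp: \<delta>_def)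
  have "\<bar>g t\<bar> ^ 3 \<le> \<bar>g t\<bar> ^ 1" using t by (intro power_decreasing) (auto simp: \<delta>_def)
  then have "\<bar>g t\<bar> ^ 3 \<le> e" using t by (simp add: \<delta>_def)
  have "ennreal (\<bar>g s\<bar> ^ 3) \<le> ennreal (\<bar>g t\<bar> ^ 3) + (\<integral>\<^sup>+x. ennreal (3 * (g x)\<^sup>2 * \<bar>g' x\<bar>) * indicator {min s t..max s t} x \<partial>lborel)"
    by (rule cube_le_line_integral[OF d c]) auto
  also have "\<dots> \<le> ennreal e + (\<integral>\<^sup>+x. ennreal (3 * (g x)\<^sup>2 * \<bar>g' x\<bar>) \<partial>lborel)"
    using \<open>\<bar>g t\<bar> ^ 3 \<le> e\<close> by (intro add_mono nn_integral_mono ennreal_leI) (auto simp: indicator_def)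
  finally show "ennreal (\<bar>g s\<bar> ^ 3) \<le> (\<integral>\<^sup>+x. ennreal (3 * (g x)\<^sup>2 * \<bar>g' x\<bar>) \<partial>lborel) + ennreal e"
    by (simp add: add.commute)
qed

section \<open>Integration over the cell\<close>

definition TT :: "pt measure" where "TT = lborel \<Otimes>\<^sub>M tau"

lemma sets_TT [measurable_cong, simp]: "sets TT = sets borel"
proof -
  have "sets TT = sets (borel \<Otimes>\<^sub>M (borel :: real measure) :: pt measure)"
    unfolding TT_def by (rule sets_pair_measure_cong) simp_all
  then show ?thesis using arg_cong[OF borel_prod[where 'a="real^3" and 'b=real], of sets] by (rule trans)
qed

lemma space_TT [simp]: "space TT = UNIV"
  using sets_eq_imp_space_eq[OF sets_TT] by simp

lemma TT_density: "TT = density lborel (indicator cell)"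
proof -
  have "sigma_finite_measure (density lborel (indicator {0..2 * pi} :: real \<Rightarrow> ennreal))"
    using tau.sigma_finite_measure_axioms by (simp add: tau_def)
  then have "density lborel (\<lambda>_. 1) \<Otimes>\<^sub>M tau = density (lborel \<Otimes>\<^sub>M lborel) (\<lambda>(x::real^3, y). 1 * indicator {0..2*pi} y)"
    unfolding tau_def by (intro pair_measure_density lborel.sigma_finite_measure_axioms) auto
  moreover have "(\<lambda>(x::real^3, y::real). 1 * indicator {0..2*pi} y :: ennreal) = indicator cell"
    by (auto simp: fun_eq_iff cell_def indicator_def)
  ultimately show ?thesis by (simp add: TT_def density_1 lborel_prod)
qed

lemma cell_borel [measurable]: "cell \<in> sets borel"
  unfolding cell_def by (intro borel_closed closed_Times) auto

lemma intT_TT: "f \<in> borel_measurable borel \<Longrightarrow> intT f = (LINT z|TT. f z)"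
  unfolding intT_def set_lebesgue_integral_def TT_density
  by (subst integral_density[of f lborel "indicator cell :: pt \<Rightarrow> real", symmetric]) (auto simp: ennreal_indicator)

lemma set_integrable_TT:
  fixes f :: "pt \<Rightarrow> real"
  shows "f \<in> borel_measurable borel \<Longrightarrow> set_integrable lborel cell f \<longleftrightarrow> integrable TT f"
  unfolding set_integrable_def TT_density
  by (subst integrable_density[of f lborel "indicator cell :: pt \<Rightarrow> real", symmetric]) (auto simp: ennreal_indicator)

lemma AE_TT: "AE z in lborel. Q z \<Longrightarrow> AE z in TT. Q z"
  unfolding TT_density by (subst AE_density) (simp, erule eventually_mono, simp)

lemma nn_integral_TT:
  assumes [measurable]: "f \<in> borel_measurable (borel :: pt measure)"
  shows "(\<integral>\<^sup>+z. f z \<partial>TT) = (\<integral>\<^sup>+y. \<integral>\<^sup>+x. f (x,y) \<partial>lborel \<partial>tau)"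
    and "(\<integral>\<^sup>+z. f z \<partial>TT) = (\<integral>\<^sup>+x. \<integral>\<^sup>+y. f (x,y) \<partial>tau \<partial>lborel)"
proof -
  have m: "f \<in> borel_measurable (lborel \<Otimes>\<^sub>M tau)"
    using assms measurable_cong_sets[OF sets_TT refl] unfolding TT_def by blast
  show "(\<integral>\<^sup>+z. f z \<partial>TT) = (\<integral>\<^sup>+y. \<integral>\<^sup>+x. f (x,y) \<partial>lborel \<partial>tau)"
    unfolding TT_def using lborel_tau.nn_integral_snd[of f] m by simp
  show "(\<integral>\<^sup>+z. f z \<partial>TT) = (\<integral>\<^sup>+x. \<integral>\<^sup>+y. f (x,y) \<partial>tau \<partial>lborel)"
    unfolding TT_def using tau.nn_integral_fst[of f] m by simp
qed

section \<open>Cartesian coordinates on R^3\<close>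

definition vec3 :: "real \<Rightarrow> real \<Rightarrow> real \<Rightarrow> real^3" where
  "vec3 a b c = a *\<^sub>R axis 1 1 + b *\<^sub>R axis 2 1 + c *\<^sub>R axis 3 1"

lemma vec3_nth: "vec3 a b c $ 1 = a" "vec3 a b c $ 2 = b" "vec3 a b c $ 3 = c"
  by (simp_all add: vec3_def axis_def)

lemma vec3_measurable [measurable]: "(\<lambda>(a,b,c). vec3 a b c) \<in> borel_measurable (borel \<Otimes>\<^sub>M borel \<Otimes>\<^sub>M borel)"
  unfolding vec3_def by measurable

lemma vec3_measurable' [measurable (raw)]:
  assumes [measurable]: "f \<in> borel_measurable M" "g \<in> borel_measurable M" "h \<in> borel_measurable M"
  shows "(\<lambda>x. vec3 (f x) (g x) (h x)) \<in> borel_measurable M"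
  unfolding vec3_def by measurable

lemma prod_Basis3: "(\<Prod>b\<in>Basis. f b) = f (axis 1 1) * f (axis 2 1) * f (axis 3 (1::real))" for f :: "real^3 \<Rightarrow> real"
proof -
  have B: "(Basis :: (real^3) set) = (\<lambda>i. axis i 1) ` UNIV" by (auto simp: Basis_vec_def)
  have "inj (\<lambda>i::3. axis i (1::real))" by (auto simp: inj_def axis_eq_axis)
  then have "(\<Prod>b\<in>Basis. f b) = (\<Prod>i\<in>UNIV. f (axis i 1))" unfolding B by (simp add: prod.reindex)
  then show ?thesis unfolding UNIV_3 by (simp add: mult.assoc del: One_nat_def)
qed

lemma sum_Basis3: "(\<Sum>b\<in>Basis. f b) = f (axis 1 1) + f (axis 2 1) + f (axis 3 (1::real))" for f :: "real^3 \<Rightarrow> real"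
proof -
  have B: "(Basis :: (real^3) set) = (\<lambda>i. axis i 1) ` UNIV" by (auto simp: Basis_vec_def)
  have "inj (\<lambda>i::3. axis i (1::real))" by (auto simp: inj_def axis_eq_axis)
  then have "(\<Sum>b\<in>Basis. f b) = (\<Sum>i\<in>UNIV. f (axis i 1))" unfolding B by (simp add: sum.reindex)
  then show ?thesis by (simp add: sum_3)
qed

text \<open>Lebesgue measure is determined by its values on boxes. The coordinates come in reverse
  order so that the first one is innermost in the iterated integral, as in
  \<open>loomis_whitney\<close>.\<close>

lemma lborel_vec3: "(lborel :: (real^3) measure) = distr (lborel \<Otimes>\<^sub>M lborel \<Otimes>\<^sub>M lborel) borel (\<lambda>(c,b,a). vec3 a b c)"
proof (rule lborel_eqI)
  fix l u :: "real^3" assume lu: "\<And>b. b \<in> Basis \<Longrightarrow> l \<bullet> b \<le> u \<bullet> b"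
  have le: "l $ i \<le> u $ i" for i
    using lu[of "axis i 1"] by (simp add: inner_axis)
  have [measurable]: "(\<lambda>(c,b,a). vec3 a b c) \<in> borel_measurable (lborel \<Otimes>\<^sub>M lborel \<Otimes>\<^sub>M lborel)"
    by measurable
  have v: "(\<lambda>(c,b,a). vec3 a b c) -` box l u \<inter> space (lborel \<Otimes>\<^sub>M lborel \<Otimes>\<^sub>M lborel)
     = {l $ 3<..<u $ 3} \<times> {l $ 2<..<u $ 2} \<times> {l $ 1<..<u $ 1}"
    by (auto simp: space_pair_measure mem_box_cart vec3_nth forall_3)
  show "emeasure (distr (lborel \<Otimes>\<^sub>M lborel \<Otimes>\<^sub>M lborel) borel (\<lambda>(c,b,a). vec3 a b c)) (box l u) = ennreal (\<Prod>b\<in>Basis. (u - l) \<bullet> b)"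
  proof -
    have sf: "sigma_finite_measure (lborel \<Otimes>\<^sub>M lborel :: (real \<times> real) measure)"
      by (simp add: lborel_prod sigma_finite_lborel)
    have "emeasure (lborel \<Otimes>\<^sub>M lborel \<Otimes>\<^sub>M lborel) ({l $ 3<..<u $ 3} \<times> {l $ 2<..<u $ 2} \<times> {l $ 1<..<u $ 1})
      = emeasure lborel {l $ 3<..<u $ 3} * emeasure (lborel \<Otimes>\<^sub>M lborel) ({l $ 2<..<u $ 2} \<times> {l $ 1<..<u $ 1})"
      by (rule sigma_finite_measure.emeasure_pair_measure_Times[OF sf]) auto
    also have "\<dots> = emeasure lborel {l $ 3<..<u $ 3} * (emeasure lborel {l $ 2<..<u $ 2} * emeasure lborel {l $ 1<..<u $ 1})"
      by (subst lborel.emeasure_pair_measure_Times) auto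
    finally show ?thesis
      using le[of 1] le[of 2] le[of 3]
      by (subst emeasure_distr) (simp_all add: v prod_Basis3 inner_axis ennreal_mult mult_ac)
  qed
qed simp

lemma nn_integral_vec3:
  assumes [measurable]: "f \<in> borel_measurable borel"
  shows "(\<integral>\<^sup>+x. f x \<partial>lborel) = (\<integral>\<^sup>+c. \<integral>\<^sup>+b. \<integral>\<^sup>+a. f (vec3 a b c) \<partial>lborel \<partial>lborel \<partial>lborel)"
proof -
  have [measurable]: "(\<lambda>(c,b,a). vec3 a b c) \<in> borel_measurable (lborel \<Otimes>\<^sub>M lborel \<Otimes>\<^sub>M lborel)"
    by measurable
  have sf: "sigma_finite_measure (lborel \<Otimes>\<^sub>M lborel :: (real \<times> real) measure)"
    by (simp add: lborel_prod sigma_finite_lborel)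
  have "(\<integral>\<^sup>+x. f x \<partial>lborel) = (\<integral>\<^sup>+p. f ((\<lambda>(c,b,a). vec3 a b c) p) \<partial>(lborel \<Otimes>\<^sub>M lborel \<Otimes>\<^sub>M lborel))"
    by (subst lborel_vec3, subst nn_integral_distr) auto
  also have "\<dots> = (\<integral>\<^sup>+c. \<integral>\<^sup>+q. f ((\<lambda>(b,a). vec3 a b c) q) \<partial>(lborel \<Otimes>\<^sub>M lborel) \<partial>lborel)"
    by (subst sigma_finite_measure.nn_integral_fst[OF sf, symmetric]) (auto simp: case_prod_beta')
  also have "\<dots> = (\<integral>\<^sup>+c. \<integral>\<^sup>+b. \<integral>\<^sup>+a. f (vec3 a b c) \<partial>lborel \<partial>lborel \<partial>lborel)"
    by (intro nn_integral_cong, subst lborel.nn_integral_fst[symmetric]) auto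
  finally show ?thesis .
qed

lemma nn_integral_TT4:
  assumes [measurable]: "f \<in> borel_measurable (borel :: pt measure)"
  shows "(\<integral>\<^sup>+z. f z \<partial>TT) = (\<integral>\<^sup>+d. \<integral>\<^sup>+c. \<integral>\<^sup>+b. \<integral>\<^sup>+a. f (vec3 a b c, d) \<partial>lborel \<partial>lborel \<partial>lborel \<partial>tau)"
proof -
  have [measurable]: "(\<lambda>x. f (x, d)) \<in> borel_measurable borel" for d
    using assms by (simp add: borel_prod[symmetric])
  show ?thesis by (simp add: nn_integral_TT(1) nn_integral_vec3)
qed

section \<open>Periodicity and translation invariance\<close>

lemma periodic_int:
  fixes h :: "real \<Rightarrow> 'a" assumes "\<And>y. h (y + 2*pi) = h y"
  shows "h (y + 2 * pi * of_int k) = h y"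
proof (induction k arbitrary: y rule: int_induct[where k=0])
  case base then show ?case by simp
next
  case (step1 i) then show ?case using assms[of "y + 2 * pi * of_int i"] by (simp add: algebra_simps)
next
  case (step2 i) then show ?case using assms[of "y + 2 * pi * of_int (i - 1)"] by (simp add: algebra_simps)
qed

text \<open>After reduction of \<open>s\<close> modulo the period, the part of the shifted interval
  beyond \<open>2*pi\<close> is moved back by one period.\<close>

lemma nn_integral_tau_shift:
  assumes [measurable]: "h \<in> borel_measurable borel" and p: "\<And>y. h (y + 2*pi) = h y"
  shows "(\<integral>\<^sup>+y. h (y + s) \<partial>tau) = (\<integral>\<^sup>+y. h y \<partial>tau)"
proof -
  define k where "k = \<lfloor>s / (2*pi)\<rfloor>"
  define s' where "s' = s - 2 * pi * of_int k"
  have "of_int k \<le> s / (2*pi)" "s / (2*pi) < of_int k + 1" by (simp_all add: k_def)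
  then have s': "0 \<le> s'" "s' < 2 * pi" by (simp_all add: s'_def field_simps)
  have hs: "h (y + s) = h (y + s')" for y
    using periodic_int[of h "y + s'" k, OF p] by (simp add: s'_def algebra_simps)
  have tr: "(\<integral>\<^sup>+y. f y \<partial>lborel) = (\<integral>\<^sup>+y. f (r + y) \<partial>lborel)" if "f \<in> borel_measurable borel" for r :: real and f
    using nn_integral_real_affine[OF that, of 1 r] by simp
  have "(\<integral>\<^sup>+y. h (y + s) \<partial>tau) = (\<integral>\<^sup>+y. h (y + s') * indicator {0..2*pi} y \<partial>lborel)"
    by (simp add: hs nn_integral_tau)
  also have "\<dots> = (\<integral>\<^sup>+y. h y * indicator {s'..2*pi + s'} y \<partial>lborel)"
    by (subst tr[of "\<lambda>y. h (y + s') * indicator {0..2*pi} y" "- s'"]) (auto intro!: nn_integral_cong simp: indicator_def)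
  also have "\<dots> = (\<integral>\<^sup>+y. h y * indicator {s'..2*pi} y + h y * indicator {2*pi<..2*pi + s'} y \<partial>lborel)"
    using s' by (intro nn_integral_cong) (auto simp: indicator_def)
  also have "\<dots> = (\<integral>\<^sup>+y. h y * indicator {s'..2*pi} y \<partial>lborel) + (\<integral>\<^sup>+y. h y * indicator {2*pi<..2*pi + s'} y \<partial>lborel)"
    by (rule nn_integral_add) auto
  also have "(\<integral>\<^sup>+y. h y * indicator {2*pi<..2*pi + s'} y \<partial>lborel) = (\<integral>\<^sup>+y. h y * indicator {0<..s'} y \<partial>lborel)"
    by (subst tr[of _ "2*pi"]) (auto intro!: nn_integral_cong simp: indicator_def p add.commute[of "2*pi"])
  also have "(\<integral>\<^sup>+y. h y * indicator {s'..2*pi} y \<partial>lborel) + (\<integral>\<^sup>+y. h y * indicator {0<..s'} y \<partial>lborel)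
     = (\<integral>\<^sup>+y. h y * indicator {s'..2*pi} y + h y * indicator {0<..s'} y \<partial>lborel)"
    by (rule nn_integral_add[symmetric]) auto
  also have "\<dots> = (\<integral>\<^sup>+y. h y * indicator {0..2*pi} y \<partial>lborel)"
  proof (rule nn_integral_cong_AE)
    \<comment> \<open>The two intervals may overlap in \<open>s'\<close> and miss 0, hence equality
      off these two points only.\<close>
    show "AE y in lborel. h y * indicator {s'..2*pi} y + h y * indicator {0<..s'} y = h y * indicator {0..2*pi} y"
      using AE_lborel_singleton[of 0] AE_lborel_singleton[of s']
      by eventually_elim (use s' in \<open>auto simp: indicator_def\<close>)
  qed
  also have "\<dots> = (\<integral>\<^sup>+y. h y \<partial>tau)" by (simp add: nn_integral_tau)
  finally show ?thesis .
qed

lemma nn_integral_lborel_shift: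
  fixes f :: "'a::euclidean_space \<Rightarrow> ennreal"
  assumes [measurable]: "f \<in> borel_measurable borel"
  shows "(\<integral>\<^sup>+x. f (x + w) \<partial>lborel) = (\<integral>\<^sup>+x. f x \<partial>lborel)"
  by (subst (2) lborel_distr_plus[of w, symmetric], subst nn_integral_distr) (simp_all add: add.commute)

lemma nn_integral_TT_shift:
  assumes f [measurable]: "f \<in> borel_measurable (borel :: pt measure)" and p: "periodic_y f"
  shows "(\<integral>\<^sup>+z. f (z + w) \<partial>TT) = (\<integral>\<^sup>+z. f z \<partial>TT)"
proof -
  have [measurable]: "f \<in> borel_measurable (borel \<Otimes>\<^sub>M borel)" using f by (simp add: borel_prod)
  have "(\<integral>\<^sup>+z. f (z + w) \<partial>TT) = (\<integral>\<^sup>+y. \<integral>\<^sup>+x. f (x + fst w, y + snd w) \<partial>lborel \<partial>tau)"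
    by (subst nn_integral_TT(1)) (simp, simp add: plus_prod_def)
  also have "\<dots> = (\<integral>\<^sup>+y. \<integral>\<^sup>+x. f (x, y + snd w) \<partial>lborel \<partial>tau)"
    by (intro nn_integral_cong nn_integral_lborel_shift) simp
  also have "\<dots> = (\<integral>\<^sup>+y. \<integral>\<^sup>+x. f (x, y) \<partial>lborel \<partial>tau)"
    by (rule nn_integral_tau_shift[of "\<lambda>y. \<integral>\<^sup>+x. f (x, y) \<partial>lborel"])
       (use p in \<open>simp_all add: periodic_y_def\<close>)
  finally show ?thesis by (simp add: nn_integral_TT(1))
qed

section \<open>A Sobolev inequality for functions of zero mean\<close>

text \<open>Each bound \<open>P_i\<close> in \<open>loomis_whitney\<close> will be an integral over
  the i-th variable alone, which makes that variable the innermost one; the four orders must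
  therefore be identified.\<close>

lemma nn_integral_reorder:
  assumes [measurable]: "q \<in> borel_measurable (borel \<Otimes>\<^sub>M borel \<Otimes>\<^sub>M borel \<Otimes>\<^sub>M borel)"
  defines "I \<equiv> (\<integral>\<^sup>+d. \<integral>\<^sup>+c. \<integral>\<^sup>+b. \<integral>\<^sup>+a. q (a,b,c,d) \<partial>lborel \<partial>lborel \<partial>lborel \<partial>tau)"
  shows "(\<integral>\<^sup>+d. \<integral>\<^sup>+c. \<integral>\<^sup>+a. \<integral>\<^sup>+b. q (a,b,c,d) \<partial>lborel \<partial>lborel \<partial>lborel \<partial>tau) = I"
    and "(\<integral>\<^sup>+d. \<integral>\<^sup>+b. \<integral>\<^sup>+a. \<integral>\<^sup>+c. q (a,b,c,d) \<partial>lborel \<partial>lborel \<partial>lborel \<partial>tau) = I"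
    and "(\<integral>\<^sup>+c. \<integral>\<^sup>+b. \<integral>\<^sup>+a. \<integral>\<^sup>+d. q (a,b,c,d) \<partial>tau \<partial>lborel \<partial>lborel \<partial>lborel) = I"
proof -
  show "(\<integral>\<^sup>+d. \<integral>\<^sup>+c. \<integral>\<^sup>+a. \<integral>\<^sup>+b. q (a,b,c,d) \<partial>lborel \<partial>lborel \<partial>lborel \<partial>tau) = I"
    unfolding I_def by (intro nn_integral_cong lborel_pair.Fubini') measurable
  have "(\<integral>\<^sup>+d. \<integral>\<^sup>+b. \<integral>\<^sup>+a. \<integral>\<^sup>+c. q (a,b,c,d) \<partial>lborel \<partial>lborel \<partial>lborel \<partial>tau)
      = (\<integral>\<^sup>+d. \<integral>\<^sup>+b. \<integral>\<^sup>+c. \<integral>\<^sup>+a. q (a,b,c,d) \<partial>lborel \<partial>lborel \<partial>lborel \<partial>tau)"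
    by (intro nn_integral_cong lborel_pair.Fubini') measurable
  also have "\<dots> = I"
    unfolding I_def
    by (rule nn_integral_cong, rule lborel_pair.Fubini'[where f="\<lambda>c b. \<integral>\<^sup>+a. q (a,b,c,d) \<partial>lborel" for d]) measurable
  finally show "(\<integral>\<^sup>+d. \<integral>\<^sup>+b. \<integral>\<^sup>+a. \<integral>\<^sup>+c. q (a,b,c,d) \<partial>lborel \<partial>lborel \<partial>lborel \<partial>tau) = I" .
  have "(\<integral>\<^sup>+c. \<integral>\<^sup>+b. \<integral>\<^sup>+a. \<integral>\<^sup>+d. q (a,b,c,d) \<partial>tau \<partial>lborel \<partial>lborel \<partial>lborel)
      = (\<integral>\<^sup>+c. \<integral>\<^sup>+b. \<integral>\<^sup>+d. \<integral>\<^sup>+a. q (a,b,c,d) \<partial>lborel \<partial>tau \<partial>lborel \<partial>lborel)"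
    by (intro nn_integral_cong lborel_tau.Fubini'[symmetric]) measurable
  also have "\<dots> = (\<integral>\<^sup>+c. \<integral>\<^sup>+d. \<integral>\<^sup>+b. \<integral>\<^sup>+a. q (a,b,c,d) \<partial>lborel \<partial>lborel \<partial>tau \<partial>lborel)"
    by (rule nn_integral_cong, rule lborel_tau.Fubini'[where f="\<lambda>b d. \<integral>\<^sup>+a. q (a,b,c,d) \<partial>lborel" for c, symmetric]) measurable
  also have "\<dots> = I"
    unfolding I_def
    by (rule lborel_tau.Fubini'[where f="\<lambda>c d. \<integral>\<^sup>+b. \<integral>\<^sup>+a. q (a,b,c,d) \<partial>lborel \<partial>lborel", symmetric]) measurable
  finally show "(\<integral>\<^sup>+c. \<integral>\<^sup>+b. \<integral>\<^sup>+a. \<integral>\<^sup>+d. q (a,b,c,d) \<partial>tau \<partial>lborel \<partial>lborel \<partial>lborel) = I" .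
qed

text \<open>The properties shared by mollified functions and by their remainders after averaging in
  y. Decay for large x, uniform in y, takes the place of compact support, and \<open>P\<close> is
  the classical gradient.\<close>

definition smoothT :: "(pt \<Rightarrow> real) \<Rightarrow> (pt \<Rightarrow> pt) \<Rightarrow> bool" where
  "smoothT \<phi> P \<longleftrightarrow> periodic_y \<phi> \<and> (\<forall>b\<in>Basis. C1dir \<phi> (\<lambda>z. P z \<bullet> b) b) \<and>
     (\<forall>e>0. \<exists>R. \<forall>x y. norm x > R \<longrightarrow> \<bar>\<phi> (x,y)\<bar> < e) \<and>
     integrable TT (\<lambda>z. (\<phi> z)\<^sup>2) \<and> integrable TT (\<lambda>z. (norm (P z))\<^sup>2)"

lemma Basis_pt: "(axis i 1, 0) \<in> (Basis :: pt set)" "(0, 1) \<in> (Basis :: pt set)"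
  by (auto simp: Basis_prod_def Basis_vec_def)

lemma smoothT_C1dir: "smoothT \<phi> P \<Longrightarrow> b \<in> Basis \<Longrightarrow> C1dir \<phi> (\<lambda>z. P z \<bullet> b) b"
  by (simp add: smoothT_def)

lemma smoothT_continuous:
  assumes "smoothT \<phi> P" shows "continuous_on UNIV \<phi>" "continuous_on UNIV P"
proof -
  show "continuous_on UNIV \<phi>" using smoothT_C1dir[OF assms Basis_pt(2)] by (simp add: C1dir_def)
  show "continuous_on UNIV P"
    by (rule continuous_on_componentwise[THEN iffD2]) (use smoothT_C1dir[OF assms] in \<open>simp add: C1dir_def\<close>)
qed

lemma smoothT_measurable:
  assumes "smoothT \<phi> P" shows "\<phi> \<in> borel_measurable borel" "P \<in> borel_measurable borel"
  using smoothT_continuous[OF assms] by (auto intro: borel_measurable_continuous_onI)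

lemma periodic_y_reduce:
  assumes "periodic_y f" obtains y' where "y' \<in> {0..2*pi}" "\<And>x. f (x, y) = f (x, y')"
proof -
  define k where "k = \<lfloor>y / (2*pi)\<rfloor>"
  define s' where "s' = y - 2 * pi * of_int k"
  have "of_int k \<le> y / (2*pi)" "y / (2*pi) < of_int k + 1" by (simp_all add: k_def)
  then have s': "0 \<le> s'" "s' < 2 * pi" by (simp_all add: s'_def field_simps)
  have "f (x, y) = f (x, s')" for x
    using periodic_int[of "\<lambda>y. f (x, y)" s' k] assms by (simp add: s'_def periodic_y_def)
  with s' show ?thesis by (intro that[of s']) auto
qed

lemma smoothT_bounded:
  assumes s: "smoothT \<phi> P" obtains M where "\<And>z. \<bar>\<phi> z\<bar> \<le> M"
proof -
  obtain R where R: "\<And>x y. norm x > R \<Longrightarrow> \<bar>\<phi> (x,y)\<bar> < 1"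
    using s unfolding smoothT_def by (metis zero_less_one)
  have "bounded (\<phi> ` (cball 0 R \<times> {0..2*pi}))"
    by (intro compact_imp_bounded compact_continuous_image continuous_on_subset[OF smoothT_continuous(1)[OF s]] compact_Times) auto
  then obtain M where M: "\<And>z. z \<in> cball 0 R \<times> {0..2*pi} \<Longrightarrow> \<bar>\<phi> z\<bar> \<le> M"
    unfolding bounded_iff real_norm_def by (metis imageI)
  have "\<bar>\<phi> z\<bar> \<le> max M 1" for z
  proof -
    obtain x y where z: "z = (x, y)" by (cases z)
    have "periodic_y \<phi>" using s by (simp add: smoothT_def)
    then obtain y' where "y' \<in> {0..2*pi}" "\<phi> (x, y) = \<phi> (x, y')" using periodic_y_reduce[of \<phi> y] by blast
    then show ?thesis using R[of x y] M[of "(x, y')"] z by (cases "norm x \<le> R") auto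
  qed
  then show ?thesis using that by blast
qed

lemma integral_tau:
  fixes g :: "real \<Rightarrow> real" assumes "g \<in> borel_measurable borel"
  shows "(LINT y|tau. g y) = (LINT y:{0..2*pi}|lborel. g y)" "integrable tau g \<longleftrightarrow> set_integrable lborel {0..2*pi} g"
  unfolding tau_def set_lebesgue_integral_def set_integrable_def
   apply (subst integral_density[of g lborel "indicator {0..2*pi} :: real \<Rightarrow> real", symmetric])
  using assms apply (auto simp: ennreal_indicator)[4]
  apply (subst integrable_density[of g lborel "indicator {0..2*pi} :: real \<Rightarrow> real", symmetric])
  using assms apply (auto simp: ennreal_indicator)
  done

lemma integral_tau_continuous:
  fixes g :: "real \<Rightarrow> real" assumes "continuous_on UNIV g"
  shows "(LINT y|tau. g y) = integral {0..2*pi} g" "integrable tau g"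
proof -
  have m: "g \<in> borel_measurable borel" using assms by (rule borel_measurable_continuous_onI)
  have si: "set_integrable lborel {0..2*pi} g"
    unfolding set_integrable_def by (rule borel_integrable_compact) (auto intro: continuous_on_subset[OF assms])
  then show "integrable tau g" by (simp add: integral_tau(2)[OF m])
  show "(LINT y|tau. g y) = integral {0..2*pi} g"
    by (simp add: integral_tau(1)[OF m] set_borel_integral_eq_integral(2)[OF si])
qed

text \<open>The mean value theorem for the primitive, which takes equal values at both ends of the
  period.\<close>

lemma mean_zero_root:
  fixes g :: "real \<Rightarrow> real" assumes c: "continuous_on UNIV g" and z: "(LINT y|tau. g y) = 0"
  obtains t where "t \<in> {0..2*pi}" "g t = 0"
proof -
  let ?G = "\<lambda>y. integral {0..y} g"
  have d: "(?G has_real_derivative g x) (at x within {0..2*pi})" if "x \<in> {0..2*pi}" for x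
    using integral_has_real_derivative[of 0 "2*pi" g x] that continuous_on_subset[OF c] by auto
  have "\<exists>x\<in>{0<..<2*pi}. ?G (2*pi) - ?G 0 = g x * (2*pi - 0)"
    by (rule mvt_simple[where f' = "\<lambda>x h. g x * h"]) (use d in \<open>auto simp: has_field_derivative_def\<close>)
  then obtain x where "0 < x" "x < 2*pi" "?G (2*pi) - ?G 0 = g x * (2*pi - 0)" by auto
  with z show ?thesis by (intro that[of x]) (auto simp: integral_tau_continuous(1)[OF c])
qed

lemma power4_mult: "x ^ 4 = x\<^sup>2 * x\<^sup>2" for x :: real
  by (simp add: power4_eq_xxxx power2_eq_square)

lemma parts_measurable [measurable (raw)]:
  fixes P :: "'a \<Rightarrow> pt" assumes P: "P \<in> borel_measurable M"
  shows "(\<lambda>z. fst (P z)) \<in> borel_measurable M" "(\<lambda>z. snd (P z)) \<in> borel_measurable M"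
  using measurable_compose[OF P borel_measurable_continuous_onI[OF continuous_on_fst[OF continuous_on_id]]]
    measurable_compose[OF P borel_measurable_continuous_onI[OF continuous_on_snd[OF continuous_on_id]]]
  by auto

lemma norm_pt_split: "(norm (p::pt))\<^sup>2 = (norm (fst p))\<^sup>2 + (snd p)\<^sup>2"
  by (simp add: norm_prod_def)

lemma parts_integrable:
  assumes [measurable]: "P \<in> borel_measurable borel" and i: "integrable TT (\<lambda>z. (norm (P z :: pt))\<^sup>2)"
  shows "integrable TT (\<lambda>z. (norm (fst (P z)))\<^sup>2)" "integrable TT (\<lambda>z. (snd (P z))\<^sup>2)"
    by (rule Bochner_Integration.integrable_bound[OF i]; simp add: norm_pt_split)+

lemma smoothT_pow4:
  assumes s: "smoothT \<phi> P" shows "integrable TT (\<lambda>z. \<phi> z ^ 4)"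
proof -
  note [measurable] = smoothT_measurable[OF s]
  obtain M where M: "\<And>z. \<bar>\<phi> z\<bar> \<le> M" using smoothT_bounded[OF s] by blast
  show ?thesis
  proof (rule Bochner_Integration.integrable_bound)
    show "integrable TT (\<lambda>z. M\<^sup>2 * (\<phi> z)\<^sup>2)" using s by (simp add: smoothT_def)
    have "(\<phi> z)\<^sup>2 \<le> M\<^sup>2" for z using power_mono[OF M, of z 2] by simp
    then have "(\<phi> z)\<^sup>2 * (\<phi> z)\<^sup>2 \<le> M\<^sup>2 * (\<phi> z)\<^sup>2" for z by (intro mult_right_mono) auto
    then show "AE z in TT. norm (\<phi> z ^ 4) \<le> norm (M\<^sup>2 * (\<phi> z)\<^sup>2)"
      by (intro AE_I2) (simp only: power4_mult real_norm_def abs_mult abs_power2)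
  qed measurable
qed

text \<open>Along each x-axis \<open>\<bar>\<phi>\<bar>^3\<close> is bounded by a full line
  integral, along y by an integral from a zero of the slice, which the zero mean provides. With
  \<open>n\<close> the integral of \<open>\<phi>^4\<close> and \<open>E i\<close> the energies of
  the partial derivatives, Loomis-Whitney and Cauchy-Schwarz yield
  \<open>n^6 \<le> 9^4 n^4 E1 E2 E3 E4\<close>; hence 6561 = 9^4.\<close>

lemma sobolev_smooth:
  assumes s: "smoothT \<phi> P" and mz: "\<And>x. (LINT y|tau. \<phi> (x,y)) = 0"
  shows "integrable TT (\<lambda>z. \<phi> z ^ 4)"
    and "(LINT z|TT. \<phi> z ^ 4)\<^sup>2 \<le> 6561 * (LINT z|TT. (norm (fst (P z)))\<^sup>2) ^ 3 * (LINT z|TT. (snd (P z))\<^sup>2)"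
proof -
  note [measurable] = smoothT_measurable[OF s]
  note cont = smoothT_continuous[OF s]
  have [measurable]: "\<phi> \<in> borel_measurable (borel \<Otimes>\<^sub>M borel)" "P \<in> borel_measurable (borel \<Otimes>\<^sub>M borel)"
    using smoothT_measurable[OF s] by (simp_all add: borel_prod)
  have iP: "integrable TT (\<lambda>z. (norm (P z))\<^sup>2)" using s by (simp add: smoothT_def)
  show i4: "integrable TT (\<lambda>z. \<phi> z ^ 4)" by (rule smoothT_pow4[OF s])
  define e where "e = (\<lambda>i::nat. if i = 1 then (axis 1 1, 0) else if i = 2 then (axis 2 1, 0)
     else if i = 3 then (axis 3 1, 0) else ((0, 1) :: pt))"
  have eB: "e i \<in> Basis" for i by (auto simp: e_def Basis_pt)
  define p where "p = (\<lambda>i z. ennreal (3 * (\<phi> z)\<^sup>2 * \<bar>P z \<bullet> e i\<bar>))"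
  have [measurable]: "p i \<in> borel_measurable borel" for i unfolding p_def by measurable
  have [measurable]: "p i \<in> borel_measurable (borel \<Otimes>\<^sub>M borel)" for i unfolding p_def by measurable
  define q where "q = (\<lambda>i (a,b,c,d). p i (vec3 a b c, d))"
  have q[measurable]: "q i \<in> borel_measurable (borel \<Otimes>\<^sub>M borel \<Otimes>\<^sub>M borel \<Otimes>\<^sub>M borel)" for i
    unfolding q_def by measurable
  have van: "\<exists>R. \<forall>x y. norm x > R \<longrightarrow> \<bar>\<phi> (x,y)\<bar> < \<epsilon>" if "\<epsilon> > 0" for \<epsilon>
    using s that by (simp add: smoothT_def)
  have line: "((\<lambda>t. \<phi> (z + t *\<^sub>R e i)) has_real_derivative (P (z + t *\<^sub>R e i) \<bullet> e i)) (at t)" for z t i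
    by (rule C1dir_line[OF smoothT_C1dir[OF s eB]])
  have cl: "continuous_on UNIV (\<lambda>t. P (z + t *\<^sub>R e i) \<bullet> e i)" for z i
    by (rule continuous_on_inner[OF continuous_on_compose2[OF cont(2)]]) (auto intro!: continuous_intros)
  have xdir: "ennreal \<bar>\<phi> z\<bar> ^ 3 \<le> (\<integral>\<^sup>+t. p i (z0 + t *\<^sub>R e i) \<partial>lborel)"
    if i: "i \<in> {1,2,3}" and z: "z = z0 + s *\<^sub>R e i" for i z z0 s
  proof -
    have "\<exists>t. \<bar>\<phi> (z0 + t *\<^sub>R e i)\<bar> < \<epsilon>" if \<epsilon>: "\<epsilon> > 0" for \<epsilon>
    proof -
      obtain R where R: "\<And>x y. norm x > R \<Longrightarrow> \<bar>\<phi> (x,y)\<bar> < \<epsilon>" using van[OF \<epsilon>] by blast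
      obtain j where j: "e i = (axis j 1, 0)" using i by (auto simp: e_def)
      \<comment> \<open>Moving this far along the axis leaves the ball of radius \<open>R\<close>
        wherever the line starts.\<close>
      define t where "t = \<bar>R\<bar> + norm (fst z0) + 1"
      have "norm (fst z0 + t *\<^sub>R axis j (1::real)) \<ge> norm (t *\<^sub>R axis j (1::real)) - norm (fst z0)"
        using norm_triangle_ineq4[of "fst z0 + t *\<^sub>R axis j (1::real)" "fst z0"] by simp
      then have "norm (fst (z0 + t *\<^sub>R e i)) > R" by (simp add: j t_def)
      then show ?thesis
        using R[of "fst (z0 + t *\<^sub>R e i)" "snd (z0 + t *\<^sub>R e i)"] by (auto simp only: prod.collapse)
    qed
    from cube_le_full_line_integral[OF line cl this, of s]
    show ?thesis by (simp add: z p_def ennreal_power)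
  qed
  have ydir: "ennreal \<bar>\<phi> (x,d)\<bar> ^ 3 \<le> (\<integral>\<^sup>+d. p 4 (x,d) \<partial>tau)" if d: "d \<in> {0..2*pi}" for x d
  proof -
    have z: "(x,0) + t *\<^sub>R e 4 = (x,t)" for t by (simp add: e_def)
    have "continuous_on UNIV (\<lambda>y. \<phi> (x,y))"
      by (rule continuous_on_compose2[OF cont(1)]) (auto intro!: continuous_intros)
    then obtain t where t: "t \<in> {0..2*pi}" "\<phi> (x,t) = 0" using mean_zero_root mz by metis
    have "ennreal (\<bar>\<phi> (x,d)\<bar> ^ 3) \<le> ennreal (\<bar>\<phi> (x,t)\<bar> ^ 3) + (\<integral>\<^sup>+y. p 4 (x,y) * indicator {0..2*pi} y \<partial>lborel)"
      using cube_le_line_integral[OF line cl d t(1), of "(x,0)" 4] unfolding z p_def .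
    then show ?thesis by (simp add: t nn_integral_tau ennreal_power)
  qed
  have v: "vec3 a b c = vec3 0 b c + a *\<^sub>R axis 1 1" "vec3 a b c = vec3 a 0 c + b *\<^sub>R axis 2 1"
     "vec3 a b c = vec3 a b 0 + c *\<^sub>R axis 3 1" for a b c by (simp_all add: vec3_def)
  define N where "N = (\<integral>\<^sup>+z. ennreal (\<phi> z ^ 4) \<partial>TT)"
  define T where "T = (\<lambda>i. \<integral>\<^sup>+z. p i z \<partial>TT)"
  have Tq: "T i = (\<integral>\<^sup>+d. \<integral>\<^sup>+c. \<integral>\<^sup>+b. \<integral>\<^sup>+a. q i (a,b,c,d) \<partial>lborel \<partial>lborel \<partial>lborel \<partial>tau)" for i
    unfolding T_def q_def by (simp add: nn_integral_TT4)
  have "N = (\<integral>\<^sup>+z. (ennreal \<bar>\<phi> z\<bar>) ^ 4 \<partial>TT)" unfolding N_def by (simp add: ennreal_power)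
  also have "\<dots> = (\<integral>\<^sup>+d. \<integral>\<^sup>+c. \<integral>\<^sup>+b. \<integral>\<^sup>+a. (\<lambda>(a,b,c,d). ennreal \<bar>\<phi> (vec3 a b c, d)\<bar>) (a,b,c,d) ^ 4 \<partial>lborel \<partial>lborel \<partial>lborel \<partial>tau)"
    by (simp add: nn_integral_TT4)
  finally have N4: "N = \<dots>" .
  have LW: "N ^ 3 \<le> T 1 * T 2 * T 3 * T 4"
  proof -
    let ?F = "\<lambda>(a,b,c,d). ennreal \<bar>\<phi> (vec3 a b c, d)\<bar>"
    let ?P1 = "\<lambda>(b,c,d). \<integral>\<^sup>+a. q 1 (a,b,c,d) \<partial>lborel"
    let ?P2 = "\<lambda>(a,c,d). \<integral>\<^sup>+b. q 2 (a,b,c,d) \<partial>lborel"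
    let ?P3 = "\<lambda>(a,b,d). \<integral>\<^sup>+c. q 3 (a,b,c,d) \<partial>lborel"
    let ?P4 = "\<lambda>(a,b,c). \<integral>\<^sup>+d. q 4 (a,b,c,d) \<partial>tau"
    have l1: "?F (a,b,c,d) ^ 3 \<le> ?P1 (b,c,d)" if "d \<in> {0..2*pi}" for a b c d
      using xdir[of 1 "(vec3 a b c, d)" "(vec3 0 b c, d)" a] by (simp add: q_def e_def v(1)[symmetric])
    have l2: "?F (a,b,c,d) ^ 3 \<le> ?P2 (a,c,d)" if "d \<in> {0..2*pi}" for a b c d
      using xdir[of 2 "(vec3 a b c, d)" "(vec3 a 0 c, d)" b] by (simp add: q_def e_def v(2)[symmetric])
    have l3: "?F (a,b,c,d) ^ 3 \<le> ?P3 (a,b,d)" if "d \<in> {0..2*pi}" for a b c d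
      using xdir[of 3 "(vec3 a b c, d)" "(vec3 a b 0, d)" c] by (simp add: q_def e_def v(3)[symmetric])
    have l4: "?F (a,b,c,d) ^ 3 \<le> ?P4 (a,b,c)" if "d \<in> {0..2*pi}" for a b c d
      using ydir[OF that, of "vec3 a b c"] by (simp add: q_def)
    have m: "?F \<in> borel_measurable (borel \<Otimes>\<^sub>M borel \<Otimes>\<^sub>M borel \<Otimes>\<^sub>M borel)"
      "?P1 \<in> borel_measurable (borel \<Otimes>\<^sub>M borel \<Otimes>\<^sub>M borel)" "?P2 \<in> borel_measurable (borel \<Otimes>\<^sub>M borel \<Otimes>\<^sub>M borel)"
      "?P3 \<in> borel_measurable (borel \<Otimes>\<^sub>M borel \<Otimes>\<^sub>M borel)" "?P4 \<in> borel_measurable (borel \<Otimes>\<^sub>M borel \<Otimes>\<^sub>M borel)"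
      by measurable
    from loomis_whitney[OF m l1 l2 l3 l4] show ?thesis
      by (simp only: N4 Tq prod.case nn_integral_reorder[OF q])
  qed
  define n where "n = (LINT z|TT. \<phi> z ^ 4)"
  define E where "E = (\<lambda>i. LINT z|TT. (P z \<bullet> e i)\<^sup>2)"
  have n0: "n \<ge> 0" by (simp add: n_def)
  have Nn: "N = ennreal n" unfolding N_def n_def by (rule nn_integral_eq_integral[OF i4]) simp
  have iE: "integrable TT (\<lambda>z. (P z \<bullet> e i)\<^sup>2)" for i
  proof (rule Bochner_Integration.integrable_bound[OF iP])
    have "(P z \<bullet> e i)\<^sup>2 \<le> (norm (P z))\<^sup>2" for z
      using power_mono[OF Basis_le_norm[OF eB, of "P z" i], of 2] by simp
    then show "AE z in TT. norm ((P z \<bullet> e i)\<^sup>2) \<le> norm ((norm (P z))\<^sup>2)" by simp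
  qed simp
  have E0: "E i \<ge> 0" for i by (simp add: E_def)
  \<comment> \<open>Cauchy-Schwarz between \<open>3 \<phi>^2\<close> and the derivative; the square
    of the first factor integrates to \<open>9 n\<close>.\<close>
  have T2: "(T i)\<^sup>2 \<le> ennreal (9 * n * E i)" for i
  proof -
    have "T i = (\<integral>\<^sup>+z. ennreal (3 * (\<phi> z)\<^sup>2) * ennreal \<bar>P z \<bullet> e i\<bar> \<partial>TT)"
      unfolding T_def p_def by (simp add: ennreal_mult)
    then have "(T i)\<^sup>2 \<le> (\<integral>\<^sup>+z. ennreal (3 * (\<phi> z)\<^sup>2) ^ 2 \<partial>TT) * (\<integral>\<^sup>+z. ennreal \<bar>P z \<bullet> e i\<bar> ^ 2 \<partial>TT)"
      by (simp only:) (rule Cauchy_Schwarz_nn_integral; measurable)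
    also have "(\<integral>\<^sup>+z. ennreal (3 * (\<phi> z)\<^sup>2) ^ 2 \<partial>TT) = (\<integral>\<^sup>+z. ennreal (9 * \<phi> z ^ 4) \<partial>TT)"
      by (simp add: ennreal_power power_mult_distrib flip: power_mult)
    also have "\<dots> = ennreal (9 * n)"
      unfolding n_def using i4 by (subst nn_integral_eq_integral) auto
    also have "(\<integral>\<^sup>+z. ennreal \<bar>P z \<bullet> e i\<bar> ^ 2 \<partial>TT) = (\<integral>\<^sup>+z. ennreal ((P z \<bullet> e i)\<^sup>2) \<partial>TT)"
      by (simp add: ennreal_power)
    also have "\<dots> = ennreal (E i)" unfolding E_def by (rule nn_integral_eq_integral[OF iE]) simp
    also have "ennreal (9 * n) * ennreal (E i) = ennreal (9 * n * E i)"
      using n0 E0 by (simp add: ennreal_mult)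
    finally show ?thesis .
  qed
  have "(N ^ 3)\<^sup>2 \<le> (T 1 * T 2 * T 3 * T 4)\<^sup>2" by (rule power_mono[OF LW]) simp
  also have "\<dots> \<le> ennreal (9 * n * E 1) * ennreal (9 * n * E 2) * ennreal (9 * n * E 3) * ennreal (9 * n * E 4)"
    unfolding power_mult_distrib by (intro mult_mono T2) auto
  finally have "(n ^ 3)\<^sup>2 \<le> (9 * n * E 1) * (9 * n * E 2) * (9 * n * E 3) * (9 * n * E 4)"
    using n0 E0 by (simp add: Nn ennreal_power ennreal_mult[symmetric] ennreal_le_iff)
  then have "n ^ 4 * n\<^sup>2 \<le> n ^ 4 * (6561 * (E 1 * E 2 * E 3) * E 4)"
    by (simp add: power2_eq_square power3_eq_cube power4_eq_xxxx algebra_simps)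
  \<comment> \<open>Cancelling \<open>n^4\<close> is legitimate because \<open>n\<close> is finite;
    for \<open>n = 0\<close> nothing has to be cancelled.\<close>
  then have main: "n\<^sup>2 \<le> 6561 * (E 1 * E 2 * E 3) * E 4"
  proof (cases "n = 0")
    case True then show ?thesis using E0 by (simp add: mult_nonneg_nonneg)
  next
    case False
    then have "n ^ 4 > 0" using n0 by simp
    with \<open>n ^ 4 * n\<^sup>2 \<le> _\<close> show ?thesis by (rule mult_left_le_imp_le)
  qed
  define A where "A = (LINT z|TT. (norm (fst (P z)))\<^sup>2)"
  have EA: "E i \<le> A" if i: "i \<in> {1,2,3}" for i
    unfolding E_def A_def
  proof (rule integral_mono[OF iE])
    show "integrable TT (\<lambda>z. (norm (fst (P z)))\<^sup>2)"
      by (intro parts_integrable iP) simp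
    fix z
    obtain j where j: "e i = (axis j 1, 0)" using i by (auto simp: e_def)
    have "\<bar>P z \<bullet> e i\<bar> \<le> norm (fst (P z))"
      using Cauchy_Schwarz_ineq2[of "fst (P z)" "axis j 1"] by (simp add: j inner_prod_def)
    from power_mono[OF this, of 2] show "(P z \<bullet> e i)\<^sup>2 \<le> (norm (fst (P z)))\<^sup>2" by simp
  qed
  have E4: "E 4 = (LINT z|TT. (snd (P z))\<^sup>2)" by (simp add: E_def e_def inner_prod_def)
  have "E 1 * E 2 * E 3 \<le> A * A * A" by (intro mult_mono EA mult_nonneg_nonneg E0 order_trans[OF E0 EA]) auto
  then have "6561 * (E 1 * E 2 * E 3) * E 4 \<le> 6561 * A ^ 3 * E 4"
    using E0 by (intro mult_right_mono) (auto simp: power3_eq_cube)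
  with main show "(LINT z|TT. \<phi> z ^ 4)\<^sup>2 \<le> 6561 * (LINT z|TT. (norm (fst (P z)))\<^sup>2) ^ 3 * (LINT z|TT. (snd (P z))\<^sup>2)"
    unfolding n_def[symmetric] A_def[symmetric] E4[symmetric] by linarith
qed

section \<open>Mollification of periodic functions\<close>

definition L2T :: "(pt \<Rightarrow> real) \<Rightarrow> bool" where
  "L2T f \<longleftrightarrow> periodic_y f \<and> f \<in> borel_measurable borel \<and> integrable TT (\<lambda>z. (f z)\<^sup>2)"

lemma L2T_measurable [measurable_dest]: "L2T f \<Longrightarrow> f \<in> borel_measurable borel"
  by (simp add: L2T_def)

lemma nn_integral_cell:
  assumes [measurable]: "g \<in> borel_measurable borel"
  shows "(\<integral>\<^sup>+z. g z \<partial>TT) = (\<integral>\<^sup>+z. g z * indicator cell z \<partial>lborel)"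
  unfolding TT_density by (subst nn_integral_density) (auto simp: mult.commute)

lemma periodic_y_int: "periodic_y g \<Longrightarrow> g (z + (0, 2 * pi * of_int k)) = g z"
  using periodic_int[of "\<lambda>y. g (fst z, y)" "snd z" k] by (cases z) (simp add: periodic_y_def)

text \<open>A ball is covered by finitely many translates of the cell along y, and by periodicity
  each of them carries the same integral. The values of \<open>g\<close> are extended reals, so
  \<open>g\<close> may be infinite somewhere.\<close>

lemma nn_integral_strip_finite:
  assumes [measurable]: "g \<in> borel_measurable (borel :: pt measure)" and p: "periodic_y g"
    and f: "(\<integral>\<^sup>+z. g z \<partial>TT) < \<infinity>"
  shows "(\<integral>\<^sup>+z. g z * indicator (cball 0 r) z \<partial>lborel) < \<infinity>"
proof -
  define N where "N = \<lceil>\<bar>r\<bar> / (2*pi)\<rceil>"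
  have N: "\<bar>r\<bar> \<le> 2 * pi * of_int N"
  proof -
    have "\<bar>r\<bar> / (2*pi) \<le> of_int N" unfolding N_def by (rule le_of_int_ceiling)
    then show ?thesis by (simp add: divide_le_eq mult.commute)
  qed
  have "(\<integral>\<^sup>+z. g z * indicator (cball 0 r) z \<partial>lborel)
    \<le> (\<integral>\<^sup>+z. (\<Sum>k\<in>{-N..N}. g z * indicator cell (z - (0, 2 * pi * of_int k))) \<partial>lborel)"
  proof (rule nn_integral_mono)
    fix z :: pt
    show "g z * indicator (cball 0 r) z \<le> (\<Sum>k\<in>{-N..N}. g z * indicator cell (z - (0, 2 * pi * of_int k)))"
    proof (cases "z \<in> cball 0 r")
      case True
      then have "\<bar>snd z\<bar> \<le> r" using norm_snd_le[of "snd z" "fst z"] by (simp add: norm_Pair2)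
      \<comment> \<open>The index of the period that contains \<open>z\<close>.\<close>
      define k where "k = \<lfloor>snd z / (2*pi)\<rfloor>"
      have "of_int k \<le> snd z / (2*pi)" "snd z / (2*pi) < of_int k + 1" by (simp_all add: k_def)
      then have k: "2 * pi * of_int k \<le> snd z" "snd z < 2 * pi * of_int k + 2 * pi" by (simp_all add: field_simps)
      then have c: "z - (0, 2 * pi * of_int k) \<in> cell" by (cases z) (auto simp: cell_def)
      have "2 * pi * of_int k \<le> 2 * pi * of_int N" using k(1) N \<open>\<bar>snd z\<bar> \<le> r\<close> by linarith
      moreover have "- (2 * pi * of_int N) < 2 * pi * of_int k + 2 * pi" using k(2) N \<open>\<bar>snd z\<bar> \<le> r\<close> by linarith
      then have "2 * pi * (- of_int N) < 2 * pi * (of_int k + 1)" by (simp add: algebra_simps)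
      ultimately have "real_of_int k \<le> of_int N \<and> - real_of_int N < of_int k + 1"
        by (meson mult_left_le_imp_le mult_left_less_imp_less pi_gt_zero zero_less_mult_iff zero_less_numeral less_imp_le)
      then have "k \<in> {-N..N}" by simp
      then have "g z * indicator cell (z - (0, 2 * pi * of_int k)) \<le> (\<Sum>k\<in>{-N..N}. g z * indicator cell (z - (0, 2 * pi * of_int k)))"
        by (intro member_le_sum) auto
      then show ?thesis using c True by simp
    qed simp
  qed
  also have "\<dots> = (\<Sum>k\<in>{-N..N}. (\<integral>\<^sup>+z. g z * indicator cell (z - (0, 2 * pi * of_int k)) \<partial>lborel))"
    by (rule nn_integral_sum) measurable
  also have "\<dots> = (\<Sum>k\<in>{-N..N}. (\<integral>\<^sup>+z. g z \<partial>TT))"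
  proof (rule sum.cong[OF refl])
    fix k
    have "(\<integral>\<^sup>+z. g z * indicator cell (z - (0, 2 * pi * of_int k)) \<partial>lborel)
      = (\<integral>\<^sup>+z. g (z + (0, 2 * pi * of_int k)) * indicator cell (z + (0, 2 * pi * of_int k) - (0, 2 * pi * of_int k)) \<partial>lborel)"
      by (rule nn_integral_lborel_shift[symmetric]) measurable
    then show "(\<integral>\<^sup>+z. g z * indicator cell (z - (0, 2 * pi * of_int k)) \<partial>lborel) = (\<integral>\<^sup>+z. g z \<partial>TT)"
      by (simp add: periodic_y_int[OF p] nn_integral_cell)
  qed
  also have "\<dots> < \<infinity>" using f by (simp add: ennreal_mult_less_top of_nat_less_top)
  finally show ?thesis .
qed

lemma abs_le_1_plus_square: "\<bar>t\<bar> \<le> 1 + t\<^sup>2" for t :: real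
proof (cases "\<bar>t\<bar> \<le> 1")
  case False
  then have "1 * \<bar>t\<bar> \<le> \<bar>t\<bar> * \<bar>t\<bar>" by (intro mult_right_mono) auto
  also have "\<dots> = t\<^sup>2" by (simp add: power2_eq_square)
  finally show ?thesis by simp
qed (simp add: add_increasing2)

text \<open>Square integrability over one cell becomes local integrability on all of R^4, where weak
  derivatives are tested; \<open>\<bar>f\<bar> \<le> 1 + f^2\<close> passes from the square to
  \<open>f\<close>.\<close>

lemma L2T_loc_int:
  assumes L: "L2T f" shows "loc_int (\<lambda>z. (f z)\<^sup>2)" "loc_int f"
proof -
  note [measurable] = L2T_measurable[OF L]
  have [measurable]: "cball (0::pt) r \<in> sets borel" for r by simp
  have p: "periodic_y (\<lambda>z. ennreal ((f z)\<^sup>2))" using L by (simp add: L2T_def periodic_y_def)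
  have i: "integrable TT (\<lambda>z. (f z)\<^sup>2)" using L by (simp add: L2T_def)
  have "(\<integral>\<^sup>+z. ennreal ((f z)\<^sup>2) \<partial>TT) < \<infinity>" using i by (simp add: integrable_iff_bounded)
  from nn_integral_strip_finite[OF _ p this]
  have fin: "(\<integral>\<^sup>+z. ennreal ((f z)\<^sup>2) * indicator (cball 0 r) z \<partial>lborel) < \<infinity>" for r by simp
  have s2: "set_integrable lborel (cball 0 r) (\<lambda>z. (f z)\<^sup>2)" for r
    unfolding set_integrable_def integrable_iff_bounded
  proof (intro conjI)
    have "(\<integral>\<^sup>+z. ennreal (norm (indicator (cball 0 r) z *\<^sub>R (f z)\<^sup>2)) \<partial>lborel)
        = (\<integral>\<^sup>+z. ennreal ((f z)\<^sup>2) * indicator (cball 0 r) z \<partial>lborel)"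
      by (intro nn_integral_cong) (simp add: indicator_def)
    then show "(\<integral>\<^sup>+z. ennreal (norm (indicator (cball 0 r) z *\<^sub>R (f z)\<^sup>2)) \<partial>lborel) < \<infinity>" using fin by simp
  qed measurable
  then show "loc_int (\<lambda>z. (f z)\<^sup>2)" by (simp add: loc_int_def)
  have "set_integrable lborel (cball 0 r) f" for r
  proof (rule set_integrable_bound)
    have "set_integrable lborel (cball (0::pt) r) (\<lambda>_. 1::real)"
      using loc_int_continuous[of "\<lambda>_::pt. 1"] by (simp add: loc_int_def)
    then show "set_integrable lborel (cball 0 r) (\<lambda>z. 1 + (f z)\<^sup>2)" by (intro set_integral_add(1) s2)
    show "set_borel_measurable lborel (cball 0 r) f" unfolding set_borel_measurable_def by measurable
    show "AE z in lborel. z \<in> cball 0 r \<longrightarrow> norm (f z) \<le> norm (1 + (f z)\<^sup>2)"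
      using abs_le_1_plus_square by simp
  qed
  then show "loc_int f" by (simp add: loc_int_def)
qed

lemma conv_alt:
  assumes [measurable]: "f \<in> borel_measurable borel" "K \<in> borel_measurable borel"
  shows "conv f K z = (LINT w|lborel. f (z - w) * K w)"
proof -
  have [measurable]: "(\<lambda>w. f w * K (z - w)) \<in> borel_measurable borel" by measurable
  show ?thesis using integral_ckernel_shift(1)[of "\<lambda>w. f w * K (z - w)" z] by (simp add: conv_def)
qed

lemma mol_measurable [measurable]: "h > 0 \<Longrightarrow> (mol h :: 'a::euclidean_space \<Rightarrow> real) \<in> borel_measurable borel"
  by (intro ckernel_measurable ckernel_mol)

lemma conv_periodic:
  assumes "L2T f" "h > 0" shows "periodic_y (conv f (mol h))"
proof -
  have "f ((x, y + 2*pi) - w) = f ((x,y) - w)" for x y w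
    using assms(1) by (cases w) (simp add: L2T_def periodic_y_def algebra_simps, metis add.commute add_diff_eq)
  then show ?thesis
    using assms unfolding periodic_y_def by (simp add: conv_alt L2T_measurable mol_measurable)
qed

text \<open>Jensen's inequality bounds the square by an average of translates of \<open>f^2\<close>;
  Tonelli's theorem and the translation invariance of periodic integrals remove the average.\<close>

lemma conv_L2:
  assumes L: "L2T f" and h: "h > 0"
  shows "integrable TT (\<lambda>z. (conv f (mol h) z)\<^sup>2)" "(LINT z|TT. (conv f (mol h) z)\<^sup>2) \<le> (LINT z|TT. (f z)\<^sup>2)"
proof -
  note [measurable] = L2T_measurable[OF L] mol_measurable[OF h]
  note li = L2T_loc_int[OF L]
  have [measurable]: "conv f (mol h) \<in> borel_measurable borel"
    by (intro borel_measurable_continuous_onI continuous_conv li ckernel_mol h)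
  have i: "integrable TT (\<lambda>z. (f z)\<^sup>2)" using L by (simp add: L2T_def)
  have pt: "ennreal ((conv f (mol h) z)\<^sup>2) \<le> (\<integral>\<^sup>+w. ennreal ((f (z - w))\<^sup>2) * ennreal (mol h w) \<partial>lborel)" for z
  proof -
    have "ennreal ((conv f (mol h) z)\<^sup>2) \<le> ennreal (LINT w|lborel. (f (z - w))\<^sup>2 * mol h w)"
      using conv_square_le[OF li(2,1) h, of z] by (intro ennreal_leI) (simp add: conv_alt)
    also have "\<dots> = (\<integral>\<^sup>+w. ennreal ((f (z - w))\<^sup>2 * mol h w) \<partial>lborel)"
    proof (rule nn_integral_eq_integral[symmetric])
      have "integrable lborel (\<lambda>w. (f w)\<^sup>2 * mol h (z - w))" by (intro conv_integrable li ckernel_mol h)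
      then have "integrable (distr lborel borel (\<lambda>w::pt. z - w)) (\<lambda>w. (f w)\<^sup>2 * mol h (z - w))"
        using lborel_affine[of "-1" z] by (simp add: density_1)
      then show "integrable lborel (\<lambda>w. (f (z - w))\<^sup>2 * mol h w)"
        by (subst (asm) integrable_distr_eq) auto
    qed (simp add: mol_nonneg[OF h])
    also have "\<dots> = (\<integral>\<^sup>+w. ennreal ((f (z - w))\<^sup>2) * ennreal (mol h w) \<partial>lborel)"
      by (simp add: ennreal_mult mol_nonneg[OF h])
    finally show ?thesis .
  qed
  interpret P: pair_sigma_finite TT "lborel :: pt measure"
    unfolding TT_def pair_sigma_finite_def
    by (intro conjI sigma_finite_pair_measure sigma_finite_lborel tau.sigma_finite_measure_axioms)
  have p: "periodic_y (\<lambda>z. ennreal ((f z)\<^sup>2))" using L by (simp add: L2T_def periodic_y_def)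
  have "(\<integral>\<^sup>+z. ennreal ((conv f (mol h) z)\<^sup>2) \<partial>TT) \<le> (\<integral>\<^sup>+z. \<integral>\<^sup>+w. ennreal ((f (z - w))\<^sup>2) * ennreal (mol h w) \<partial>lborel \<partial>TT)"
    by (intro nn_integral_mono pt)
  also have "\<dots> = (\<integral>\<^sup>+w. \<integral>\<^sup>+z. ennreal ((f (z - w))\<^sup>2) * ennreal (mol h w) \<partial>TT \<partial>lborel)"
    by (rule P.Fubini'[symmetric]) measurable
  also have "\<dots> = (\<integral>\<^sup>+w. (\<integral>\<^sup>+z. ennreal ((f (z + - w))\<^sup>2) \<partial>TT) * ennreal (mol h w) \<partial>lborel)"
    by (simp add: nn_integral_multc)
  also have "\<dots> = (\<integral>\<^sup>+w. (\<integral>\<^sup>+z. ennreal ((f z)\<^sup>2) \<partial>TT) * ennreal (mol h (w::pt)) \<partial>lborel)"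
  proof -
    have "(\<integral>\<^sup>+z. ennreal ((f (z + - w))\<^sup>2) \<partial>TT) = (\<integral>\<^sup>+z. ennreal ((f z)\<^sup>2) \<partial>TT)" for w
      by (rule nn_integral_TT_shift[OF _ p]) simp
    then show ?thesis by (simp only:)
  qed
  also have "\<dots> = (\<integral>\<^sup>+z. ennreal ((f z)\<^sup>2) \<partial>TT) * (\<integral>\<^sup>+w. ennreal (mol h (w::pt)) \<partial>lborel)"
    by (rule nn_integral_cmult) measurable
  also have "(\<integral>\<^sup>+w. ennreal (mol h (w::pt)) \<partial>lborel) = 1"
    using nn_integral_eq_integral[OF kernel_integrable[OF ckernel_mol[OF h, where 'a=pt]], OF AE_I2[OF mol_nonneg[OF h]]]
    by (simp add: mol_integral[OF h])
  finally have le: "(\<integral>\<^sup>+z. ennreal ((conv f (mol h) z)\<^sup>2) \<partial>TT) \<le> (\<integral>\<^sup>+z. ennreal ((f z)\<^sup>2) \<partial>TT)" by simp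
  also have "\<dots> < \<infinity>" using i by (simp add: integrable_iff_bounded)
  finally show ic: "integrable TT (\<lambda>z. (conv f (mol h) z)\<^sup>2)" by (simp add: integrable_iff_bounded)
  show "(LINT z|TT. (conv f (mol h) z)\<^sup>2) \<le> (LINT z|TT. (f z)\<^sup>2)"
    using le i ic by (simp add: nn_integral_eq_integral)
qed

text \<open>By Jensen's inequality the square at \<open>(x,y)\<close> is at most a constant, fixed
  with \<open>h\<close>, times the integral of \<open>f^2\<close> over the support of the translated
  kernel. For large x this support lies in a tail of \<open>f^2\<close>, up to a shift in y.\<close>

lemma conv_vanish:
  assumes L: "L2T f" and h: "h > 0" "h \<le> 1" and e: "e > 0"
  shows "\<exists>R. \<forall>x y. norm x > R \<longrightarrow> \<bar>conv f (mol h) (x,y)\<bar> < e"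
proof -
  note [measurable] = L2T_measurable[OF L] mol_measurable[OF h(1)]
  note li = L2T_loc_int[OF L]
  have i: "integrable TT (\<lambda>z. (f z)\<^sup>2)" using L by (simp add: L2T_def)
  define C where "C = 1 / (h ^ DIM(pt) * (LINT w|lborel. bump (w::pt)))"
  have C: "C > 0" using bump_integral_pos[where 'a=pt] h by (simp add: C_def)
  define F where "F = (\<lambda>(r::real) z. (f z)\<^sup>2 * indicator {z. norm (fst z) \<ge> r} z)"
  have [measurable]: "F r \<in> borel_measurable borel" for r unfolding F_def by measurable
  have iF: "integrable TT (F r)" for r
    by (rule Bochner_Integration.integrable_bound[OF i]) (auto simp: F_def indicator_def)
  have "(\<lambda>n. LINT z|TT. F (real n) z) \<longlonglongrightarrow> (LINT z|TT. 0)"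
  proof (rule integral_dominated_convergence[OF _ _ i])
    show "AE z in TT. (\<lambda>n. F (real n) z) \<longlonglongrightarrow> 0"
    proof (intro AE_I2)
      fix z :: pt
      obtain m where m: "norm (fst z) < real m" using reals_Archimedean2 by blast
      have "F (real n) z = 0" if "n \<ge> m" for n
      proof -
        have "real m \<le> real n" using that by simp
        then have "norm (fst z) < real n" using m by linarith
        then show ?thesis by (simp add: F_def)
      qed
      then show "(\<lambda>n. F (real n) z) \<longlonglongrightarrow> 0"
        by (intro tendsto_eventually) (auto simp: eventually_sequentially)
    qed
  qed (auto simp: F_def indicator_def)
  then have "(\<lambda>n. LINT z|TT. F (real n) z) \<longlonglongrightarrow> 0" by simp
  moreover have "e\<^sup>2 / C > 0" using e C by simp
  ultimately obtain n where n: "(LINT z|TT. F (real n) z) < e\<^sup>2 / C"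
    using order_tendstoD(2) by (fastforce simp: eventually_sequentially)
  \<comment> \<open>As \<open>h \<le> 1\<close>, the support of the translated kernel stays within
    this distance of \<open>(x,y)\<close>.\<close>
  define c where "c = norm (One :: pt)"
  show ?thesis
  proof (intro exI allI impI)
    fix x :: "real^3" and y :: real assume x: "norm x > real n + c"
    let ?z = "(x,y)"
    \<comment> \<open>In y the support reaches from \<open>y\<close> upwards by at most
      \<open>h\<close>, hence stays inside the period that starts at \<open>y\<close>.\<close>
    have sup: "norm (fst w) \<ge> real n \<and> snd w \<in> {y..y + 2*pi}" if "mol h (?z - w) \<noteq> 0" for w
    proof -
      have b: "?z - w \<in> cbox (- h *\<^sub>R One) 0" by (rule mol_support[OF h(1) that])
      have "norm (?z - w) \<le> norm (One :: pt)"
      proof (rule norm_le_componentwise)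
        fix b :: pt assume bb: "b \<in> Basis"
        then have "- h \<le> (?z - w) \<bullet> b" "(?z - w) \<bullet> b \<le> 0" using b unfolding mem_box by (auto simp: inner_simps)
        then show "\<bar>(?z - w) \<bullet> b\<bar> \<le> \<bar>One \<bullet> b\<bar>" using bb h by simp
      qed
      then have "norm (x - fst w) \<le> c"
        using norm_fst_le[of "x - fst w" "y - snd w"] by (cases w) (simp add: c_def)
      then have 1: "norm (fst w) \<ge> real n" using x norm_triangle_ineq[of "x - fst w" "fst w"] by simp
      have "- h \<le> (?z - w) \<bullet> (0,1)" "(?z - w) \<bullet> (0,1) \<le> 0"
        using b Basis_pt(2) unfolding mem_box by (auto simp: inner_simps)
      then have "- h \<le> y - snd w" "y - snd w \<le> 0" by (cases w; simp)+
      then show ?thesis using 1 h pi_gt3 by auto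
    qed
    have "(conv f (mol h) ?z)\<^sup>2 \<le> (LINT w|lborel. (f w)\<^sup>2 * mol h (?z - w))"
      using conv_square_le[OF li(2,1) h(1)] by (simp add: conv_def)
    then have "ennreal ((conv f (mol h) ?z)\<^sup>2) \<le> ennreal (LINT w|lborel. (f w)\<^sup>2 * mol h (?z - w))" by (rule ennreal_leI)
    also have "\<dots> = (\<integral>\<^sup>+w. ennreal ((f w)\<^sup>2 * mol h (?z - w)) \<partial>lborel)"
      by (rule nn_integral_eq_integral[symmetric]) (auto intro!: conv_integrable li ckernel_mol h mult_nonneg_nonneg mol_nonneg)
    also have "\<dots> \<le> (\<integral>\<^sup>+w. ennreal C * (ennreal (F (real n) w) * indicator cell (w - (0,y))) \<partial>lborel)"
    proof (rule nn_integral_mono)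
      fix w :: pt
      show "ennreal ((f w)\<^sup>2 * mol h (?z - w)) \<le> ennreal C * (ennreal (F (real n) w) * indicator cell (w - (0,y)))"
      proof (cases "mol h (?z - w) = 0")
        case False
        then have "w - (0,y) \<in> cell" "F (real n) w = (f w)\<^sup>2"
          using sup[OF False] by (cases w; auto simp: cell_def F_def)+
        moreover have "(f w)\<^sup>2 * mol h (?z - w) \<le> (f w)\<^sup>2 * C"
          using mol_bound[OF h(1), of "?z - w"] by (intro mult_left_mono) (simp_all add: C_def)
        ultimately show ?thesis using C by (simp add: ennreal_mult[symmetric] ennreal_leI mult.commute)
      qed simp
    qed
    also have "\<dots> = ennreal C * (\<integral>\<^sup>+w. ennreal (F (real n) w) * indicator cell (w - (0,y)) \<partial>lborel)"
      by (rule nn_integral_cmult) measurable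
    also have "(\<integral>\<^sup>+w. ennreal (F (real n) w) * indicator cell (w - (0,y)) \<partial>lborel)
        = (\<integral>\<^sup>+w. ennreal (F (real n) (w + (0,y))) * indicator cell (w + (0,y) - (0,y)) \<partial>lborel)"
      by (rule nn_integral_lborel_shift[symmetric]) measurable
    also have "\<dots> = (\<integral>\<^sup>+w. ennreal (F (real n) (w + (0,y))) \<partial>TT)" by (simp add: nn_integral_cell)
    also have "\<dots> = (\<integral>\<^sup>+w. ennreal (F (real n) w) \<partial>TT)"
      by (rule nn_integral_TT_shift) (use L in \<open>auto simp: periodic_y_def F_def L2T_def indicator_def\<close>)
    also have "\<dots> = ennreal (LINT w|TT. F (real n) w)"
      by (rule nn_integral_eq_integral[OF iF]) (simp add: F_def)
    also have "ennreal C * ennreal (LINT w|TT. F (real n) w) = ennreal (C * (LINT w|TT. F (real n) w))"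
      using C by (simp add: ennreal_mult F_def)
    finally have "(conv f (mol h) ?z)\<^sup>2 \<le> C * (LINT w|TT. F (real n) w)"
      by (subst (asm) ennreal_le_iff) (use C in \<open>auto simp: F_def\<close>)
    also have "\<dots> < e\<^sup>2" using n C by (simp add: field_simps)
    finally show "\<bar>conv f (mol h) ?z\<bar> < e" 
      using e power2_less_imp_less[of "\<bar>conv f (mol h) ?z\<bar>" e] by simp
  qed
qed

section \<open>Weak gradients of periodic functions and their mollification\<close>

definition wgT :: "(pt \<Rightarrow> real) \<Rightarrow> (pt \<Rightarrow> pt) \<Rightarrow> bool" where
  "wgT u G \<longleftrightarrow> L2T u \<and> weak_grad u G \<and> periodic_y G \<and> G \<in> borel_measurable borel \<and>
     integrable TT (\<lambda>z. (norm (G z))\<^sup>2)"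

lemma wgT_component:
  assumes w: "wgT u G" and b: "b \<in> Basis" shows "L2T (\<lambda>z. G z \<bullet> b)" "wderiv u (\<lambda>z. G z \<bullet> b) b"
proof -
  have [measurable]: "G \<in> borel_measurable borel" and i: "integrable TT (\<lambda>z. (norm (G z))\<^sup>2)"
    and p: "periodic_y G" using w by (auto simp: wgT_def)
  show "wderiv u (\<lambda>z. G z \<bullet> b) b" using w b by (simp add: wgT_def weak_grad_iff)
  have "integrable TT (\<lambda>z. (G z \<bullet> b)\<^sup>2)"
  proof (rule Bochner_Integration.integrable_bound[OF i])
    have "(G z \<bullet> b)\<^sup>2 \<le> (norm (G z))\<^sup>2" for z
      using power_mono[OF Basis_le_norm[OF b, of "G z"], of 2] by simp
    then show "AE z in TT. norm ((G z \<bullet> b)\<^sup>2) \<le> norm ((norm (G z))\<^sup>2)" by simp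
  qed measurable
  then show "L2T (\<lambda>z. G z \<bullet> b)" using p by (auto simp: L2T_def periodic_y_def)
qed

lemma wgT_unique:
  assumes "wgT u G" "wgT u G'" shows "AE z in lborel. G z = G' z"
proof -
  have "AE z in lborel. \<forall>b\<in>Basis. G z \<bullet> b = G' z \<bullet> b"
  proof (rule AE_finite_allI)
    fix b :: pt assume b: "b \<in> Basis"
    show "AE z in lborel. G z \<bullet> b = G' z \<bullet> b"
      by (rule wderiv_unique[OF _ _ wgT_component(2)[OF assms(1) b] wgT_component(2)[OF assms(2) b]])
         (intro L2T_loc_int wgT_component(1)[OF assms(1) b] wgT_component(1)[OF assms(2) b])+
  qed simp
  then show ?thesis by eventually_elim (auto intro: euclidean_eqI)
qed

lemma norm_fst_components: "(norm (fst (p::pt)))\<^sup>2 = (\<Sum>i\<in>{1,2,3::3}. (p \<bullet> (axis i 1, 0))\<^sup>2)"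
proof -
  have "(norm (fst p))\<^sup>2 = (\<Sum>b\<in>Basis. (fst p \<bullet> b)\<^sup>2)"
    unfolding power2_norm_eq_inner by (subst euclidean_inner) (simp add: power2_eq_square)
  then show ?thesis by (simp add: sum_Basis3 inner_prod_def)
qed

definition molP :: "(pt \<Rightarrow> pt) \<Rightarrow> real \<Rightarrow> pt \<Rightarrow> pt" where
  "molP G h z = (\<Sum>b\<in>Basis. conv (\<lambda>z. G z \<bullet> b) (mol h) z *\<^sub>R b)"

lemma molP_inner: "b \<in> Basis \<Longrightarrow> molP G h z \<bullet> b = conv (\<lambda>z. G z \<bullet> b) (mol h) z"
  by (simp add: molP_def inner_sum_left_Basis)

text \<open>The x-energy and the y-energy are bounded separately, because they enter the later
  estimates with different powers.\<close>

lemma smoothT_mol: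
  assumes w: "wgT u G" and h: "0 < h" "h \<le> 1"
  shows "smoothT (conv u (mol h)) (molP G h)"
    and "(LINT z|TT. (norm (fst (molP G h z)))\<^sup>2) \<le> (LINT z|TT. (norm (fst (G z)))\<^sup>2)"
    and "(LINT z|TT. (snd (molP G h z))\<^sup>2) \<le> (LINT z|TT. (snd (G z))\<^sup>2)"
proof -
  have L: "L2T u" using w by (simp add: wgT_def)
  note C = wgT_component[OF w]
  have C1: "C1dir (conv u (mol h)) (\<lambda>z. molP G h z \<bullet> b) b" if b: "b \<in> Basis" for b
    unfolding molP_inner[OF b]
    by (intro conv_C1dir L2T_loc_int L C b test_fun_mol h)
  have cx: "integrable TT (\<lambda>z. (molP G h z \<bullet> b)\<^sup>2)" "(LINT z|TT. (molP G h z \<bullet> b)\<^sup>2) \<le> (LINT z|TT. (G z \<bullet> b)\<^sup>2)"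
    "integrable TT (\<lambda>z. (G z \<bullet> b)\<^sup>2)" if b: "b \<in> Basis" for b
    using conv_L2[OF C(1)[OF b] h(1)] C(1)[OF b] by (simp_all add: molP_inner[OF b] L2T_def)
  have sn: "snd p = p \<bullet> (0,1)" for p :: pt by (cases p) simp
  note B = Basis_pt
  have f3: "integrable TT (\<lambda>z. (norm (fst (molP G h z)))\<^sup>2)"
    unfolding norm_fst_components by (intro Bochner_Integration.integrable_sum cx B)
  have s3: "integrable TT (\<lambda>z. (snd (molP G h z))\<^sup>2)" unfolding sn by (intro cx B)
  show "smoothT (conv u (mol h)) (molP G h)"
    unfolding smoothT_def
  proof (intro conjI ballI allI impI)
    show "periodic_y (conv u (mol h))" by (rule conv_periodic[OF L h(1)])
    show "integrable TT (\<lambda>z. (conv u (mol h) z)\<^sup>2)" by (rule conv_L2[OF L h(1)])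
    show "integrable TT (\<lambda>z. (norm (molP G h z))\<^sup>2)" unfolding norm_pt_split using f3 s3 by simp
  qed (use C1 conv_vanish[OF L h] in auto)
  show "(LINT z|TT. (snd (molP G h z))\<^sup>2) \<le> (LINT z|TT. (snd (G z))\<^sup>2)" unfolding sn by (intro cx B)
  show "(LINT z|TT. (norm (fst (molP G h z)))\<^sup>2) \<le> (LINT z|TT. (norm (fst (G z)))\<^sup>2)"
    unfolding norm_fst_components using cx(1,3)[OF B(1)]
    by (subst (1 2) Bochner_Integration.integral_sum) (auto intro!: add_mono cx(2) B)
qed

text \<open>The inequalities for mollified functions are upper bounds, so lower semicontinuity
  carries them to the limit; it also supplies the integrability of the limit.\<close>

lemma fatou_bound:
  fixes F :: "'a \<Rightarrow> real"
  assumes i: "\<And>n. integrable M (f n)" and nn: "\<And>n z. f n z \<ge> 0" and lim: "AE z in M. (\<lambda>n. f n z) \<longlonglongrightarrow> F z"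
    and le: "\<And>n. (LINT z|M. f n z) \<le> C" and [measurable]: "F \<in> borel_measurable M" and F0: "\<And>z. F z \<ge> 0"
  shows "integrable M F" "(LINT z|M. F z) \<le> C"
proof -
  have C0: "C \<ge> 0" using le[of 0] nn by (meson order_trans Bochner_Integration.integral_nonneg)
  have [measurable]: "f n \<in> borel_measurable M" for n using i by auto
  have "(\<integral>\<^sup>+z. ennreal (F z) \<partial>M) = (\<integral>\<^sup>+z. liminf (\<lambda>n. ennreal (f n z)) \<partial>M)"
  proof (rule nn_integral_cong_AE)
    show "AE z in M. ennreal (F z) = liminf (\<lambda>n. ennreal (f n z))"
      using lim
    proof eventually_elim
      fix z assume "(\<lambda>n. f n z) \<longlonglongrightarrow> F z"
      then have "(\<lambda>n. ennreal (f n z)) \<longlonglongrightarrow> ennreal (F z)" by (rule tendsto_ennrealI)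
      then show "ennreal (F z) = liminf (\<lambda>n. ennreal (f n z))"
        by (intro lim_imp_Liminf[symmetric]) auto
    qed
  qed
  also have "\<dots> \<le> liminf (\<lambda>n. \<integral>\<^sup>+z. ennreal (f n z) \<partial>M)" by (rule nn_integral_liminf) measurable
  also have "\<dots> \<le> liminf (\<lambda>n::nat. ennreal C)"
    by (rule Liminf_mono) (use le nn in \<open>auto simp: nn_integral_eq_integral[OF i] ennreal_leI\<close>)
  also have "\<dots> = ennreal C" by (simp add: Liminf_const)
  finally have b: "(\<integral>\<^sup>+z. ennreal (F z) \<partial>M) \<le> ennreal C" .
  then show iF: "integrable M F"
    by (intro integrableI_nonneg) (use F0 le_less_trans[OF b ennreal_less_top] in auto)
  show "(LINT z|M. F z) \<le> C"
    using b C0 F0 by (simp add: nn_integral_eq_integral[OF iF] Bochner_Integration.integral_nonneg)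
qed

lemma integral_tau_shift:
  fixes g :: "real \<Rightarrow> real" assumes c: "continuous_on UNIV g" and p: "\<And>y. g (y + 2*pi) = g y"
  shows "(LINT y|tau. g (y + s)) = (LINT y|tau. g y)"
proof -
  have [measurable]: "g \<in> borel_measurable borel" by (rule borel_measurable_continuous_onI[OF c])
  have c': "continuous_on UNIV (\<lambda>y. g (y + s))"
    by (rule continuous_on_compose2[OF c]) (auto intro!: continuous_intros)
  have "(\<integral>\<^sup>+y. ennreal (g (y + s)) \<partial>tau) = (\<integral>\<^sup>+y. ennreal (g y) \<partial>tau)"
    by (rule nn_integral_tau_shift[of "\<lambda>y. ennreal (g y)"]) (simp_all add: p)
  moreover have "(\<integral>\<^sup>+y. ennreal (- g (y + s)) \<partial>tau) = (\<integral>\<^sup>+y. ennreal (- g y) \<partial>tau)"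
    by (rule nn_integral_tau_shift[of "\<lambda>y. ennreal (- g y)"]) (simp_all add: p)
  ultimately show ?thesis
    by (simp add: real_lebesgue_integral_def integral_tau_continuous(2)[OF c] integral_tau_continuous(2)[OF c'])
qed

definition hseq :: "nat \<Rightarrow> real" where "hseq n = inverse (real (Suc n))"

lemma hseq: "0 < hseq n" "hseq n \<le> 1" by (auto simp: hseq_def field_simps)

lemma conv_hseq_tendsto:
  assumes "wgT u G" shows "AE z in TT. (\<lambda>n. conv u (mol (hseq n)) z) \<longlonglongrightarrow> u z"
  using AE_TT[OF conv_mol_tendsto[OF L2T_loc_int(2)]] assms unfolding hseq_def wgT_def by blast

text \<open>Antiperiodicity is inherited by convolutions, and a shift by \<open>pi\<close> turns it
  into zero mean on every slice; so \<open>sobolev_smooth\<close> applies to all mollified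
  functions. The case of interest is \<open>f(x) cos y\<close>.\<close>

lemma sobolev_antiperiodic:
  assumes w: "wgT u G" and a: "\<And>x y. u (x, y + pi) = - u (x, y)"
  shows "integrable TT (\<lambda>z. u z ^ 4)"
    and "(LINT z|TT. u z ^ 4)\<^sup>2 \<le> 6561 * (LINT z|TT. (norm (fst (G z)))\<^sup>2) ^ 3 * (LINT z|TT. (snd (G z))\<^sup>2)"
proof -
  have L: "L2T u" using w by (simp add: wgT_def)
  note [measurable] = L2T_measurable[OF L]
  let ?A = "LINT z|TT. (norm (fst (G z)))\<^sup>2" and ?D = "LINT z|TT. (snd (G z))\<^sup>2"
  \<comment> \<open>Fatou's lemma bounds the integral itself, so the inequality for its square is
    first rewritten with a square root.\<close>
  define K where "K = sqrt (6561 * ?A ^ 3 * ?D)"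
  have "integrable TT (\<lambda>z. conv u (mol (hseq n)) z ^ 4) \<and> (LINT z|TT. conv u (mol (hseq n)) z ^ 4) \<le> K" for n
  proof -
    note S = smoothT_mol[OF w hseq]
    let ?u = "conv u (mol (hseq n))"
    have ap: "?u (x, y + pi) = - ?u (x, y)" for x y
    proof -
      have "u ((x, y + pi) - z) = - u ((x, y) - z)" for z
        using a[of "x - fst z" "y - snd z"] by (cases z) (simp add: algebra_simps)
      then show ?thesis by (simp add: conv_alt mol_measurable[OF hseq(1)])
    qed
    have mz: "(LINT y|tau. ?u (x,y)) = 0" for x
    proof -
      have c: "continuous_on UNIV (\<lambda>y. ?u (x,y))"
        by (rule continuous_on_compose2[OF smoothT_continuous(1)[OF S(1)]]) (auto intro!: continuous_intros)
      have "(LINT y|tau. ?u (x, y + pi)) = (LINT y|tau. ?u (x,y))"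
        by (rule integral_tau_shift[OF c]) (use conv_periodic[OF L hseq(1)] in \<open>simp add: periodic_y_def\<close>)
      then show ?thesis by (simp add: ap)
    qed
    have "(LINT z|TT. ?u z ^ 4)\<^sup>2 \<le> 6561 * (LINT z|TT. (norm (fst (molP G (hseq n) z)))\<^sup>2) ^ 3 * (LINT z|TT. (snd (molP G (hseq n) z))\<^sup>2)"
      by (rule sobolev_smooth(2)[OF S(1) mz])
    also have "\<dots> \<le> 6561 * ?A ^ 3 * ?D"
      by (intro mult_mono power_mono S) (auto intro!: mult_nonneg_nonneg zero_le_power Bochner_Integration.integral_nonneg)
    finally have "(LINT z|TT. ?u z ^ 4) \<le> K" unfolding K_def by (rule real_le_rsqrt)
    then show ?thesis using sobolev_smooth(1)[OF S(1) mz] by simp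
  qed
  note b = this
  have lim: "AE z in TT. (\<lambda>n. conv u (mol (hseq n)) z ^ 4) \<longlonglongrightarrow> u z ^ 4"
    using conv_hseq_tendsto[OF w] by eventually_elim (rule tendsto_power)
  note F = fatou_bound[where M=TT and f="\<lambda>n z. conv u (mol (hseq n)) z ^ 4" and F="\<lambda>z. u z ^ 4" and C=K, OF _ _ lim]
  show "integrable TT (\<lambda>z. u z ^ 4)" by (rule F) (use b in auto)
  have le: "(LINT z|TT. u z ^ 4) \<le> K" by (rule F) (use b in auto)
  have "0 \<le> 6561 * ?A ^ 3 * ?D"
    by simp
  then have "K\<^sup>2 = 6561 * ?A ^ 3 * ?D" unfolding K_def by simp
  then show "(LINT z|TT. u z ^ 4)\<^sup>2 \<le> 6561 * ?A ^ 3 * ?D"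
    using power_mono[OF le, of 2] by (simp add: Bochner_Integration.integral_nonneg)
qed

section \<open>Product functions\<close>

definition wgR :: "(real^3 \<Rightarrow> real) \<Rightarrow> (real^3 \<Rightarrow> real^3) \<Rightarrow> bool" where
  "wgR f F \<longleftrightarrow> f \<in> borel_measurable borel \<and> integrable lborel (\<lambda>x. (f x)\<^sup>2) \<and> weak_grad f F \<and>
     F \<in> borel_measurable borel \<and> integrable lborel (\<lambda>x. (norm (F x))\<^sup>2)"

lemma L2_loc_int:
  fixes f :: "'a::euclidean_space \<Rightarrow> real"
  assumes [measurable]: "f \<in> borel_measurable borel" and i: "integrable lborel (\<lambda>x. (f x)\<^sup>2)"
  shows "loc_int f"
proof -
  have [measurable]: "cball (0::'a) r \<in> sets borel" for r by simp
  have "set_integrable lborel (cball 0 r) f" for r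
  proof (rule set_integrable_bound)
    have "set_integrable lborel (cball (0::'a) r) (\<lambda>_. 1::real)"
      using loc_int_continuous[of "\<lambda>_::'a. 1"] by (simp add: loc_int_def)
    moreover have "set_integrable lborel (cball 0 r) (\<lambda>x. (f x)\<^sup>2)"
      unfolding set_integrable_def by (rule integrable_mult_indicator[OF _ i]) simp
    ultimately show "set_integrable lborel (cball 0 r) (\<lambda>z. 1 + (f z)\<^sup>2)" by (rule set_integral_add(1))
    show "set_borel_measurable lborel (cball 0 r) f" unfolding set_borel_measurable_def by measurable
    show "AE z in lborel. z \<in> cball 0 r \<longrightarrow> norm (f z) \<le> norm (1 + (f z)\<^sup>2)"
      using abs_le_1_plus_square by simp
  qed
  then show "loc_int f" by (simp add: loc_int_def)
qed

lemma wgR_component: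
  assumes w: "wgR f F" and b: "b \<in> Basis"
  shows "loc_int (\<lambda>z. F z \<bullet> b)" "wderiv f (\<lambda>z. F z \<bullet> b) b" "loc_int f" "integrable lborel (\<lambda>z. (F z \<bullet> b)\<^sup>2)"
proof -
  have [measurable]: "F \<in> borel_measurable borel" "f \<in> borel_measurable borel" and i: "integrable lborel (\<lambda>z. (norm (F z))\<^sup>2)"
    and i2: "integrable lborel (\<lambda>x. (f x)\<^sup>2)" using w by (auto simp: wgR_def)
  show "wderiv f (\<lambda>z. F z \<bullet> b) b" using w b by (simp add: wgR_def weak_grad_iff)
  show "loc_int f" by (rule L2_loc_int[OF _ i2]) simp
  show ib: "integrable lborel (\<lambda>z. (F z \<bullet> b)\<^sup>2)"
  proof (rule Bochner_Integration.integrable_bound[OF i])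
    have "(F z \<bullet> b)\<^sup>2 \<le> (norm (F z))\<^sup>2" for z
      using power_mono[OF Basis_le_norm[OF b, of "F z"], of 2] by simp
    then show "AE z in lborel. norm ((F z \<bullet> b)\<^sup>2) \<le> norm ((norm (F z))\<^sup>2)" by simp
  qed measurable
  then show "loc_int (\<lambda>z. F z \<bullet> b)" by (intro L2_loc_int) measurable
qed

lemma wgR_unique:
  assumes "wgR f F" "wgR f F'" shows "AE z in lborel. F z = F' z"
proof -
  have "AE z in lborel. \<forall>b\<in>Basis. F z \<bullet> b = F' z \<bullet> b"
  proof (rule AE_finite_allI)
    fix b :: "real^3" assume b: "b \<in> Basis"
    show "AE z in lborel. F z \<bullet> b = F' z \<bullet> b"
      by (rule wderiv_unique[OF wgR_component(1)[OF assms(1) b] wgR_component(1)[OF assms(2) b]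
         wgR_component(2)[OF assms(1) b] wgR_component(2)[OF assms(2) b]])
  qed simp
  then show ?thesis by eventually_elim (auto intro: euclidean_eqI)
qed

lemma TT_product:
  fixes F :: "real^3 \<Rightarrow> real" and H :: "real \<Rightarrow> real"
  assumes F: "integrable lborel F" and H: "integrable tau H"
  shows "integrable TT (\<lambda>z. F (fst z) * H (snd z))" "(LINT z|TT. F (fst z) * H (snd z)) = (LINT x|lborel. F x) * (LINT y|tau. H y)"
proof -
  have [measurable]: "F \<in> borel_measurable lborel" "H \<in> borel_measurable tau" using F H by auto
  have "integrable (lborel \<Otimes>\<^sub>M tau) (\<lambda>z. F (fst z) * H (snd z))"
  proof (rule lborel_tau.Fubini_integrable)
    show "integrable lborel (\<lambda>x. LINT y|tau. norm (F (fst (x, y)) * H (snd (x, y))))"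
      using F H by (simp add: abs_mult)
    show "AE x in lborel. integrable tau (\<lambda>y. F (fst (x, y)) * H (snd (x, y)))" using H by simp
  qed measurable
  then show i: "integrable TT (\<lambda>z. F (fst z) * H (snd z))" by (simp add: TT_def)
  show "(LINT z|TT. F (fst z) * H (snd z)) = (LINT x|lborel. F x) * (LINT y|tau. H y)"
    using lborel_tau.integral_fst'[of "\<lambda>z. F (fst z) * H (snd z)"] i F H by (simp add: TT_def)
qed

lemma integral_pt_iterated:
  fixes f :: "pt \<Rightarrow> real"
  assumes "integrable lborel f"
  shows "(LINT z|lborel. f z) = (LINT y|lborel. LINT x|lborel. f (x,y))" "(LINT z|lborel. f z) = (LINT x|lborel. LINT y|lborel. f (x,y))"
proof -
  have i: "integrable (lborel \<Otimes>\<^sub>M lborel) f" using assms by (simp add: lborel_prod)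
  show "(LINT z|lborel. f z) = (LINT x|lborel. LINT y|lborel. f (x,y))"
    using lborel_pair.integral_fst'[OF i] by (simp add: lborel_prod)
  show "(LINT z|lborel. f z) = (LINT y|lborel. LINT x|lborel. f (x,y))"
    using lborel_pair.integral_snd[of "\<lambda>x y. f (x,y)"] i by (simp add: lborel_prod)
qed

text \<open>Slices of a test function in x or in y are again test functions, so Fubini's theorem
  reduces each partial derivative to that of one factor.\<close>

lemma wgT_product:
  assumes w: "wgR f F" and h: "C1dir h h' (1::real)" and p: "\<And>y. h (y + 2*pi) = h y" "\<And>y. h' (y + 2*pi) = h' y"
  shows "wgT (\<lambda>z. f (fst z) * h (snd z)) (\<lambda>z. (h (snd z) *\<^sub>R F (fst z), f (fst z) * h' (snd z)))"
proof -
  let ?u = "\<lambda>z::pt. f (fst z) * h (snd z)" and ?G = "\<lambda>z::pt. (h (snd z) *\<^sub>R F (fst z), f (fst z) * h' (snd z))"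
  have [measurable]: "f \<in> borel_measurable borel" "F \<in> borel_measurable borel" using w by (auto simp: wgR_def)
  have if2: "integrable lborel (\<lambda>x. (f x)\<^sup>2)" "integrable lborel (\<lambda>x. (norm (F x))\<^sup>2)" using w by (auto simp: wgR_def)
  have ch: "continuous_on UNIV h" "continuous_on UNIV h'" using h by (auto simp: C1dir_def)
  then have [measurable]: "h \<in> borel_measurable borel" "h' \<in> borel_measurable borel"
    by (auto intro: borel_measurable_continuous_onI)
  have ih: "integrable tau (\<lambda>y. (h y)\<^sup>2)" "integrable tau (\<lambda>y. (h' y)\<^sup>2)"
    by (intro integral_tau_continuous(2) continuous_intros ch)+
  have m[measurable]: "?u \<in> borel_measurable borel" by measurable
  have m2: "(\<lambda>z::pt. f (fst z) * h' (snd z)) \<in> borel_measurable borel" by measurable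
  have mG: "?G \<in> borel_measurable borel"
  proof -
    have "?G \<in> borel_measurable (borel \<Otimes>\<^sub>M borel)" by measurable
    then have "?G \<in> (borel \<Otimes>\<^sub>M borel) \<rightarrow>\<^sub>M (borel \<Otimes>\<^sub>M borel)" by (simp add: borel_prod)
    then show ?thesis by (simp add: borel_prod)
  qed
  have Lu: "L2T ?u"
    using TT_product(1)[OF if2(1) ih(1)] m p by (simp add: L2T_def periodic_y_def power_mult_distrib)
  have Lu': "L2T (\<lambda>z. f (fst z) * h' (snd z))"
    using TT_product(1)[OF if2(1) ih(2)] m2 p by (simp add: L2T_def periodic_y_def power_mult_distrib)
  have LG: "L2T (\<lambda>z. h (snd z) * (F (fst z) \<bullet> j))" if j: "j \<in> Basis" for j
  proof -
    have "(\<lambda>z::pt. h (snd z) * (F (fst z) \<bullet> j)) \<in> borel_measurable borel" by measurable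
    then show ?thesis
      using TT_product(1)[OF wgR_component(4)[OF w j] ih(1)] p
      by (simp add: L2T_def periodic_y_def power_mult_distrib mult.commute)
  qed
  have iG: "integrable TT (\<lambda>z. (norm (?G z))\<^sup>2)"
    using TT_product(1)[OF if2(2) ih(1)] TT_product(1)[OF if2(1) ih(2)]
    by (simp add: norm_pt_split power_mult_distrib mult.commute)
  have wd: "wderiv ?u (\<lambda>z. ?G z \<bullet> b) b" if b: "b \<in> Basis" for b
    unfolding wderiv_def
  proof (intro allI impI)
    fix \<phi> :: "pt \<Rightarrow> real" assume t: "test_fun \<phi>"
    let ?d = "\<lambda>z. frechet_derivative \<phi> (at z) b"
    note k = test_fun_C1dir(2,3)[OF t b]
    consider (x) j where "j \<in> Basis" "b = (j, 0)" | (y) "b = (0, 1)"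
      using b by (auto simp: Basis_prod_def)
    then show "(LINT z|lborel. ?u z * ?d z) = - (LINT z|lborel. (?G z \<bullet> b) * \<phi> z)"
    proof cases
      case x
      have lin: "linear (\<lambda>x::real^3. (x, 0::real))" by (rule linearI) auto
      have tf: "test_fun (\<lambda>x. \<phi> (x, y))" "frechet_derivative (\<lambda>x. \<phi> (x, y)) (at x) j = ?d (x, y)" for x y
        using test_fun_affine[OF t lin, of 1 "(0, y)"] by (simp_all add: x norm_Pair)
      have i1: "integrable lborel (\<lambda>z. ?u z * ?d z)"
        by (intro loc_int_ckernel_integrable L2T_loc_int Lu k)
      have i2: "integrable lborel (\<lambda>z. h (snd z) * (F (fst z) \<bullet> j) * \<phi> z)"
        by (intro loc_int_ckernel_integrable L2T_loc_int LG k x)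
      have "(LINT z|lborel. ?u z * ?d z) = (LINT y|lborel. LINT x|lborel. f x * h y * ?d (x, y))"
        using integral_pt_iterated(1)[OF i1] by simp
      also have "\<dots> = (LINT y|lborel. h y * (LINT x|lborel. f x * frechet_derivative (\<lambda>x. \<phi> (x, y)) (at x) j))"
        by (simp add: tf(2) mult_ac flip: integral_mult_right_zero)
      also have "\<dots> = (LINT y|lborel. h y * (- (LINT x|lborel. (F x \<bullet> j) * \<phi> (x, y))))"
        using wgR_component(2)[OF w x(1)] tf(1) by (simp add: wderiv_def)
      also have "\<dots> = - (LINT y|lborel. LINT x|lborel. h y * (F x \<bullet> j) * \<phi> (x, y))"
        by (simp add: mult.assoc)
      also have "(LINT y|lborel. LINT x|lborel. h y * (F x \<bullet> j) * \<phi> (x, y)) = (LINT z|lborel. (?G z \<bullet> b) * \<phi> z)"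
        using integral_pt_iterated(1)[OF i2] by (simp add: x)
      finally show ?thesis .
    next
      case y
      have lin: "linear (\<lambda>y::real. (0::real^3, y))" by (rule linearI) auto
      have tf: "test_fun (\<lambda>y. \<phi> (x, y))" "frechet_derivative (\<lambda>y. \<phi> (x, y)) (at y) 1 = ?d (x, y)" for x y
        using test_fun_affine[OF t lin, of 1 "(x, 0)"] by (simp_all add: \<open>b = (0, 1)\<close> norm_Pair)
      have i1: "integrable lborel (\<lambda>z. ?u z * ?d z)"
        by (intro loc_int_ckernel_integrable L2T_loc_int Lu k)
      have i2: "integrable lborel (\<lambda>z. f (fst z) * h' (snd z) * \<phi> z)"
        by (intro loc_int_ckernel_integrable L2T_loc_int Lu' k)
      have wh: "wderiv h h' 1" by (rule C1dir_wderiv[OF h]) simp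
      have "(LINT z|lborel. ?u z * ?d z) = (LINT x|lborel. LINT y|lborel. f x * h y * ?d (x, y))"
        using integral_pt_iterated(2)[OF i1] by simp
      also have "\<dots> = (LINT x|lborel. f x * (LINT y|lborel. h y * frechet_derivative (\<lambda>y. \<phi> (x, y)) (at y) 1))"
        by (simp add: tf(2) mult.assoc)
      also have "\<dots> = (LINT x|lborel. f x * (- (LINT y|lborel. h' y * \<phi> (x, y))))"
        using wh tf(1) by (simp add: wderiv_def)
      also have "\<dots> = - (LINT x|lborel. LINT y|lborel. f x * h' y * \<phi> (x, y))"
        by (simp add: mult.assoc)
      also have "(LINT x|lborel. LINT y|lborel. f x * h' y * \<phi> (x, y)) = (LINT z|lborel. (?G z \<bullet> b) * \<phi> z)"
        using integral_pt_iterated(2)[OF i2] by (simp add: \<open>b = (0, 1)\<close>)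
      finally show ?thesis .
    qed
  qed
  show ?thesis
    unfolding wgT_def weak_grad_iff
    using Lu wd mG iG p by (auto simp: periodic_y_def)
qed

section \<open>Trigonometric integrals over a period\<close>

lemma tau_integrals:
  "(LINT y|tau. (cos y)\<^sup>2) = pi" "(LINT y|tau. (cos y) ^ 4) = 3 * pi / 4" "(LINT y|tau. (- sin y)\<^sup>2) = pi"
  "(LINT y|tau. 1) = 2 * pi"
proof -
  have *: "(LINT y|tau. g y) = H (2*pi) - H 0"
    if "\<And>y. (H has_real_derivative g y) (at y)" "continuous_on UNIV g" for g H :: "real \<Rightarrow> real"
  proof -
    have "(g has_integral (H (2*pi) - H 0)) {0..2*pi}"
      using that(1) by (intro fundamental_theorem_of_calculus)
        (auto simp: has_real_derivative_iff_has_vector_derivative[symmetric] intro: has_field_derivative_at_within)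
    then show ?thesis by (simp add: integral_tau_continuous(1)[OF that(2)] integral_unique)
  qed
  have c: "(cos y)\<^sup>2 = 1 - (sin y)\<^sup>2" for y :: real by (simp add: cos_squared_eq)
  have "(LINT y|tau. (cos y)\<^sup>2) = (\<lambda>y. y/2 + sin y * cos y / 2) (2*pi) - (\<lambda>y. y/2 + sin y * cos y / 2) 0"
    by (rule *) (auto intro!: derivative_eq_intros continuous_intros simp: c power2_eq_square[symmetric] field_simps)
  then show "(LINT y|tau. (cos y)\<^sup>2) = pi" by simp
  have "(LINT y|tau. (- sin y)\<^sup>2) = (\<lambda>y. y/2 - sin y * cos y / 2) (2*pi) - (\<lambda>y. y/2 - sin y * cos y / 2) 0"
    by (rule *) (auto intro!: derivative_eq_intros continuous_intros simp: c power2_eq_square[symmetric] field_simps)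
  then show "(LINT y|tau. (- sin y)\<^sup>2) = pi" by simp
  \<comment> \<open>The reduction formula for powers of the cosine, applied twice.\<close>
  let ?H = "\<lambda>y. 3*y/8 + 3/8 * (sin y * cos y) + 1/4 * (sin y * cos y ^ 3)"
  have "(LINT y|tau. (cos y) ^ 4) = ?H (2*pi) - ?H 0"
  proof (rule *)
    fix y :: real
    have s: "sin y * sin y = 1 - cos y * cos y" by (simp add: power2_eq_square[symmetric] sin_squared_eq)
    have "(?H has_real_derivative 3/8 + 3/8 * (cos y * cos y - sin y * sin y) + 1/4 * (cos y * cos y ^ 3 - 3 * (cos y)\<^sup>2 * (sin y * sin y))) (at y)"
      by (auto intro!: derivative_eq_intros simp: field_simps)
    also have "3/8 + 3/8 * (cos y * cos y - sin y * sin y) + 1/4 * (cos y * cos y ^ 3 - 3 * (cos y)\<^sup>2 * (sin y * sin y)) = cos y ^ 4"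
      unfolding s by (simp add: power2_eq_square power3_eq_cube power4_eq_xxxx field_simps)
    finally show "(?H has_real_derivative cos y ^ 4) (at y)" .
  qed (auto intro!: continuous_intros)
  then show "(LINT y|tau. (cos y) ^ 4) = 3 * pi / 4" by simp
  show "(LINT y|tau. 1) = 2 * pi" by (simp add: measure_def emeasure_tau)
qed

section \<open>The problem on the whole space\<close>

abbreviation sqint :: "(real^3 \<Rightarrow> 'b::real_normed_vector) \<Rightarrow> real" where
  "sqint f \<equiv> LINT x|lborel. (norm (f x))\<^sup>2"

definition quartR :: "(real^3 \<Rightarrow> real) \<Rightarrow> (real^3 \<Rightarrow> real) \<Rightarrow> real" where
  "quartR f g = (LINT x|lborel. ((f x)\<^sup>2 + (g x)\<^sup>2)\<^sup>2)"

definition GN :: real where "GN = 11664 * pi\<^sup>2"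

text \<open>Obtained from \<open>sobolev_antiperiodic\<close> for \<open>f(x) cos y\<close>; the constant is \<open>6561 \<pi>\<^sup>4 / (3\<pi>/4)\<^sup>2\<close>.\<close>

lemma gagliardo_nirenberg:
  assumes w: "wgR f F"
  shows "integrable lborel (\<lambda>x. f x ^ 4)" "(LINT x|lborel. f x ^ 4)\<^sup>2 \<le> GN * sqint F ^ 3 * sqint f"
proof -
  have [measurable]: "f \<in> borel_measurable borel" and i: "integrable lborel (\<lambda>x. (norm (F x))\<^sup>2)" "integrable lborel (\<lambda>x. (f x)\<^sup>2)"
    using w by (auto simp: wgR_def)
  let ?u = "\<lambda>z::pt. f (fst z) * cos (snd z)"
  have h: "C1dir (cos :: real \<Rightarrow> real) (\<lambda>y. - sin y) 1"
    unfolding C1dir_def by (auto intro!: continuous_intros derivative_eq_intros)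
  have wT: "wgT ?u (\<lambda>z. (cos (snd z) *\<^sub>R F (fst z), f (fst z) * - sin (snd z)))"
    by (rule wgT_product[OF w h]) auto
  note S = sobolev_antiperiodic[OF wT]
  \<comment> \<open>The Sobolev inequality gives integrability of the product only. That of
    \<open>f^4\<close> is extracted by factoring the extended nonnegative integral, whose cosine
    factor is positive.\<close>
  have i4: "integrable TT (\<lambda>z. f (fst z) ^ 4 * (cos (snd z)) ^ 4)"
    using S(1) by (simp add: power_mult_distrib)
  have ic: "integrable tau (\<lambda>y. (cos y) ^ 4)" "integrable tau (\<lambda>y. (cos y)\<^sup>2)" "integrable tau (\<lambda>y. (- sin y)\<^sup>2)"
    by (intro integral_tau_continuous(2) continuous_intros)+
  have "(\<integral>\<^sup>+z. ennreal (f (fst z) ^ 4 * (cos (snd z)) ^ 4) \<partial>TT) = (\<integral>\<^sup>+x. \<integral>\<^sup>+y. ennreal (f x ^ 4) * ennreal ((cos y) ^ 4) \<partial>tau \<partial>lborel)"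
    by (subst nn_integral_TT(2)) (simp_all add: ennreal_mult)
  also have "\<dots> = (\<integral>\<^sup>+x. ennreal (f x ^ 4) \<partial>lborel) * (\<integral>\<^sup>+y. ennreal ((cos y) ^ 4) \<partial>tau)"
    by (simp add: nn_integral_cmult nn_integral_multc)
  also have "(\<integral>\<^sup>+y. ennreal ((cos y) ^ 4) \<partial>tau) = ennreal (3 * pi / 4)"
    by (subst nn_integral_eq_integral[OF ic(1)]) (auto simp: tau_integrals)
  finally have "(\<integral>\<^sup>+x. ennreal (f x ^ 4) \<partial>lborel) * ennreal (3 * pi / 4) = (\<integral>\<^sup>+z. ennreal (f (fst z) ^ 4 * (cos (snd z)) ^ 4) \<partial>TT)" by simp
  also have "\<dots> < \<infinity>" using i4 by (simp add: integrable_iff_bounded)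
  finally have "(\<integral>\<^sup>+x. ennreal (f x ^ 4) \<partial>lborel) < \<infinity>"
    using pi_gt_zero by (auto simp: ennreal_mult_less_top ennreal_eq_0_iff mult_le_0_iff)
  then show if4: "integrable lborel (\<lambda>x. f x ^ 4)" by (intro integrableI_nonneg) auto
  have e1: "(LINT z|TT. ?u z ^ 4) = (LINT x|lborel. f x ^ 4) * (3 * pi / 4)"
    using TT_product(2)[OF if4 ic(1)] by (simp add: power_mult_distrib tau_integrals)
  have e2: "(LINT z|TT. (norm (cos (snd z) *\<^sub>R F (fst z)))\<^sup>2) = sqint F * pi"
    using TT_product(2)[OF i(1) ic(2)] by (simp add: power_mult_distrib tau_integrals mult.commute)
  have e3: "(LINT z|TT. (f (fst z) * - sin (snd z))\<^sup>2) = sqint f * pi"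
    using TT_product(2)[OF i(2) ic(3)] by (simp add: power_mult_distrib tau_integrals(3)[simplified])
  have "((LINT x|lborel. f x ^ 4) * (3 * pi / 4))\<^sup>2 \<le> 6561 * (sqint F * pi) ^ 3 * (sqint f * pi)"
    using S(2) unfolding e1 fst_conv snd_conv e2 e3 by simp
  then have "(9 * pi\<^sup>2 / 16) * (LINT x|lborel. f x ^ 4)\<^sup>2 \<le> (9 * pi\<^sup>2 / 16) * (GN * sqint F ^ 3 * sqint f)"
    by (simp add: GN_def power2_eq_square power3_eq_cube algebra_simps)
  then show "(LINT x|lborel. f x ^ 4)\<^sup>2 \<le> GN * sqint F ^ 3 * sqint f"
    by (rule mult_left_le_imp_le) simp
qed

lemma square_sum_le: "((a::real)\<^sup>2 + b\<^sup>2)\<^sup>2 \<le> 2 * a ^ 4 + 2 * b ^ 4"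
proof -
  have "0 \<le> (a\<^sup>2 - b\<^sup>2)\<^sup>2" by simp
  then show ?thesis by (simp add: power2_eq_square power4_eq_xxxx algebra_simps)
qed

lemma quartR_integrable:
  assumes f: "wgR f F" and g: "wgR g G"
  shows "integrable lborel (\<lambda>x. ((f x)\<^sup>2 + (g x)\<^sup>2)\<^sup>2)"
proof (rule Bochner_Integration.integrable_bound)
  have [measurable]: "f \<in> borel_measurable borel" "g \<in> borel_measurable borel" using f g by (auto simp: wgR_def)
  show "integrable lborel (\<lambda>x. 2 * f x ^ 4 + 2 * g x ^ 4)"
    using gagliardo_nirenberg(1)[OF f] gagliardo_nirenberg(1)[OF g] by simp
  show "(\<lambda>x. ((f x)\<^sup>2 + (g x)\<^sup>2)\<^sup>2) \<in> borel_measurable lborel" by measurable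
  show "AE x in lborel. norm (((f x)\<^sup>2 + (g x)\<^sup>2)\<^sup>2) \<le> norm (2 * f x ^ 4 + 2 * g x ^ 4)"
    using square_sum_le by (intro AE_I2) (simp add: abs_of_nonneg)
qed

lemma sqint_nonneg: "sqint f \<ge> 0" by simp

text \<open>A crude version for pairs; it serves for \<open>m_R 1 > 0\<close> and for degenerate
  pairs. The 16 is 8 from \<open>(2X + 2Y)^2 \<le> 8 (X^2 + Y^2)\<close> times 2 for the two
  components.\<close>

lemma gn_pair:
  assumes f: "wgR f F" and g: "wgR g G"
  shows "(quartR f g)\<^sup>2 \<le> 16 * GN * (sqint F + sqint G) ^ 3 * (sqint f + sqint g)"
proof -
  let ?X = "LINT x|lborel. f x ^ 4" and ?Y = "LINT x|lborel. g x ^ 4"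
  let ?a = "sqint F + sqint G" and ?s = "sqint f + sqint g"
  have GN: "GN > 0" by (simp add: GN_def)
  have "quartR f g \<le> (LINT x|lborel. 2 * f x ^ 4 + 2 * g x ^ 4)"
    unfolding quartR_def using gagliardo_nirenberg(1)[OF f] gagliardo_nirenberg(1)[OF g]
    by (intro integral_mono quartR_integrable[OF f g] square_sum_le) auto
  also have "\<dots> = 2 * ?X + 2 * ?Y" using gagliardo_nirenberg(1)[OF f] gagliardo_nirenberg(1)[OF g] by simp
  finally have b: "quartR f g \<le> 2 * ?X + 2 * ?Y" .
  have "GN * sqint F ^ 3 * sqint f \<le> GN * ?a ^ 3 * ?s" "GN * sqint G ^ 3 * sqint g \<le> GN * ?a ^ 3 * ?s"
    using GN by (intro mult_mono power_mono; simp)+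
  then have XY: "?X\<^sup>2 \<le> GN * ?a ^ 3 * ?s" "?Y\<^sup>2 \<le> GN * ?a ^ 3 * ?s"
    using gagliardo_nirenberg(2)[OF f] gagliardo_nirenberg(2)[OF g] by linarith+
  have "(quartR f g)\<^sup>2 \<le> (2 * ?X + 2 * ?Y)\<^sup>2" by (rule power_mono[OF b]) (simp add: quartR_def)
  also have "\<dots> \<le> 8 * (?X\<^sup>2 + ?Y\<^sup>2)"
  proof -
    have "0 \<le> 4 * (?X - ?Y)\<^sup>2" by simp
    then show ?thesis by (simp add: power2_eq_square algebra_simps)
  qed
  also have "\<dots> \<le> 16 * GN * ?a ^ 3 * ?s" using XY by simp
  finally show ?thesis .
qed

lemma quartR_pos:
  assumes f: "wgR f F" and g: "wgR g G" and m: "sqint f + sqint g > 0"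
  shows "quartR f g > 0" "sqint F + sqint G > 0"
proof -
  have [measurable]: "f \<in> borel_measurable borel" "g \<in> borel_measurable borel" using f g by (auto simp: wgR_def)
  have "quartR f g \<noteq> 0"
  proof
    assume "quartR f g = 0"
    then have "AE x in lborel. ((f x)\<^sup>2 + (g x)\<^sup>2)\<^sup>2 = 0"
      unfolding quartR_def using integral_nonneg_eq_0_iff_AE[OF quartR_integrable[OF f g]] by auto
    then have "AE x in lborel. f x = 0 \<and> g x = 0"
      by eventually_elim (simp add: sum_power2_eq_zero_iff)
    then have "sqint f = (LINT x|(lborel::(real^3) measure). 0)" "sqint g = (LINT x|(lborel::(real^3) measure). 0)"
      by (intro integral_cong_AE; (measurable | (eventually_elim, simp)))+
    then show False using m by simp
  qed
  moreover have "quartR f g \<ge> 0" by (simp add: quartR_def)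
  ultimately show b: "quartR f g > 0" by simp
  have "sqint F + sqint G \<noteq> 0" using gn_pair[OF f g] b by auto
  moreover have "sqint F + sqint G \<ge> 0" by simp
  ultimately show "sqint F + sqint G > 0" by linarith
qed

lemma H1R_wgR: "f \<in> H1R \<Longrightarrow> wgR f (gradR f)"
proof -
  assume f: "f \<in> H1R"
  let ?P = "\<lambda>G. weak_grad f G \<and> G \<in> borel_measurable lborel \<and> integrable lborel (\<lambda>x. (norm (G x))\<^sup>2)"
  have "?P (gradR f)" unfolding gradR_def by (rule someI_ex[of ?P]) (use f in \<open>simp add: H1R_def\<close>)
  then show ?thesis using f by (simp add: wgR_def H1R_def)
qed

text \<open>Weak gradients are unique almost everywhere, so energies do not depend on the choice
  made in \<open>gradR\<close> and can be computed from any explicit gradient.\<close>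

lemma wgR_H1R:
  assumes w: "wgR f F" shows "f \<in> H1R" "sqint (gradR f) = sqint F"
proof -
  show f: "f \<in> H1R" using w unfolding wgR_def H1R_def by (auto simp: measurable_lborel1)
  have [measurable]: "F \<in> borel_measurable borel" "gradR f \<in> borel_measurable borel"
    using w H1R_wgR[OF f] by (auto simp: wgR_def)
  have "AE x in lborel. (norm (gradR f x))\<^sup>2 = (norm (F x))\<^sup>2"
    using wgR_unique[OF H1R_wgR[OF f] w] by eventually_elim simp
  then show "sqint (gradR f) = sqint F" by (intro integral_cong_AE) measurable
qed

lemma IQ_R:
  assumes f: "wgR f F" and g: "wgR g G"
  shows "I_R f g = (sqint F + sqint G) / 2 - quartR f g / 4" "Q_R f g = (sqint F + sqint G) - 3 / 4 * quartR f g"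
proof -
  \<comment> \<open>The quartic density is the square of \<open>u^2 + v^2\<close>, hence invariant
    under rotations of the pair.\<close>
  have e: "\<bar>a\<bar> ^ 4 + 2 * \<bar>a\<bar>\<^sup>2 * \<bar>b\<bar>\<^sup>2 + \<bar>b\<bar> ^ 4 = (a\<^sup>2 + b\<^sup>2)\<^sup>2" for a b :: real
    by (simp add: power2_eq_square power4_eq_xxxx algebra_simps)
  have "(LINT x|lborel. (norm (gradR f x))\<^sup>2 + (norm (gradR g x))\<^sup>2) = sqint (gradR f) + sqint (gradR g)"
    using H1R_wgR[OF wgR_H1R(1)[OF f]] H1R_wgR[OF wgR_H1R(1)[OF g]]
    by (intro Bochner_Integration.integral_add) (auto simp: wgR_def)
  then have "(LINT x|lborel. (norm (gradR f x))\<^sup>2 + (norm (gradR g x))\<^sup>2) = sqint F + sqint G"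
    by (simp add: wgR_H1R(2)[OF f] wgR_H1R(2)[OF g])
  then show "I_R f g = (sqint F + sqint G) / 2 - quartR f g / 4" "Q_R f g = (sqint F + sqint G) - 3 / 4 * quartR f g"
    unfolding I_R_def Q_R_def quartR_def e by simp_all
qed

section \<open>Linear combinations and dilations on R^3\<close>

lemma wgR_lin:
  assumes f: "wgR f F" and g: "wgR g G"
  shows "wgR (\<lambda>x. \<alpha> * f x + \<beta> * g x) (\<lambda>x. \<alpha> *\<^sub>R F x + \<beta> *\<^sub>R G x)"
proof -
  have [measurable]: "f \<in> borel_measurable borel" "g \<in> borel_measurable borel" "F \<in> borel_measurable borel" "G \<in> borel_measurable borel"
    using f g by (auto simp: wgR_def)
  have gen: "integrable lborel (\<lambda>x. (norm (\<alpha> *\<^sub>R p x + \<beta> *\<^sub>R q x))\<^sup>2)"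
    if "integrable lborel (\<lambda>x. (norm (p x))\<^sup>2)" "integrable lborel (\<lambda>x. (norm (q x))\<^sup>2)"
      and [measurable]: "p \<in> borel_measurable borel" "q \<in> borel_measurable borel" for p q :: "real^3 \<Rightarrow> 'b::euclidean_space"
  proof (rule Bochner_Integration.integrable_bound)
    show "integrable lborel (\<lambda>x. 2 * \<alpha>\<^sup>2 * (norm (p x))\<^sup>2 + 2 * \<beta>\<^sup>2 * (norm (q x))\<^sup>2)" using that by simp
    show "(\<lambda>x. (norm (\<alpha> *\<^sub>R p x + \<beta> *\<^sub>R q x))\<^sup>2) \<in> borel_measurable lborel" by measurable
    have "(norm (\<alpha> *\<^sub>R p x + \<beta> *\<^sub>R q x))\<^sup>2 \<le> 2 * \<alpha>\<^sup>2 * (norm (p x))\<^sup>2 + 2 * \<beta>\<^sup>2 * (norm (q x))\<^sup>2" for x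
    proof -
      have "(norm (\<alpha> *\<^sub>R p x + \<beta> *\<^sub>R q x))\<^sup>2 \<le> (\<bar>\<alpha>\<bar> * norm (p x) + \<bar>\<beta>\<bar> * norm (q x))\<^sup>2"
        using norm_triangle_ineq[of "\<alpha> *\<^sub>R p x" "\<beta> *\<^sub>R q x"] by (intro power_mono) auto
      also have "\<dots> \<le> 2 * (\<bar>\<alpha>\<bar> * norm (p x))\<^sup>2 + 2 * (\<bar>\<beta>\<bar> * norm (q x))\<^sup>2"
      proof -
        have "0 \<le> (\<bar>\<alpha>\<bar> * norm (p x) - \<bar>\<beta>\<bar> * norm (q x))\<^sup>2" by simp
        then show ?thesis by (simp add: power2_eq_square algebra_simps)
      qed
      finally show ?thesis by (simp add: power_mult_distrib)
    qed
    then show "AE x in lborel. norm ((norm (\<alpha> *\<^sub>R p x + \<beta> *\<^sub>R q x))\<^sup>2) \<le> norm (2 * \<alpha>\<^sup>2 * (norm (p x))\<^sup>2 + 2 * \<beta>\<^sup>2 * (norm (q x))\<^sup>2)"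
      by (intro AE_I2) simp
  qed
  have wd: "wderiv (\<lambda>x. \<alpha> * f x + \<beta> * g x) (\<lambda>x. (\<alpha> *\<^sub>R F x + \<beta> *\<^sub>R G x) \<bullet> b) b" if b: "b \<in> Basis" for b
    using wderiv_lin[OF wgR_component(3)[OF f b] wgR_component(3)[OF g b] wgR_component(1)[OF f b] wgR_component(1)[OF g b]
       wgR_component(2)[OF f b] wgR_component(2)[OF g b] b, of \<alpha> \<beta>] by (simp add: inner_simps)
  have 1: "integrable lborel (\<lambda>x. (norm (\<alpha> *\<^sub>R F x + \<beta> *\<^sub>R G x))\<^sup>2)"
    using f g by (intro gen) (auto simp: wgR_def)
  have 2: "integrable lborel (\<lambda>x. (norm (\<alpha> *\<^sub>R f x + \<beta> *\<^sub>R g x))\<^sup>2)"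
    using f g by (intro gen) (auto simp: wgR_def)
  show ?thesis unfolding wgR_def weak_grad_iff using wd 1 2 by auto
qed

lemma dil_scaleR: "dil (\<lambda>_. t) x = t *\<^sub>R x"
  by (rule euclidean_eqI) (simp add: dil_inner)

lemma dil3_integral:
  fixes f :: "real^3 \<Rightarrow> real"
  assumes t: "t > 0" and f: "f \<in> borel_measurable borel"
  shows "(LINT x|lborel. f (t *\<^sub>R x)) = (LINT x|lborel. f x) / t ^ 3"
    "integrable lborel (\<lambda>x. f (t *\<^sub>R x)) \<longleftrightarrow> integrable lborel f"
  using dil_integral[where c="\<lambda>_. t", OF t f] by (simp_all add: dil_scaleR)

lemma wgR_dil:
  assumes w: "wgR f F" and t: "t > 0"
  shows "wgR (\<lambda>x. k * f (t *\<^sub>R x)) (\<lambda>x. (k * t) *\<^sub>R F (t *\<^sub>R x))"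
    and "sqint (\<lambda>x. k * f (t *\<^sub>R x)) = k\<^sup>2 * sqint f / t ^ 3"
    and "sqint (\<lambda>x. (k * t) *\<^sub>R F (t *\<^sub>R x)) = k\<^sup>2 * sqint F / t"
proof -
  have [measurable]: "f \<in> borel_measurable borel" "F \<in> borel_measurable borel" and i: "integrable lborel (\<lambda>x. (f x)\<^sup>2)" "integrable lborel (\<lambda>x. (norm (F x))\<^sup>2)"
    using w by (auto simp: wgR_def)
  have i1: "integrable lborel (\<lambda>x. (f (t *\<^sub>R x))\<^sup>2)" using dil3_integral(2)[OF t, of "\<lambda>x. (f x)\<^sup>2"] i by simp
  have i2: "integrable lborel (\<lambda>x. (norm (F (t *\<^sub>R x)))\<^sup>2)" using dil3_integral(2)[OF t, of "\<lambda>x. (norm (F x))\<^sup>2"] i by simp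
  have wd: "wderiv (\<lambda>x. k * f (t *\<^sub>R x)) (\<lambda>x. ((k * t) *\<^sub>R F (t *\<^sub>R x)) \<bullet> b) b" if b: "b \<in> Basis" for b
    using wderiv_dil[where c="\<lambda>_. t", OF t wgR_component(2)[OF w b] b, of k] by (simp add: dil_scaleR)
  show "wgR (\<lambda>x. k * f (t *\<^sub>R x)) (\<lambda>x. (k * t) *\<^sub>R F (t *\<^sub>R x))"
    unfolding wgR_def weak_grad_iff using wd i1 i2 by (auto simp: power_mult_distrib)
  show "sqint (\<lambda>x. k * f (t *\<^sub>R x)) = k\<^sup>2 * sqint f / t ^ 3"
    using dil3_integral(1)[OF t, of "\<lambda>x. (f x)\<^sup>2"] by (simp add: power_mult_distrib)
  show "sqint (\<lambda>x. (k * t) *\<^sub>R F (t *\<^sub>R x)) = k\<^sup>2 * sqint F / t"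
  proof -
    have "sqint (\<lambda>x. (k * t) *\<^sub>R F (t *\<^sub>R x)) = (LINT x|lborel. (k * t)\<^sup>2 * (norm (F (t *\<^sub>R x)))\<^sup>2)"
      by (simp only: norm_scaleR power_mult_distrib power2_abs)
    also have "\<dots> = (k * t)\<^sup>2 * (sqint F / t ^ 3)"
      using dil3_integral(1)[OF t, of "\<lambda>x. (norm (F x))\<^sup>2"] by simp
    finally show ?thesis using t by (simp add: power2_eq_square power3_eq_cube field_simps)
  qed
qed

section \<open>Admissible values on R^3\<close>

definition admR :: "real \<Rightarrow> real set" where
  "admR \<rho> = {I_R u v | u v. u \<in> H1R \<and> v \<in> H1R \<and>
                 sqrt (LINT x|lborel. (u x)^2) = \<rho> \<and> sqrt (LINT x|lborel. (v x)^2) = \<rho> \<and>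
                 Q_R u v = 0}"

lemma m_R_admR: "m_R \<rho> = Inf (admR \<rho>)" by (simp add: m_R_def admR_def)

lemma admR_elem:
  assumes "x \<in> admR \<rho>"
  obtains f F g G where "wgR f F" "wgR g G" "sqint f = \<rho>\<^sup>2" "sqint g = \<rho>\<^sup>2"
    "x = (sqint F + sqint G) / 6" "quartR f g = 4 / 3 * (sqint F + sqint G)"
proof -
  obtain u v where x: "x = I_R u v" "u \<in> H1R" "v \<in> H1R" "sqrt (LINT x|lborel. (u x)^2) = \<rho>" "sqrt (LINT x|lborel. (v x)^2) = \<rho>" "Q_R u v = 0"
    using assms unfolding admR_def by blast
  note u = H1R_wgR[OF x(2)] and v = H1R_wgR[OF x(3)]
  have "quartR u v = 4 / 3 * (sqint (gradR u) + sqint (gradR v))" using x(6) IQ_R(2)[OF u v] by simp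
  moreover have "x = (sqint (gradR u) + sqint (gradR v)) / 6" using x(1) IQ_R(1)[OF u v] calculation by linarith
  moreover have "sqint u = \<rho>\<^sup>2" "sqint v = \<rho>\<^sup>2" using x(4,5) by auto
  ultimately show ?thesis using that u v by blast
qed

lemma admR_nonneg: "x \<in> admR \<rho> \<Longrightarrow> 0 \<le> x"
  by (erule admR_elem) (simp only: divide_nonneg_pos add_nonneg_nonneg sqint_nonneg zero_less_numeral)

lemma bdd_admR: "bdd_below (admR \<rho>)" using admR_nonneg by (rule bdd_belowI)

text \<open>Dilation and multiplication offer two parameters, which are used up by the mass and by
  \<open>Q_R = 0\<close>. The value reached depends on the pair only through the Gagliardo-Nirenberg
  quotient \<open>a^3 p / b^2\<close>.\<close>

lemma admR_scaled:
  assumes f: "wgR f F" and g: "wgR g G" and p: "sqint f = p" "sqint g = p" "p > 0" and \<rho>: "\<rho> > 0"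
  defines "a \<equiv> sqint F + sqint G" and "b \<equiv> quartR f g"
  shows "8/27 * a ^ 3 * p / (b\<^sup>2 * \<rho>\<^sup>2) \<in> admR \<rho>"
proof -
  have a: "a > 0" and b: "b > 0" using quartR_pos[OF f g] p by (simp_all add: a_def b_def)
  \<comment> \<open>Mass \<open>\<rho>^2\<close> forces \<open>k^2 = t^3 \<rho>^2 / p\<close>. The
    gradient term becomes \<open>t^2 \<rho>^2 a / p\<close>, the quartic one
    \<open>t^3 \<rho>^4 b / p^2\<close>, and after division by \<open>t^2\<close> the condition
    \<open>Q_R = 0\<close> is linear in \<open>t\<close>.\<close>
  define t where "t = 4 * a * p / (3 * b * \<rho>\<^sup>2)"
  define k where "k = sqrt (t ^ 3 * \<rho>\<^sup>2 / p)"
  have t: "t > 0" using a b p \<rho> by (simp add: t_def)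
  have k2: "k\<^sup>2 = t ^ 3 * \<rho>\<^sup>2 / p" using t p \<rho> by (simp add: k_def)
  let ?f = "\<lambda>x. k * f (t *\<^sub>R x)" and ?g = "\<lambda>x. k * g (t *\<^sub>R x)"
  note F = wgR_dil[OF f t, of k] and G = wgR_dil[OF g t, of k]
  have [measurable]: "f \<in> borel_measurable borel" "g \<in> borel_measurable borel" using f g by (auto simp: wgR_def)
  have q: "quartR ?f ?g = k\<^sup>2 * k\<^sup>2 * b / t ^ 3"
  proof -
    have "quartR ?f ?g = (LINT x|lborel. k\<^sup>2 * k\<^sup>2 * ((f (t *\<^sub>R x))\<^sup>2 + (g (t *\<^sub>R x))\<^sup>2)\<^sup>2)"
      unfolding quartR_def by (simp add: power2_eq_square algebra_simps)
    also have "\<dots> = k\<^sup>2 * k\<^sup>2 * b / t ^ 3"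
      using dil3_integral(1)[OF t, of "\<lambda>x. ((f x)\<^sup>2 + (g x)\<^sup>2)\<^sup>2"] by (simp add: b_def quartR_def)
    finally show ?thesis .
  qed
  have m: "sqint ?f = \<rho>\<^sup>2" "sqint ?g = \<rho>\<^sup>2" unfolding F(2) G(2) k2 using p t by simp_all
  have q': "quartR ?f ?g = t ^ 3 * \<rho> ^ 4 * b / p\<^sup>2"
    unfolding q k2 using t p by (simp add: power2_eq_square power3_eq_cube power4_eq_xxxx field_simps)
  have a': "sqint (\<lambda>x. (k * t) *\<^sub>R F (t *\<^sub>R x)) + sqint (\<lambda>x. (k * t) *\<^sub>R G (t *\<^sub>R x)) = t\<^sup>2 * \<rho>\<^sup>2 * a / p"
    unfolding F(3) G(3) k2 a_def using t p by (simp add: power2_eq_square power3_eq_cube field_simps)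
  have tb: "t * \<rho>\<^sup>2 * b = 4 / 3 * a * p" using b \<rho> by (simp add: t_def field_simps)
  have "t ^ 3 * \<rho> ^ 4 * b / p\<^sup>2 = t\<^sup>2 * \<rho>\<^sup>2 * (t * \<rho>\<^sup>2 * b) / p\<^sup>2"
    by (simp add: power2_eq_square power3_eq_cube power4_eq_xxxx)
  also have "\<dots> = 4 / 3 * (t\<^sup>2 * \<rho>\<^sup>2 * a / p)" unfolding tb using p by (simp add: power2_eq_square)
  finally have qa: "quartR ?f ?g = 4 / 3 * (t\<^sup>2 * \<rho>\<^sup>2 * a / p)" using q' by simp
  have Q: "Q_R ?f ?g = 0" unfolding IQ_R(2)[OF F(1) G(1)] a' qa by simp
  have "I_R ?f ?g = t\<^sup>2 * \<rho>\<^sup>2 * a / p / 6" unfolding IQ_R(1)[OF F(1) G(1)] a' qa by (simp add: field_simps)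
  also have "\<dots> = 8/27 * a ^ 3 * p / (b\<^sup>2 * \<rho>\<^sup>2)"
    unfolding t_def using a b p \<rho> by (simp add: power2_eq_square power3_eq_cube field_simps)
  finally have I: "I_R ?f ?g = 8/27 * a ^ 3 * p / (b\<^sup>2 * \<rho>\<^sup>2)" .
  have s: "sqrt (LINT x|lborel. (?f x)\<^sup>2) = \<rho>" "sqrt (LINT x|lborel. (?g x)\<^sup>2) = \<rho>" using m \<rho> by simp_all
  show ?thesis unfolding admR_def I[symmetric] using wgR_H1R(1)[OF F(1)] wgR_H1R(1)[OF G(1)] s Q by blast
qed

lemma wgR_bump: "\<exists>f F. wgR f F \<and> sqint f > 0"
proof -
  let ?f = "bump :: real^3 \<Rightarrow> real"
  define F where "F = (\<lambda>x. \<Sum>b\<in>Basis. frechet_derivative ?f (at x) b *\<^sub>R b)"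
  note t = test_fun_bump[where 'a="real^3"]
  have Fb: "F x \<bullet> b = frechet_derivative ?f (at x) b" if "b \<in> Basis" for x b
    using that by (simp add: F_def inner_sum_left_Basis)
  have k: "ckernel ?f" using test_fun_C1dir(2)[OF t] SOME_Basis by blast
  have cF: "continuous_on UNIV F"
    by (rule continuous_on_componentwise[THEN iffD2]) (use test_fun_C1dir(3)[OF t] in \<open>simp add: Fb ckernel_def\<close>)
  have nF: "(norm (F x))\<^sup>2 = (\<Sum>b\<in>Basis. (F x \<bullet> b) * (F x \<bullet> b))" for x
    unfolding power2_norm_eq_inner by (subst euclidean_inner) simp
  have i: "integrable lborel (\<lambda>x. (norm (F x))\<^sup>2)"
    unfolding nF
  proof (rule Bochner_Integration.integrable_sum)
    fix b :: "real^3" assume b: "b \<in> Basis"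
    show "integrable lborel (\<lambda>x. (F x \<bullet> b) * (F x \<bullet> b))"
      unfolding Fb[OF b]
      by (intro kernel_integrable ckernel_mult test_fun_C1dir(3)[OF t b]) (use test_fun_C1dir(3)[OF t b] in \<open>simp add: ckernel_def\<close>)
  qed
  have i2: "integrable lborel (\<lambda>x. (?f x)\<^sup>2)"
    unfolding power2_eq_square by (intro kernel_integrable ckernel_mult k) (use k in \<open>simp add: ckernel_def\<close>)
  have w: "wgR ?f F"
    unfolding wgR_def weak_grad_iff
    using i i2 ckernel_measurable[OF k] borel_measurable_continuous_onI[OF cF] C1dir_wderiv[OF test_fun_C1dir(1)[OF t]]
    by (simp add: Fb)
  have "sqint ?f \<noteq> 0"
  proof
    assume "sqint ?f = 0"
    then have "AE x in lborel. ?f x = 0"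
      using integral_nonneg_eq_0_iff_AE[OF i2] by simp
    then have "(LINT x|lborel. ?f x) = (LINT x|(lborel::(real^3) measure). 0)"
      by (intro integral_cong_AE) (use ckernel_measurable[OF k] in auto)
    then show False using bump_integral_pos[where 'a="real^3"] by simp
  qed
  then have "sqint ?f > 0" using sqint_nonneg[of ?f] by linarith
  then show ?thesis using w by blast
qed

lemma admR_nonempty: "\<rho> > 0 \<Longrightarrow> admR \<rho> \<noteq> {}"
  using wgR_bump admR_scaled by blast

lemma m_R_pos: "m_R 1 > 0"
proof -
  have GN: "GN > 0" by (simp add: GN_def)
  \<comment> \<open>With \<open>a = 6x\<close> the constraint \<open>b = 4a/3\<close> turns
    \<open>gn_pair\<close> into \<open>16/9 a^2 \<le> 32 GN a^3\<close>, that is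
    \<open>1 \<le> 18 GN a\<close>.\<close>
  have "1 / (108 * GN) \<le> x" if x: "x \<in> admR 1" for x
  proof -
    obtain f F g G where w: "wgR f F" "wgR g G" "sqint f = 1\<^sup>2" "sqint g = 1\<^sup>2"
      and xe: "x = (sqint F + sqint G) / 6" and b: "quartR f g = 4 / 3 * (sqint F + sqint G)"
      using admR_elem[OF x] by blast
    define a where "a = sqint F + sqint G"
    have a: "a > 0" using quartR_pos[OF w(1,2)] w by (simp add: a_def)
    have "(4 / 3 * a)\<^sup>2 \<le> 16 * GN * a ^ 3 * 2"
      using gn_pair[OF w(1,2)] w b by (simp add: a_def)
    then have "a\<^sup>2 * 1 \<le> a\<^sup>2 * (18 * GN * a)" by (simp add: power2_eq_square power3_eq_cube algebra_simps)
    then have "1 \<le> 18 * GN * a" by (rule mult_left_le_imp_le) (use a in simp)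
    moreover have "18 * GN * a = x * (108 * GN)" using xe[folded a_def] by simp
    ultimately show ?thesis using GN by (subst pos_divide_le_eq) simp_all
  qed
  then have "1 / (108 * GN) \<le> m_R 1"
    unfolding m_R_admR by (intro cInf_greatest admR_nonempty) auto
  moreover have "1 / (108 * GN) > 0" using GN by simp
  ultimately show ?thesis by linarith
qed

section \<open>Averaging in the periodic variable\<close>

lemma product_integrable:
  fixes f g :: "'a \<Rightarrow> real"
  assumes [measurable]: "f \<in> borel_measurable M" "g \<in> borel_measurable M"
    and i: "integrable M (\<lambda>x. (f x)\<^sup>2)" "integrable M (\<lambda>x. (g x)\<^sup>2)"
  shows "integrable M (\<lambda>x. f x * g x)"
proof (rule Bochner_Integration.integrable_bound)
  show "integrable M (\<lambda>x. (f x)\<^sup>2 + (g x)\<^sup>2)" using i by simp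
  have "\<bar>a * b\<bar> \<le> a\<^sup>2 + b\<^sup>2" for a b :: real
  proof -
    have "0 \<le> (\<bar>a\<bar> - \<bar>b\<bar>)\<^sup>2" "0 \<le> \<bar>a\<bar> * \<bar>b\<bar>" by simp_all
    then have "2 * (\<bar>a\<bar> * \<bar>b\<bar>) \<le> a\<^sup>2 + b\<^sup>2" by (simp add: power2_diff)
    then show ?thesis using \<open>0 \<le> \<bar>a\<bar> * \<bar>b\<bar>\<close> unfolding abs_mult by linarith
  qed
  then show "AE x in M. norm (f x * g x) \<le> norm ((f x)\<^sup>2 + (g x)\<^sup>2)" by simp
qed measurable

text \<open>A quarter turn exchanges the two masses, so their difference changes sign between the
  angles 0 and \<open>pi/2\<close>.\<close>

lemma rotation_equal_mass:
  assumes f: "wgR f F" and g: "wgR g G"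
  obtains c d :: real where "c\<^sup>2 + d\<^sup>2 = 1" "sqint (\<lambda>x. c * f x + (- d) * g x) = sqint (\<lambda>x. d * f x + c * g x)"
proof -
  have [measurable]: "f \<in> borel_measurable borel" "g \<in> borel_measurable borel"
    and i: "integrable lborel (\<lambda>x. (f x)\<^sup>2)" "integrable lborel (\<lambda>x. (g x)\<^sup>2)" using f g by (auto simp: wgR_def)
  have ifg: "integrable lborel (\<lambda>x. f x * g x)" using i by (intro product_integrable) auto
  define m where "m = (LINT x|lborel. f x * g x)"
  have e: "sqint (\<lambda>x. \<alpha> * f x + \<beta> * g x) = \<alpha>\<^sup>2 * sqint f + \<beta>\<^sup>2 * sqint g + 2 * \<alpha> * \<beta> * m" for \<alpha> \<beta>
  proof -
    have "sqint (\<lambda>x. \<alpha> * f x + \<beta> * g x) = (LINT x|lborel. \<alpha>\<^sup>2 * (f x)\<^sup>2 + \<beta>\<^sup>2 * (g x)\<^sup>2 + 2 * \<alpha> * \<beta> * (f x * g x))"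
      by (simp add: power2_eq_square algebra_simps)
    also have "\<dots> = \<alpha>\<^sup>2 * sqint f + \<beta>\<^sup>2 * sqint g + 2 * \<alpha> * \<beta> * m"
      using i ifg by (simp add: m_def)
    finally show ?thesis .
  qed
  define \<phi> where "\<phi> = (\<lambda>\<theta>. sqint (\<lambda>x. cos \<theta> * f x + (- sin \<theta>) * g x) - sqint (\<lambda>x. sin \<theta> * f x + cos \<theta> * g x))"
  have c: "continuous_on S \<phi>" for S unfolding \<phi>_def e by (intro continuous_intros)
  have "\<phi> 0 = - \<phi> (pi/2)" unfolding \<phi>_def e by simp
  then have "\<exists>\<theta>. \<phi> \<theta> = 0"
    using IVT'[of \<phi> 0 0 "pi/2"] IVT2'[of \<phi> "pi/2" 0 0] c by (cases "\<phi> 0 \<le> 0") auto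
  then obtain \<theta> where "\<phi> \<theta> = 0" by blast
  then show ?thesis using that[of "cos \<theta>" "sin \<theta>"] by (simp add: \<phi>_def)
qed

text \<open>Competitors for \<open>m_R\<close> have equal masses, while the means of a pair need
  not. A rotation preserves the quartic integral, the total mass and the total energy, so equal
  masses may be arranged first. Then \<open>admR_scaled\<close> applies with \<open>p\<close> half
  the total mass, which turns 8/27 into 4/27.\<close>

lemma sharp_gn:
  assumes f: "wgR f F" and g: "wgR g G"
  shows "27 * m_R 1 * (quartR f g)\<^sup>2 \<le> 4 * (sqint f + sqint g) * (sqint F + sqint G) ^ 3"
proof (cases "sqint f + sqint g > 0")
  case False
  then have "sqint f + sqint g = 0" using sqint_nonneg[of f] sqint_nonneg[of g] by linarith
  then show ?thesis using gn_pair[OF f g] by simp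
next
  case True
  obtain c d where cd: "c\<^sup>2 + d\<^sup>2 = 1" and eq: "sqint (\<lambda>x. c * f x + (- d) * g x) = sqint (\<lambda>x. d * f x + c * g x)"
    using rotation_equal_mass[OF f g] by blast
  let ?f = "\<lambda>x. c * f x + (- d) * g x" and ?g = "\<lambda>x. d * f x + c * g x"
  let ?F = "\<lambda>x. c *\<^sub>R F x + (- d) *\<^sub>R G x" and ?G = "\<lambda>x. d *\<^sub>R F x + c *\<^sub>R G x"
  note w = wgR_lin[OF f g, of c "- d"] wgR_lin[OF f g, of d c]
  have pf: "(?f x)\<^sup>2 + (?g x)\<^sup>2 = (f x)\<^sup>2 + (g x)\<^sup>2" for x
  proof -
    have "(?f x)\<^sup>2 + (?g x)\<^sup>2 = (c\<^sup>2 + d\<^sup>2) * ((f x)\<^sup>2 + (g x)\<^sup>2)" by (simp add: power2_eq_square algebra_simps)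
    then show ?thesis by (simp add: cd)
  qed
  have pF: "(norm (?F x))\<^sup>2 + (norm (?G x))\<^sup>2 = (norm (F x))\<^sup>2 + (norm (G x))\<^sup>2" for x
  proof -
    have "(norm (?F x))\<^sup>2 + (norm (?G x))\<^sup>2 = (c\<^sup>2 + d\<^sup>2) * ((norm (F x))\<^sup>2 + (norm (G x))\<^sup>2)"
      unfolding power2_norm_eq_inner by (simp add: inner_simps inner_commute power2_eq_square algebra_simps)
    then show ?thesis by (simp add: cd)
  qed
  have add: "sqint p + sqint q = (LINT x|lborel. (norm (p x))\<^sup>2 + (norm (q x))\<^sup>2)"
    if "integrable lborel (\<lambda>x. (norm (p x))\<^sup>2)" "integrable lborel (\<lambda>x. (norm (q x))\<^sup>2)" for p q :: "real^3 \<Rightarrow> 'b::real_normed_vector"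
    using that by simp
  have s: "sqint ?f + sqint ?g = sqint f + sqint g"
    using w f g by (subst (1 2) add) (simp_all add: wgR_def pf[simplified])
  have a: "sqint ?F + sqint ?G = sqint F + sqint G"
    using w f g by (subst (1 2) add) (simp_all only: wgR_def pF simp_thms)
  have q: "quartR ?f ?g = quartR f g" unfolding quartR_def pf ..
  define p where "p = (sqint f + sqint g) / 2"
  have p: "sqint ?f = p" "sqint ?g = p" "p > 0" using eq s True by (simp_all add: p_def)
  have "8/27 * (sqint F + sqint G) ^ 3 * p / ((quartR f g)\<^sup>2 * 1\<^sup>2) \<in> admR 1"
    using admR_scaled[OF w p, of 1] unfolding a q by simp
  then have "m_R 1 \<le> 8/27 * (sqint F + sqint G) ^ 3 * p / ((quartR f g)\<^sup>2 * 1\<^sup>2)"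
    unfolding m_R_admR by (rule cInf_lower) (rule bdd_admR)
  moreover have "quartR f g > 0" by (rule quartR_pos[OF f g True])
  ultimately show ?thesis by (simp add: p_def field_simps)
qed

text \<open>The upper bound rescales competitors of norm 1; the lower one reads
  \<open>sharp_gn\<close> on a competitor of norm \<open>\<rho>\<close>.\<close>

lemma m_R_scaling:
  assumes \<rho>: "\<rho> > 0" shows "m_R \<rho> = m_R 1 / \<rho>\<^sup>2"
proof (rule antisym)
  have "\<rho>\<^sup>2 * m_R \<rho> \<le> m_R 1"
    unfolding m_R_admR[of 1]
  proof (rule cInf_greatest[OF admR_nonempty])
    fix x assume x: "x \<in> admR 1"
    obtain f F g G where w: "wgR f F" "wgR g G" "sqint f = 1\<^sup>2" "sqint g = 1\<^sup>2"
      and xe: "x = (sqint F + sqint G) / 6" and b: "quartR f g = 4 / 3 * (sqint F + sqint G)"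
      using admR_elem[OF x] by blast
    define a where "a = sqint F + sqint G"
    have a: "a > 0" using quartR_pos[OF w(1,2)] w by (simp add: a_def)
    have "8/27 * a ^ 3 * 1 / ((4/3 * a)\<^sup>2 * \<rho>\<^sup>2) \<in> admR \<rho>"
      using admR_scaled[OF w(1,2) _ _ _ \<rho>, of 1] w b by (simp add: a_def)
    then have "m_R \<rho> \<le> 8/27 * a ^ 3 * 1 / ((4/3 * a)\<^sup>2 * \<rho>\<^sup>2)"
      unfolding m_R_admR by (rule cInf_lower) (rule bdd_admR)
    also have "\<dots> = x / \<rho>\<^sup>2" unfolding xe[folded a_def] using a by (simp add: power2_eq_square power3_eq_cube field_simps)
    finally show "\<rho>\<^sup>2 * m_R \<rho> \<le> x" using \<rho> by (simp add: field_simps)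
  qed simp
  then show "m_R \<rho> \<le> m_R 1 / \<rho>\<^sup>2" using \<rho> by (simp add: field_simps)
  show "m_R 1 / \<rho>\<^sup>2 \<le> m_R \<rho>"
    unfolding m_R_admR[of \<rho>]
  proof (rule cInf_greatest[OF admR_nonempty[OF \<rho>]])
    fix x assume x: "x \<in> admR \<rho>"
    obtain f F g G where w: "wgR f F" "wgR g G" "sqint f = \<rho>\<^sup>2" "sqint g = \<rho>\<^sup>2"
      and xe: "x = (sqint F + sqint G) / 6" and b: "quartR f g = 4 / 3 * (sqint F + sqint G)"
      using admR_elem[OF x] by blast
    define a where "a = sqint F + sqint G"
    have a: "a > 0" using quartR_pos[OF w(1,2)] w \<rho> by (simp add: a_def)
    have "27 * m_R 1 * (4 / 3 * a)\<^sup>2 \<le> 4 * (\<rho>\<^sup>2 + \<rho>\<^sup>2) * a ^ 3"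
      using sharp_gn[OF w(1,2)] unfolding w b a_def[symmetric] .
    then have "(8 * a\<^sup>2) * (6 * m_R 1) \<le> (8 * a\<^sup>2) * (\<rho>\<^sup>2 * a)"
      by (simp add: power2_eq_square power3_eq_cube algebra_simps)
    then have "6 * m_R 1 \<le> \<rho>\<^sup>2 * a" by (rule mult_left_le_imp_le) (use a in simp)
    then show "m_R 1 / \<rho>\<^sup>2 \<le> x" unfolding xe[folded a_def] using \<rho> by (simp add: field_simps)
  qed
qed

section \<open>Mean and remainder in y\<close>

definition mean :: "(pt \<Rightarrow> real) \<Rightarrow> real^3 \<Rightarrow> real" where
  "mean \<psi> x = (LINT y|tau. \<psi> (x,y)) / (2*pi)"

lemma continuous_slice: "continuous_on UNIV (\<psi> :: pt \<Rightarrow> real) \<Longrightarrow> continuous_on UNIV (\<lambda>y. \<psi> (x,y))"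
  by (rule continuous_on_compose2[of UNIV \<psi>]) (auto intro!: continuous_intros)

lemma mean_integral: "continuous_on UNIV \<psi> \<Longrightarrow> mean \<psi> x = integral {0..2*pi} (\<lambda>y. \<psi> (x,y)) / (2*pi)"
  unfolding mean_def by (simp add: integral_tau_continuous(1)[OF continuous_slice])

lemma continuous_mean:
  assumes c: "continuous_on UNIV \<psi>" shows "continuous_on UNIV (mean \<psi>)"
proof -
  have "continuous_on (UNIV \<times> cbox 0 (2*pi)) (\<lambda>(x, y). \<psi> (x, y))"
    by (simp add: continuous_on_subset[OF c])
  from integral_continuous_on_param[OF this]
  have "continuous_on UNIV (\<lambda>x. integral {0..2*pi} (\<lambda>y. \<psi> (x,y)))" by simp
  then show ?thesis unfolding mean_integral[OF c, abs_def] by (intro continuous_on_divide) auto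
qed

lemma C1dir_mean:
  assumes c: "C1dir \<phi> \<phi>' (j, 0)" shows "C1dir (mean \<phi>) (mean \<phi>') j"
proof -
  have c1: "continuous_on UNIV \<phi>" and c2: "continuous_on UNIV \<phi>'" using c by (auto simp: C1dir_def)
  have "((\<lambda>t. mean \<phi> (x + t *\<^sub>R j)) has_real_derivative mean \<phi>' x) (at 0)" for x
  proof -
    have "((\<lambda>t. integral (cbox 0 (2*pi)) (\<lambda>y. \<phi> (x + t *\<^sub>R j, y))) has_field_derivative
        integral (cbox 0 (2*pi)) (\<lambda>y. \<phi>' (x + 0 *\<^sub>R j, y))) (at 0 within UNIV)"
    proof (rule leibniz_rule_field_derivative)
      fix t y :: real
      have "((\<lambda>t. \<phi> ((x, y) + t *\<^sub>R (j, 0))) has_real_derivative \<phi>' ((x, y) + t *\<^sub>R (j, 0))) (at t)"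
        by (rule C1dir_line[OF c])
      then show "((\<lambda>t. \<phi> (x + t *\<^sub>R j, y)) has_real_derivative \<phi>' (x + t *\<^sub>R j, y)) (at t within UNIV)" by simp
    next
      show "(\<lambda>y. \<phi> (x + t *\<^sub>R j, y)) integrable_on cbox 0 (2*pi)" for t
        by (intro integrable_continuous continuous_on_subset[OF continuous_slice[OF c1]]) auto
      show "continuous_on (UNIV \<times> cbox 0 (2*pi)) (\<lambda>(t, y). \<phi>' (x + t *\<^sub>R j, y))"
        unfolding case_prod_beta by (rule continuous_on_compose2[OF c2]) (auto intro!: continuous_intros)
    qed auto
    then show ?thesis
      unfolding mean_integral[OF c1] mean_integral[OF c2] by (intro DERIV_cdivide) simp
  qed
  then show ?thesis using continuous_mean[OF c1] continuous_mean[OF c2] by (simp add: C1dir_def)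
qed

text \<open>On each slice this is the identity between variance and second moment, integrated over
  x. The mean is a function on R^3, hence the factor \<open>2*pi\<close>.\<close>

lemma mean_split:
  assumes c: "continuous_on UNIV \<psi>" and i: "integrable TT (\<lambda>z. (\<psi> z)\<^sup>2)"
  shows "integrable lborel (\<lambda>x. (mean \<psi> x)\<^sup>2)" "integrable TT (\<lambda>z. (\<psi> z - mean \<psi> (fst z))\<^sup>2)"
    "2 * pi * (LINT x|lborel. (mean \<psi> x)\<^sup>2) + (LINT z|TT. (\<psi> z - mean \<psi> (fst z))\<^sup>2) = (LINT z|TT. (\<psi> z)\<^sup>2)"
    "(LINT y|tau. \<psi> (x,y) - mean \<psi> x) = 0"
proof -
  note cs = continuous_slice[OF c]
  have [measurable]: "mean \<psi> \<in> borel_measurable borel" "\<psi> \<in> borel_measurable borel"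
    using c continuous_mean[OF c] by (auto intro: borel_measurable_continuous_onI)
  have it: "integrable tau (\<lambda>y. \<psi> (x,y))" "integrable tau (\<lambda>y. (\<psi> (x,y))\<^sup>2)" for x
    by (intro integral_tau_continuous(2) continuous_on_power cs)+
  have t1: "(LINT y|tau. k) = 2 * pi * k" "integrable tau (\<lambda>y. k)" for k :: real
    by (simp_all add: measure_def emeasure_tau)
  have mt: "(LINT y|tau. \<psi> (x,y)) = 2 * pi * mean \<psi> x" for x by (simp add: mean_def)
  show "(LINT y|tau. \<psi> (x,y) - mean \<psi> x) = 0"
    by (subst Bochner_Integration.integral_diff[OF it(1) t1(2)]) (simp only: mt t1)
  have slice: "(LINT y|tau. (\<psi> (x,y) - mean \<psi> x)\<^sup>2) = (LINT y|tau. (\<psi> (x,y))\<^sup>2) - 2 * pi * (mean \<psi> x)\<^sup>2" for x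
  proof -
    have "(LINT y|tau. (\<psi> (x,y) - mean \<psi> x)\<^sup>2) = (LINT y|tau. (\<psi> (x,y))\<^sup>2 - 2 * mean \<psi> x * \<psi> (x,y) + (mean \<psi> x)\<^sup>2)"
      by (simp add: power2_eq_square algebra_simps)
    also have "\<dots> = (LINT y|tau. (\<psi> (x,y))\<^sup>2) - 2 * mean \<psi> x * (2 * pi * mean \<psi> x) + 2 * pi * (mean \<psi> x)\<^sup>2"
      using it t1(2) by (simp add: mt measure_def emeasure_tau)
    finally show ?thesis by (simp add: power2_eq_square algebra_simps)
  qed
  have i': "integrable (lborel \<Otimes>\<^sub>M tau) (\<lambda>z. (\<psi> z)\<^sup>2)" using i by (simp add: TT_def)
  have ix: "integrable lborel (\<lambda>x. LINT y|tau. (\<psi> (x,y))\<^sup>2)" using lborel_tau.integrable_fst'[OF i'] .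
  show im: "integrable lborel (\<lambda>x. (mean \<psi> x)\<^sup>2)"
  proof (rule Bochner_Integration.integrable_bound[OF ix])
    have "(mean \<psi> x)\<^sup>2 \<le> (LINT y|tau. (\<psi> (x,y))\<^sup>2)" for x
    proof -
      have "0 \<le> (LINT y|tau. (\<psi> (x,y) - mean \<psi> x)\<^sup>2)" by simp
      then have "2 * pi * (mean \<psi> x)\<^sup>2 \<le> (LINT y|tau. (\<psi> (x,y))\<^sup>2)" by (simp add: slice)
      moreover have "1 * (mean \<psi> x)\<^sup>2 \<le> 2 * pi * (mean \<psi> x)\<^sup>2" using pi_gt3 by (intro mult_right_mono) auto
      ultimately show ?thesis by simp
    qed
    then show "AE x in lborel. norm ((mean \<psi> x)\<^sup>2) \<le> norm (LINT y|tau. (\<psi> (x,y))\<^sup>2)" by simp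
  qed measurable
  have imT: "integrable TT (\<lambda>z. (mean \<psi> (fst z))\<^sup>2)"
    using TT_product(1)[OF im t1(2), of 1] by simp
  show ir: "integrable TT (\<lambda>z. (\<psi> z - mean \<psi> (fst z))\<^sup>2)"
  proof (rule Bochner_Integration.integrable_bound)
    show "integrable TT (\<lambda>z. 2 * (\<psi> z)\<^sup>2 + 2 * (mean \<psi> (fst z))\<^sup>2)" using i imT by simp
    have "(a - b)\<^sup>2 \<le> 2 * a\<^sup>2 + 2 * b\<^sup>2" for a b :: real
      using zero_le_power2[of "a + b"] by (simp add: power2_eq_square algebra_simps)
    then show "AE z in TT. norm ((\<psi> z - mean \<psi> (fst z))\<^sup>2) \<le> norm (2 * (\<psi> z)\<^sup>2 + 2 * (mean \<psi> (fst z))\<^sup>2)"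
      by (intro AE_I2) simp
  qed measurable
  have "(LINT z|TT. (\<psi> z - mean \<psi> (fst z))\<^sup>2) = (LINT x|lborel. LINT y|tau. (\<psi> (x,y) - mean \<psi> x)\<^sup>2)"
    using lborel_tau.integral_fst'[of "\<lambda>z. (\<psi> z - mean \<psi> (fst z))\<^sup>2"] ir by (simp add: TT_def)
  also have "\<dots> = (LINT x|lborel. LINT y|tau. (\<psi> (x,y))\<^sup>2) - 2 * pi * (LINT x|lborel. (mean \<psi> x)\<^sup>2)"
    unfolding slice using ix im by simp
  also have "(LINT x|lborel. LINT y|tau. (\<psi> (x,y))\<^sup>2) = (LINT z|TT. (\<psi> z)\<^sup>2)"
    using lborel_tau.integral_fst'[OF i'] by (simp add: TT_def)
  finally show "2 * pi * (LINT x|lborel. (mean \<psi> x)\<^sup>2) + (LINT z|TT. (\<psi> z - mean \<psi> (fst z))\<^sup>2) = (LINT z|TT. (\<psi> z)\<^sup>2)" by simp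
qed

lemma cauchy_schwarz_integral:
  fixes f g :: "'a \<Rightarrow> real"
  assumes m: "f \<in> borel_measurable M" "g \<in> borel_measurable M"
    and i: "integrable M (\<lambda>x. (f x)\<^sup>2)" "integrable M (\<lambda>x. (g x)\<^sup>2)"
  shows "(LINT x|M. f x * g x)\<^sup>2 \<le> (LINT x|M. (f x)\<^sup>2) * (LINT x|M. (g x)\<^sup>2)"
proof -
  define X Y Z where "X = (LINT x|M. (f x)\<^sup>2)" and "Y = (LINT x|M. (g x)\<^sup>2)" and "Z = (LINT x|M. f x * g x)"
  have ifg: "integrable M (\<lambda>x. f x * g x)" by (rule product_integrable[OF m i])
  have q: "0 \<le> X - 2 * l * Z + l\<^sup>2 * Y" for l
  proof -
    have "0 \<le> (LINT x|M. (f x - l * g x)\<^sup>2)" by simp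
    also have "\<dots> = (LINT x|M. (f x)\<^sup>2 - 2 * l * (f x * g x) + l\<^sup>2 * (g x)\<^sup>2)"
      by (simp add: power2_eq_square algebra_simps)
    also have "\<dots> = X - 2 * l * Z + l\<^sup>2 * Y" using i ifg by (simp add: X_def Y_def Z_def)
    finally show ?thesis .
  qed
  have Y0: "Y \<ge> 0" by (simp add: Y_def)
  have "Z\<^sup>2 \<le> X * Y"
  proof (cases "Y = 0")
    case True
    have "Z = 0"
    proof (rule ccontr)
      assume "Z \<noteq> 0"
      \<comment> \<open>For \<open>Y = 0\<close> the quadratic form is affine in \<open>l\<close>,
        and this \<open>l\<close> gives it the value -1.\<close>
      then show False using q[of "(X + 1) / (2 * Z)"] True by simp
    qed
    then show ?thesis using True by simp
  next
    case False
    then have Yp: "Y > 0" using Y0 by simp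
    then have "X - 2 * (Z / Y) * Z + (Z / Y)\<^sup>2 * Y = X - Z\<^sup>2 / Y"
      by (simp add: power2_eq_square)
    then have "Z\<^sup>2 / Y \<le> X" using q[of "Z / Y"] by simp
    then show ?thesis using Yp by (simp add: divide_le_eq)
  qed
  then show ?thesis by (simp add: X_def Y_def Z_def)
qed

definition meanG :: "(pt \<Rightarrow> pt) \<Rightarrow> real^3 \<Rightarrow> real^3" where
  "meanG P x = (\<Sum>b\<in>Basis. mean (\<lambda>z. P z \<bullet> (b, 0)) x *\<^sub>R b)"

lemma meanG_inner: "b \<in> Basis \<Longrightarrow> meanG P x \<bullet> b = mean (\<lambda>z. P z \<bullet> (b, 0)) x"
  by (simp add: meanG_def inner_sum_left_Basis)

lemma Basis_fst: "j \<in> Basis \<Longrightarrow> (j, 0) \<in> (Basis :: pt set)" by (simp add: Basis_prod_def)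

lemma norm_square_components: "(norm (x :: real^3))\<^sup>2 = (\<Sum>b\<in>Basis. (x \<bullet> b)\<^sup>2)"
  unfolding power2_norm_eq_inner by (subst euclidean_inner) (simp add: power2_eq_square)

text \<open>Orthogonality of mean and remainder, used for each x-derivative: the x-energies add up
  exactly, so the remainder's share is available for absorption. The y-energy belongs to the
  remainder alone.\<close>

lemma smoothT_mean_split:
  assumes s: "smoothT \<phi> P"
  defines "r \<equiv> \<lambda>z. \<phi> z - mean \<phi> (fst z)" and "N \<equiv> \<lambda>z. P z - (meanG P (fst z), 0)"
  shows "wgR (mean \<phi>) (meanG P)" "smoothT r N" "\<And>x. (LINT y|tau. r (x,y)) = 0"
    "2 * pi * sqint (mean \<phi>) \<le> (LINT z|TT. (\<phi> z)\<^sup>2)"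
    "2 * pi * sqint (meanG P) + (LINT z|TT. (norm (fst (N z)))\<^sup>2) = (LINT z|TT. (norm (fst (P z)))\<^sup>2)"
    "(LINT z|TT. (snd (N z))\<^sup>2) = (LINT z|TT. (snd (P z))\<^sup>2)"
proof -
  note cont = smoothT_continuous[OF s]
  note [measurable] = smoothT_measurable[OF s]
  have i: "integrable TT (\<lambda>z. (\<phi> z)\<^sup>2)" and iP: "integrable TT (\<lambda>z. (norm (P z))\<^sup>2)" using s by (auto simp: smoothT_def)
  have cj: "continuous_on UNIV (\<lambda>z. P z \<bullet> (j, 0))" for j by (intro continuous_intros cont)
  have ij: "integrable TT (\<lambda>z. (P z \<bullet> (j, 0))\<^sup>2)" if "j \<in> Basis" for j
  proof (rule Bochner_Integration.integrable_bound[OF iP])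
    have "(P z \<bullet> (j, 0))\<^sup>2 \<le> (norm (P z))\<^sup>2" for z
      using power_mono[OF Basis_le_norm[OF Basis_fst[OF that], of "P z"], of 2] by simp
    then show "AE z in TT. norm ((P z \<bullet> (j, 0))\<^sup>2) \<le> norm ((norm (P z))\<^sup>2)" by simp
  qed measurable
  note M = mean_split[OF cont(1) i]
  note MJ = mean_split[OF cj ij]
  have Cm: "C1dir (mean \<phi>) (\<lambda>x. meanG P x \<bullet> j) j" if j: "j \<in> Basis" for j
    unfolding meanG_inner[OF j] by (rule C1dir_mean[OF smoothT_C1dir[OF s Basis_fst[OF j]]])
  have cG: "continuous_on UNIV (meanG P)"
    by (rule continuous_on_componentwise[THEN iffD2]) (use Cm in \<open>simp add: C1dir_def\<close>)
  have iG: "integrable lborel (\<lambda>x. (norm (meanG P x))\<^sup>2)"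
    unfolding norm_square_components using MJ(1) by (intro Bochner_Integration.integrable_sum) (simp add: meanG_inner)
  show "wgR (mean \<phi>) (meanG P)"
    unfolding wgR_def weak_grad_iff using M(1) iG cG continuous_mean[OF cont(1)] Cm
    by (auto intro: borel_measurable_continuous_onI C1dir_wderiv)
  have [measurable]: "meanG P \<in> borel_measurable borel" by (rule borel_measurable_continuous_onI[OF cG])
  show "\<And>x. (LINT y|tau. r (x,y)) = 0" unfolding r_def using M(4) by simp
  show "2 * pi * sqint (mean \<phi>) \<le> (LINT z|TT. (\<phi> z)\<^sup>2)"
  proof -
    have "0 \<le> (LINT z|TT. (\<phi> z - mean \<phi> (fst z))\<^sup>2)" by simp
    then show ?thesis using M(3) unfolding real_norm_def power2_abs by linarith
  qed
  have snN: "snd (N z) = snd (P z)" for z by (simp add: N_def)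
  then show "(LINT z|TT. (snd (N z))\<^sup>2) = (LINT z|TT. (snd (P z))\<^sup>2)" by simp
  have fN: "(norm (fst (N z)))\<^sup>2 = (\<Sum>j\<in>Basis. (P z \<bullet> (j,0) - mean (\<lambda>z. P z \<bullet> (j, 0)) (fst z))\<^sup>2)" for z
    unfolding norm_square_components by (intro sum.cong refl) (simp add: N_def inner_simps meanG_inner inner_prod_def)
  have ifN: "integrable TT (\<lambda>z. (norm (fst (N z)))\<^sup>2)"
    unfolding fN using MJ(2) by (intro Bochner_Integration.integrable_sum)
  have "2 * pi * sqint (meanG P) + (LINT z|TT. (norm (fst (N z)))\<^sup>2)
     = (\<Sum>j\<in>Basis. 2 * pi * (LINT x|lborel. (mean (\<lambda>z. P z \<bullet> (j, 0)) x)\<^sup>2) + (LINT z|TT. (P z \<bullet> (j,0) - mean (\<lambda>z. P z \<bullet> (j, 0)) (fst z))\<^sup>2))"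
  proof -
    have e1: "(LINT z|TT. (norm (fst (N z)))\<^sup>2) = (\<Sum>j\<in>Basis. LINT z|TT. (P z \<bullet> (j,0) - mean (\<lambda>z. P z \<bullet> (j, 0)) (fst z))\<^sup>2)"
      unfolding fN using MJ(2) by (rule Bochner_Integration.integral_sum)
    have "sqint (meanG P) = (LINT x|lborel. (\<Sum>j\<in>Basis. (mean (\<lambda>z. P z \<bullet> (j, 0)) x)\<^sup>2))"
      unfolding norm_square_components by (simp add: meanG_inner cong: sum.cong)
    also have "\<dots> = (\<Sum>j\<in>Basis. LINT x|lborel. (mean (\<lambda>z. P z \<bullet> (j, 0)) x)\<^sup>2)"
      using MJ(1) by (rule Bochner_Integration.integral_sum)
    finally show ?thesis unfolding e1 by (simp only: sum.distrib sum_distrib_left)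
  qed
  also have "\<dots> = (\<Sum>j\<in>Basis. (LINT z|TT. (P z \<bullet> (j,0))\<^sup>2))" by (intro sum.cong refl MJ(3))
  also have "\<dots> = (LINT z|TT. (norm (fst (P z)))\<^sup>2)"
    unfolding norm_square_components using ij by (subst Bochner_Integration.integral_sum) (simp_all add: inner_prod_def)
  finally show "2 * pi * sqint (meanG P) + (LINT z|TT. (norm (fst (N z)))\<^sup>2) = (LINT z|TT. (norm (fst (P z)))\<^sup>2)" .
  show "smoothT r N"
    unfolding smoothT_def
  proof (intro conjI ballI allI impI)
    show "periodic_y r" using s by (simp add: r_def smoothT_def periodic_y_def)
    show "integrable TT (\<lambda>z. (r z)\<^sup>2)" unfolding r_def by (rule M(2))
    show "integrable TT (\<lambda>z. (norm (N z))\<^sup>2)"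
      unfolding norm_pt_split snN using ifN parts_integrable(2)[OF _ iP] by simp
    fix b :: pt assume b: "b \<in> Basis"
    have c1: "continuous_on UNIV r"
      unfolding r_def by (intro continuous_intros cont continuous_on_compose2[OF continuous_mean[OF cont(1)]]) auto
    have c2: "continuous_on UNIV (\<lambda>z. N z \<bullet> b)"
      unfolding N_def by (intro continuous_intros cont continuous_on_compose2[OF cG]) auto
    have "((\<lambda>t. r (z + t *\<^sub>R b)) has_real_derivative N z \<bullet> b) (at 0)" for z
    proof -
      have d1: "((\<lambda>t. \<phi> (z + t *\<^sub>R b)) has_real_derivative P z \<bullet> b) (at 0)"
        using smoothT_C1dir[OF s b] unfolding C1dir_def by blast
      consider (x) j where "j \<in> Basis" "b = (j, 0)" | (y) "b = (0, 1)"
        using b by (auto simp: Basis_prod_def)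
      then show ?thesis
      proof cases
        case x
        have "((\<lambda>t. mean \<phi> (fst z + t *\<^sub>R j)) has_real_derivative meanG P (fst z) \<bullet> j) (at 0)"
          using Cm[OF x(1)] by (simp add: C1dir_def)
        from DERIV_diff[OF d1 this] show ?thesis
          by (simp add: r_def N_def x inner_simps)
      next
        case y
        then show ?thesis using DERIV_diff[OF d1 DERIV_const[of "mean \<phi> (fst z)"]] by (simp add: r_def N_def inner_simps)
      qed
    qed
    then show "C1dir r (\<lambda>z. N z \<bullet> b) b" using c1 c2 by (simp add: C1dir_def)
  next
    fix e :: real assume e: "e > 0"
    then have "e/3 > 0" by simp
    then obtain R where R: "\<And>x y. norm x > R \<Longrightarrow> \<bar>\<phi> (x,y)\<bar> < e/3" using s unfolding smoothT_def by blast
    show "\<exists>R. \<forall>x y. norm x > R \<longrightarrow> \<bar>r (x,y)\<bar> < e"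
    proof (intro exI allI impI)
      fix x :: "real^3" and y :: real assume x: "norm x > R"
      have "\<bar>LINT y|tau. \<phi> (x,y)\<bar> \<le> (LINT y|tau. \<bar>\<phi> (x,y)\<bar>)" by (rule integral_abs_bound)
      also have "\<dots> \<le> (LINT y|tau. e/3)"
        using R[OF x] by (intro integral_mono integrable_abs integral_tau_continuous(2) continuous_slice[OF cont(1)]) (auto simp: less_imp_le)
      also have "\<dots> = 2 * pi * (e/3)" by (simp add: measure_def emeasure_tau)
      finally have "\<bar>mean \<phi> x\<bar> \<le> e/3" by (simp add: mean_def abs_divide divide_le_eq mult.commute)
      then show "\<bar>r (x,y)\<bar> < e" using R[OF x, of y] e by (simp add: r_def)
    qed
  qed
qed

text \<open>Replacing \<open>\<alpha>\<^sup>3\<close> by \<open>\<gamma>\<alpha>\<^sup>2 = \<gamma>\<^sup>3 - \<gamma>\<beta>\<^sup>2\<close> leaves a negative term that absorbs the remainder;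
  the constant is \<open>(20736 + 972)\<^sup>2 / 3\<close>.\<close>

lemma absorb_remainder:
  fixes k :: real
  assumes nn: "\<alpha> \<ge> 0" "\<beta> \<ge> 0" "\<gamma> \<ge> 0" "\<delta> \<ge> 0" "k > 0" "X \<ge> 0" "Br \<ge> 0" and g: "\<gamma>\<^sup>2 = \<alpha>\<^sup>2 + \<beta>\<^sup>2"
    and Bm: "Bm \<le> k * \<alpha> ^ 3" and Br: "Br \<le> 324 * \<beta> ^ 3 * \<delta>" and X: "X\<^sup>2 \<le> Bm * Br"
    and B: "B \<le> Bm + 8 * X + 3 * Br"
  shows "B \<le> \<gamma> ^ 3 * (k + 157079088 * \<delta>\<^sup>2 / k)"
proof -
  \<comment> \<open>\<open>U\<close> is the gain, \<open>Y\<close> measures the contributions of the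
    remainder, and \<open>W\<close> is the error allowed in the claim; \<open>U W\<close> is a
    constant multiple of \<open>Y^2\<close>.\<close>
  define U Y W where "U = k * \<gamma> * \<beta>\<^sup>2" and "Y = \<delta> * \<gamma>\<^sup>2 * \<beta>" and "W = 157079088 * \<delta>\<^sup>2 * \<gamma> ^ 3 / k"
  have pos: "U \<ge> 0" "Y \<ge> 0" "W \<ge> 0" using nn by (simp_all add: U_def Y_def W_def)
  have ag: "\<alpha> \<le> \<gamma>" "\<beta> \<le> \<gamma>" using g nn by (auto intro!: power2_le_imp_le[of _ \<gamma>])
  have "k * \<alpha> ^ 3 \<le> k * (\<gamma> * \<alpha>\<^sup>2)" using ag nn by (simp add: power2_eq_square power3_eq_cube mult_right_mono)
  also have "\<dots> = k * \<gamma> ^ 3 - U"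
  proof -
    have a2: "\<alpha>\<^sup>2 = \<gamma>\<^sup>2 - \<beta>\<^sup>2" using g by simp
    show ?thesis unfolding a2 U_def by (simp add: power2_eq_square power3_eq_cube algebra_simps)
  qed
  finally have 1: "Bm \<le> k * \<gamma> ^ 3 - U" using Bm by simp
  have "\<beta> * \<beta>\<^sup>2 \<le> \<beta> * \<gamma>\<^sup>2" using ag nn by (intro mult_left_mono power_mono) auto
  then have "\<delta> * (\<beta> * \<beta>\<^sup>2) \<le> \<delta> * (\<beta> * \<gamma>\<^sup>2)" using nn(4) by (rule mult_left_mono)
  then have "\<beta> ^ 3 * \<delta> \<le> Y" unfolding Y_def by (simp add: power3_eq_cube power2_eq_square mult_ac)
  then have 2: "3 * Br \<le> 972 * Y" using Br by simp
  \<comment> \<open>Young's inequality at the cost of a quarter of \<open>U\<close>; 20736 is 64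
    times 324.\<close>
  have 3: "8 * X \<le> U / 4 + 20736 * Y"
  proof (rule power2_le_imp_le)
    have "Bm * Br \<le> (k * \<alpha> ^ 3) * (324 * \<beta> ^ 3 * \<delta>)" using Bm Br nn by (intro mult_mono) auto
    also have "\<dots> \<le> (k * \<gamma> ^ 3) * (324 * \<beta> ^ 3 * \<delta>)"
      using ag nn by (intro mult_right_mono mult_left_mono power_mono) auto
    also have "\<dots> = 324 * (U * Y)" by (simp add: U_def Y_def power2_eq_square power3_eq_cube)
    finally have "X\<^sup>2 \<le> 324 * (U * Y)" using X by simp
    then have "(8 * X)\<^sup>2 \<le> 20736 * (U * Y)" by (simp add: power_mult_distrib)
    also have "\<dots> \<le> (U / 4 + 20736 * Y)\<^sup>2"
    proof -
      have "0 \<le> (U / 4 - 20736 * Y)\<^sup>2" by simp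
      then show ?thesis by (simp add: power2_eq_square algebra_simps)
    qed
    finally show "(8 * X)\<^sup>2 \<le> (U / 4 + 20736 * Y)\<^sup>2" .
  qed (use pos in simp)
  \<comment> \<open>21708 = 20736 + 972 collects all multiples of \<open>Y\<close>, and the other
    three quarters of \<open>U\<close> pay for them.\<close>
  have 4: "21708 * Y \<le> 3 * U / 4 + W"
  proof (rule power2_le_imp_le)
    have "(21708 * Y)\<^sup>2 = 4 * ((3 * U / 4) * W)"
      using nn(5) by (simp add: U_def Y_def W_def power2_eq_square power3_eq_cube field_simps)
    also have "\<dots> \<le> (3 * U / 4 + W)\<^sup>2"
    proof -
      have "0 \<le> (3 * U / 4 - W)\<^sup>2" by simp
      then show ?thesis by (simp add: power2_eq_square algebra_simps)
    qed
    finally show "(21708 * Y)\<^sup>2 \<le> (3 * U / 4 + W)\<^sup>2" .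
  qed (use pos in simp)
  have "B \<le> k * \<gamma> ^ 3 + W" using B 1 2 3 4 by linarith
  also have "\<dots> = \<gamma> ^ 3 * (k + 157079088 * \<delta>\<^sup>2 / k)" by (simp add: W_def algebra_simps)
  finally show ?thesis .
qed

section \<open>Rigidity\<close>

lemma smoothT_quart_integrable:
  assumes f: "smoothT \<phi> P" and g: "smoothT \<psi> R"
  shows "integrable TT (\<lambda>z. ((\<phi> z)\<^sup>2 + (\<psi> z)\<^sup>2)\<^sup>2)"
    "(LINT z|TT. ((\<phi> z)\<^sup>2 + (\<psi> z)\<^sup>2)\<^sup>2) \<le> 2 * (LINT z|TT. \<phi> z ^ 4) + 2 * (LINT z|TT. \<psi> z ^ 4)"
proof -
  note [measurable] = smoothT_measurable[OF f] smoothT_measurable[OF g]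
  show i: "integrable TT (\<lambda>z. ((\<phi> z)\<^sup>2 + (\<psi> z)\<^sup>2)\<^sup>2)"
  proof (rule Bochner_Integration.integrable_bound)
    show "integrable TT (\<lambda>x. 2 * \<phi> x ^ 4 + 2 * \<psi> x ^ 4)"
      using smoothT_pow4[OF f] smoothT_pow4[OF g] by simp
    show "AE x in TT. norm (((\<phi> x)\<^sup>2 + (\<psi> x)\<^sup>2)\<^sup>2) \<le> norm (2 * \<phi> x ^ 4 + 2 * \<psi> x ^ 4)"
      using square_sum_le by (intro AE_I2) (simp add: abs_of_nonneg)
  qed measurable
  have "(LINT z|TT. ((\<phi> z)\<^sup>2 + (\<psi> z)\<^sup>2)\<^sup>2) \<le> (LINT z|TT. 2 * \<phi> z ^ 4 + 2 * \<psi> z ^ 4)"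
    using smoothT_pow4[OF f] smoothT_pow4[OF g] by (intro integral_mono i square_sum_le) auto
  also have "\<dots> = 2 * (LINT z|TT. \<phi> z ^ 4) + 2 * (LINT z|TT. \<psi> z ^ 4)"
    using smoothT_pow4[OF f] smoothT_pow4[OF g] by simp
  finally show "(LINT z|TT. ((\<phi> z)\<^sup>2 + (\<psi> z)\<^sup>2)\<^sup>2) \<le> 2 * (LINT z|TT. \<phi> z ^ 4) + 2 * (LINT z|TT. \<psi> z ^ 4)" .
qed

text \<open>Chosen so that \<open>kap * sqrt s\<close> is the constant which \<open>sharp_gn\<close>
  gives on the cell for y-independent pairs of total mass \<open>s\<close>.\<close>

definition kap :: real where "kap = 1 / (pi * sqrt (27 * m_R 1))"

lemma kap: "kap > 0" "kap\<^sup>2 = 1 / (27 * m_R 1 * pi\<^sup>2)"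
  using m_R_pos by (simp_all add: kap_def power_divide power_mult_distrib mult.commute)

text \<open>With \<open>p\<close>, \<open>q\<close>, \<open>t\<close> for the squared mean, the
  inner product and the squared remainder, \<open>q^2\<close> is estimated by Cauchy-Schwarz and
  \<open>q t\<close> by Young's inequality. The term \<open>p q\<close> is kept exactly, because it
  is linear in the remainder and integrates to zero.\<close>

lemma quartic_expansion:
  fixes m1 m2 r1 r2 :: real
  shows "((m1 + r1)\<^sup>2 + (m2 + r2)\<^sup>2)\<^sup>2 \<le> (m1\<^sup>2 + m2\<^sup>2)\<^sup>2 + 4 * ((m1\<^sup>2 + m2\<^sup>2) * m1 * r1 + (m1\<^sup>2 + m2\<^sup>2) * m2 * r2)
    + 8 * ((m1\<^sup>2 + m2\<^sup>2) * (r1\<^sup>2 + r2\<^sup>2)) + 3 * (r1\<^sup>2 + r2\<^sup>2)\<^sup>2"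
proof -
  define p q t where "p = m1\<^sup>2 + m2\<^sup>2" and "q = m1 * r1 + m2 * r2" and "t = r1\<^sup>2 + r2\<^sup>2"
  have "0 \<le> (m1 * r2 - m2 * r1)\<^sup>2" by simp
  then have cs: "q\<^sup>2 \<le> p * t" by (simp add: p_def q_def t_def power2_eq_square algebra_simps)
  have "0 \<le> (q - t)\<^sup>2" by simp
  then have am: "4 * (q * t) \<le> 2 * q\<^sup>2 + 2 * t\<^sup>2" by (simp add: power2_diff)
  have "(p + 2 * q + t)\<^sup>2 = p\<^sup>2 + 4 * (p * q) + 4 * q\<^sup>2 + 2 * (p * t) + 4 * (q * t) + t\<^sup>2"
    by (simp add: power2_eq_square algebra_simps)
  also have "\<dots> \<le> p\<^sup>2 + 4 * (p * q) + 8 * (p * t) + 3 * t\<^sup>2" using cs am by linarith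
  finally have "(p + 2 * q + t)\<^sup>2 \<le> p\<^sup>2 + 4 * (p * q) + 8 * (p * t) + 3 * t\<^sup>2" .
  moreover have "(m1 + r1)\<^sup>2 + (m2 + r2)\<^sup>2 = p + 2 * q + t" by (simp add: p_def q_def t_def power2_sum)
  moreover have "p * q = p * m1 * r1 + p * m2 * r2" by (simp add: q_def algebra_simps)
  ultimately show ?thesis unfolding p_def[symmetric] t_def[symmetric] by simp
qed

lemma mean_bounded:
  assumes c: "continuous_on UNIV \<phi>" and M: "\<And>z. \<bar>\<phi> z\<bar> \<le> M" shows "\<bar>mean \<phi> x\<bar> \<le> M"
proof -
  have "\<bar>LINT y|tau. \<phi> (x,y)\<bar> \<le> (LINT y|tau. \<bar>\<phi> (x,y)\<bar>)" by (rule integral_abs_bound)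
  also have "\<dots> \<le> (LINT y|tau. M)"
    using M by (intro integral_mono integrable_abs integral_tau_continuous(2) continuous_slice[OF c]) auto
  also have "\<dots> = 2 * pi * M" by (simp add: measure_def emeasure_tau)
  finally show ?thesis by (simp add: mean_def abs_divide divide_le_eq mult.commute)
qed

text \<open>The cubic cross term drops out because the remainder has zero mean in \<open>y\<close>; this is what makes the
  first-order correction to the sharp inequality on \<open>\<real>\<^sup>3\<close> quadratic in the remainder.\<close>

lemma cross_term_zero:
  assumes s: "smoothT \<phi> P" and w: "w \<in> borel_measurable borel" "integrable lborel (\<lambda>x. (w x)\<^sup>2)"
  shows "integrable TT (\<lambda>z. w (fst z) * (\<phi> z - mean \<phi> (fst z)))" "(LINT z|TT. w (fst z) * (\<phi> z - mean \<phi> (fst z))) = 0"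
proof -
  note S = smoothT_mean_split[OF s]
  note [measurable] = smoothT_measurable(1)[OF S(2)] w(1)
  have t1: "integrable tau (\<lambda>y. 1::real)" by simp
  show i: "integrable TT (\<lambda>z. w (fst z) * (\<phi> z - mean \<phi> (fst z)))"
  proof (rule product_integrable)
    show "integrable TT (\<lambda>z. (w (fst z))\<^sup>2)" using TT_product(1)[OF w(2) t1] by simp
    show "integrable TT (\<lambda>z. (\<phi> z - mean \<phi> (fst z))\<^sup>2)" using S(2) by (simp add: smoothT_def)
  qed measurable
  show "(LINT z|TT. w (fst z) * (\<phi> z - mean \<phi> (fst z))) = 0"
    using lborel_tau.integral_fst'[of "\<lambda>z. w (fst z) * (\<phi> z - mean \<phi> (fst z))"] i S(3) by (simp add: TT_def)
qed

text \<open>The mass is only bounded by \<open>s\<close>: mollification may lower it, while the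
  constant has to be that of the original pair.\<close>

lemma rigidity_smooth:
  assumes s1: "smoothT \<phi> P" and s2: "smoothT \<psi> R" and s: "(LINT z|TT. (\<phi> z)\<^sup>2) + (LINT z|TT. (\<psi> z)\<^sup>2) \<le> s" "s > 0"
  defines "A \<equiv> (LINT z|TT. (norm (fst (P z)))\<^sup>2) + (LINT z|TT. (norm (fst (R z)))\<^sup>2)"
    and "D \<equiv> (LINT z|TT. (snd (P z))\<^sup>2) + (LINT z|TT. (snd (R z))\<^sup>2)"
  shows "(LINT z|TT. ((\<phi> z)\<^sup>2 + (\<psi> z)\<^sup>2)\<^sup>2) \<le> sqrt A ^ 3 * (kap * sqrt s + 157079088 * D / (kap * sqrt s))"
proof -
  note S1 = smoothT_mean_split[OF s1] and S2 = smoothT_mean_split[OF s2]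
  define m1 m2 where "m1 = mean \<phi>" and "m2 = mean \<psi>"
  define r1 r2 where "r1 = (\<lambda>z. \<phi> z - m1 (fst z))" and "r2 = (\<lambda>z. \<psi> z - m2 (fst z))"
  have w: "wgR m1 (meanG P)" "wgR m2 (meanG R)" using S1(1) S2(1) by (simp_all add: m1_def m2_def)
  have [measurable]: "m1 \<in> borel_measurable borel" "m2 \<in> borel_measurable borel" using w by (auto simp: wgR_def)
  have sr: "smoothT r1 (\<lambda>z. P z - (meanG P (fst z), 0))" "smoothT r2 (\<lambda>z. R z - (meanG R (fst z), 0))"
    using S1(2) S2(2) by (simp_all add: r1_def r2_def m1_def m2_def)
  note [measurable] = smoothT_measurable(1)[OF sr(1)] smoothT_measurable(1)[OF sr(2)]
  define Ar where "Ar = (LINT z|TT. (norm (fst (P z - (meanG P (fst z), 0))))\<^sup>2) + (LINT z|TT. (norm (fst (R z - (meanG R (fst z), 0))))\<^sup>2)"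
  define Am where "Am = 2 * pi * (sqint (meanG P) + sqint (meanG R))"
  have A: "A = Am + Ar" using S1(5) S2(5) by (simp add: A_def Am_def Ar_def algebra_simps)
  have Ar0: "Ar \<ge> 0" and Am0: "Am \<ge> 0" and D0: "D \<ge> 0" by (simp_all add: Ar_def Am_def D_def)
  have t1: "integrable tau (\<lambda>y. 1::real)" by simp
  define Bm where "Bm = (LINT z|TT. ((m1 (fst z))\<^sup>2 + (m2 (fst z))\<^sup>2)\<^sup>2)"
  define Br where "Br = (LINT z|TT. ((r1 z)\<^sup>2 + (r2 z)\<^sup>2)\<^sup>2)"
  define X where "X = (LINT z|TT. ((m1 (fst z))\<^sup>2 + (m2 (fst z))\<^sup>2) * ((r1 z)\<^sup>2 + (r2 z)\<^sup>2))"
  have iBm: "integrable TT (\<lambda>z. ((m1 (fst z))\<^sup>2 + (m2 (fst z))\<^sup>2)\<^sup>2)"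
    using TT_product(1)[OF quartR_integrable[OF w] t1] by simp
  have Bm: "Bm = 2 * pi * quartR m1 m2"
    using TT_product(2)[OF quartR_integrable[OF w] t1] by (simp add: Bm_def quartR_def measure_def emeasure_tau)
  have iBr: "integrable TT (\<lambda>z. ((r1 z)\<^sup>2 + (r2 z)\<^sup>2)\<^sup>2)" by (rule smoothT_quart_integrable[OF sr])
  have iX: "integrable TT (\<lambda>z. ((m1 (fst z))\<^sup>2 + (m2 (fst z))\<^sup>2) * ((r1 z)\<^sup>2 + (r2 z)\<^sup>2))"
    using iBm iBr by (intro product_integrable) measurable
  have X2: "X\<^sup>2 \<le> Bm * Br"
    unfolding X_def Bm_def Br_def using iBm iBr by (intro cauchy_schwarz_integral) measurable
  have X0: "X \<ge> 0" by (simp add: X_def)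
  have Br0: "Br \<ge> 0" by (simp add: Br_def)
  have Bm0: "Bm \<ge> 0" by (simp add: Bm_def)
  \<comment> \<open>Bounded functions have bounded means; this makes the cubic weights of the cross
    terms square integrable.\<close>
  obtain M1 where M1: "\<And>z. \<bar>\<phi> z\<bar> \<le> M1" using smoothT_bounded[OF s1] by blast
  obtain M2 where M2: "\<And>z. \<bar>\<psi> z\<bar> \<le> M2" using smoothT_bounded[OF s2] by blast
  have b1: "\<bar>m1 x\<bar> \<le> M1" and b2: "\<bar>m2 x\<bar> \<le> M2" for x
    unfolding m1_def m2_def by (intro mean_bounded smoothT_continuous(1)[OF s1] smoothT_continuous(1)[OF s2] M1 M2)+
  have iw: "integrable lborel (\<lambda>x. (((m1 x)\<^sup>2 + (m2 x)\<^sup>2) * m x)\<^sup>2)"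
    if [measurable]: "m \<in> borel_measurable borel" and M: "\<And>x. \<bar>m x\<bar> \<le> M" for m M
  proof (rule Bochner_Integration.integrable_bound)
    show "integrable lborel (\<lambda>x. M\<^sup>2 * ((m1 x)\<^sup>2 + (m2 x)\<^sup>2)\<^sup>2)" using quartR_integrable[OF w] by simp
    have "(m x)\<^sup>2 \<le> M\<^sup>2" for x using power_mono[OF M, of x 2] by simp
    then show "AE x in lborel. norm ((((m1 x)\<^sup>2 + (m2 x)\<^sup>2) * m x)\<^sup>2) \<le> norm (M\<^sup>2 * ((m1 x)\<^sup>2 + (m2 x)\<^sup>2)\<^sup>2)"
      by (intro AE_I2) (simp add: power_mult_distrib mult.commute mult_right_mono)
  qed measurable
  have c1: "integrable TT (\<lambda>z. (((m1 (fst z))\<^sup>2 + (m2 (fst z))\<^sup>2) * m1 (fst z)) * r1 z)"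
      "(LINT z|TT. (((m1 (fst z))\<^sup>2 + (m2 (fst z))\<^sup>2) * m1 (fst z)) * r1 z) = 0"
    using cross_term_zero[OF s1 _ iw[of m1, OF _ b1]] by (simp_all add: r1_def m1_def[symmetric])
  have c2: "integrable TT (\<lambda>z. (((m1 (fst z))\<^sup>2 + (m2 (fst z))\<^sup>2) * m2 (fst z)) * r2 z)"
      "(LINT z|TT. (((m1 (fst z))\<^sup>2 + (m2 (fst z))\<^sup>2) * m2 (fst z)) * r2 z) = 0"
    using cross_term_zero[OF s2 _ iw[of m2, OF _ b2]] by (simp_all add: r2_def m2_def[symmetric])
  have "(LINT z|TT. ((\<phi> z)\<^sup>2 + (\<psi> z)\<^sup>2)\<^sup>2) \<le> (LINT z|TT. ((m1 (fst z))\<^sup>2 + (m2 (fst z))\<^sup>2)\<^sup>2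
     + 4 * (((m1 (fst z))\<^sup>2 + (m2 (fst z))\<^sup>2) * m1 (fst z) * r1 z + ((m1 (fst z))\<^sup>2 + (m2 (fst z))\<^sup>2) * m2 (fst z) * r2 z)
     + 8 * (((m1 (fst z))\<^sup>2 + (m2 (fst z))\<^sup>2) * ((r1 z)\<^sup>2 + (r2 z)\<^sup>2)) + 3 * ((r1 z)\<^sup>2 + (r2 z)\<^sup>2)\<^sup>2)"
  proof (rule integral_mono)
    show "integrable TT (\<lambda>z. ((\<phi> z)\<^sup>2 + (\<psi> z)\<^sup>2)\<^sup>2)" by (rule smoothT_quart_integrable[OF s1 s2])
    fix z
    have "\<phi> z = m1 (fst z) + r1 z" "\<psi> z = m2 (fst z) + r2 z" by (simp_all add: r1_def r2_def)
    then show "((\<phi> z)\<^sup>2 + (\<psi> z)\<^sup>2)\<^sup>2 \<le> ((m1 (fst z))\<^sup>2 + (m2 (fst z))\<^sup>2)\<^sup>2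
     + 4 * (((m1 (fst z))\<^sup>2 + (m2 (fst z))\<^sup>2) * m1 (fst z) * r1 z + ((m1 (fst z))\<^sup>2 + (m2 (fst z))\<^sup>2) * m2 (fst z) * r2 z)
     + 8 * (((m1 (fst z))\<^sup>2 + (m2 (fst z))\<^sup>2) * ((r1 z)\<^sup>2 + (r2 z)\<^sup>2)) + 3 * ((r1 z)\<^sup>2 + (r2 z)\<^sup>2)\<^sup>2"
      by (simp only: quartic_expansion)
  qed (intro Bochner_Integration.integrable_add integrable_mult_right iBm c1 c2 iX iBr)
  also have "\<dots> = Bm + 8 * X + 3 * Br"
    using iBm c1 c2 iX iBr by (simp add: Bm_def X_def Br_def)
  finally have B: "(LINT z|TT. ((\<phi> z)\<^sup>2 + (\<psi> z)\<^sup>2)\<^sup>2) \<le> Bm + 8 * X + 3 * Br" .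
  define k where "k = kap * sqrt s"
  have k: "k > 0" using kap s by (simp add: k_def)
  \<comment> \<open>The sharp inequality on R^3 for the means. Quartic term, mass and energy all
    carry a factor \<open>2*pi\<close> from the circle, and these factors are collected in
    \<open>kap\<close>.\<close>
  have Bmk: "Bm \<le> k * sqrt Am ^ 3"
  proof (rule power2_le_imp_le)
    have mu: "m_R 1 > 0" by (rule m_R_pos)
    have "2 * pi * (sqint m1 + sqint m2) \<le> s"
      using S1(4) S2(4) s(1) unfolding m1_def[symmetric] m2_def[symmetric] distrib_left by linarith
    then have sm: "sqint m1 + sqint m2 \<le> s / (2*pi)" by (simp add: field_simps)
    have am: "sqint (meanG P) + sqint (meanG R) = Am / (2*pi)" by (simp add: Am_def)
    have "27 * m_R 1 * (quartR m1 m2)\<^sup>2 \<le> 4 * (sqint m1 + sqint m2) * (Am / (2*pi)) ^ 3"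
      using sharp_gn[OF w] unfolding am .
    also have "\<dots> \<le> 4 * (s / (2*pi)) * (Am / (2*pi)) ^ 3"
      using sm Am0 by (intro mult_right_mono mult_left_mono) auto
    finally have "27 * m_R 1 * (quartR m1 m2)\<^sup>2 \<le> 4 * (s / (2*pi)) * (Am / (2*pi)) ^ 3" .
    then have "(quartR m1 m2)\<^sup>2 \<le> 4 * (s / (2*pi)) * (Am / (2*pi)) ^ 3 / (27 * m_R 1)"
      using mu by (subst pos_le_divide_eq) (simp, metis mult.commute)
    then have "(2*pi)\<^sup>2 * (quartR m1 m2)\<^sup>2 \<le> (2*pi)\<^sup>2 * (4 * (s / (2*pi)) * (Am / (2*pi)) ^ 3 / (27 * m_R 1))"
      by (rule mult_left_mono) simp
    also have "\<dots> = kap\<^sup>2 * s * Am ^ 3"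
      unfolding kap(2) using mu by (simp add: power2_eq_square power3_eq_cube field_simps)
    also have "\<dots> = (k * sqrt Am ^ 3)\<^sup>2"
    proof -
      have "(sqrt Am ^ 3)\<^sup>2 = (sqrt Am ^ 2) ^ 3" by (simp flip: power_mult)
      then show ?thesis using Am0 s by (simp add: k_def power_mult_distrib)
    qed
    finally show "Bm\<^sup>2 \<le> (k * sqrt Am ^ 3)\<^sup>2" by (simp add: Bm power_mult_distrib)
  qed (use k Am0 in simp)
  \<comment> \<open>Each component obeys \<open>sobolev_smooth\<close> with the total energies on
    the right; 324^2 = 104976 is 16 times 6561.\<close>
  have Brd: "Br \<le> 324 * sqrt Ar ^ 3 * sqrt D"
  proof (rule power2_le_imp_le)
    let ?X = "LINT z|TT. r1 z ^ 4" and ?Y = "LINT z|TT. r2 z ^ 4"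
    have z: "\<And>x. (LINT y|tau. r1 (x,y)) = 0" "\<And>x. (LINT y|tau. r2 (x,y)) = 0"
      using S1(3) S2(3) by (simp_all add: r1_def r2_def m1_def m2_def)
    note E1 = sobolev_smooth(2)[OF sr(1) z(1)] and E2 = sobolev_smooth(2)[OF sr(2) z(2)]
    have "6561 * (LINT z|TT. (norm (fst (P z - (meanG P (fst z), 0))))\<^sup>2) ^ 3 * (LINT z|TT. (snd (P z - (meanG P (fst z), 0)))\<^sup>2) \<le> 6561 * Ar ^ 3 * D"
      using S1(6) by (intro mult_mono power_mono) (auto simp: Ar_def D_def)
    then have XX: "?X\<^sup>2 \<le> 6561 * Ar ^ 3 * D" using E1 by linarith
    have "6561 * (LINT z|TT. (norm (fst (R z - (meanG R (fst z), 0))))\<^sup>2) ^ 3 * (LINT z|TT. (snd (R z - (meanG R (fst z), 0)))\<^sup>2) \<le> 6561 * Ar ^ 3 * D"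
      using S2(6) by (intro mult_mono power_mono) (auto simp: Ar_def D_def)
    then have YY: "?Y\<^sup>2 \<le> 6561 * Ar ^ 3 * D" using E2 by linarith
    have "Br \<le> 2 * ?X + 2 * ?Y" unfolding Br_def by (rule smoothT_quart_integrable(2)[OF sr])
    then have "Br\<^sup>2 \<le> (2 * ?X + 2 * ?Y)\<^sup>2" using Br0 by (intro power_mono)
    also have "\<dots> \<le> 8 * (?X\<^sup>2 + ?Y\<^sup>2)"
    proof -
      have "0 \<le> 4 * (?X - ?Y)\<^sup>2" by simp
      then show ?thesis by (simp add: power2_eq_square algebra_simps)
    qed
    also have "\<dots> \<le> 104976 * (Ar ^ 3 * D)" using XX YY by simp
    also have "\<dots> = (324 * sqrt Ar ^ 3 * sqrt D)\<^sup>2"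
    proof -
      have "(sqrt Ar ^ 3)\<^sup>2 = (sqrt Ar ^ 2) ^ 3" by (simp flip: power_mult)
      then show ?thesis using Ar0 D0 by (simp add: power_mult_distrib)
    qed
    finally show "Br\<^sup>2 \<le> (324 * sqrt Ar ^ 3 * sqrt D)\<^sup>2" .
  qed (use Ar0 D0 in simp)
  \<comment> \<open>\<open>absorb_remainder\<close> with the square roots of \<open>Am\<close>,
    \<open>Ar\<close>, \<open>A\<close> and \<open>D\<close> as \<open>\<alpha>\<close>,
    \<open>\<beta>\<close>, \<open>\<gamma>\<close> and \<open>\<delta>\<close>.\<close>
  have "(LINT z|TT. ((\<phi> z)\<^sup>2 + (\<psi> z)\<^sup>2)\<^sup>2) \<le> sqrt A ^ 3 * (k + 157079088 * (sqrt D)\<^sup>2 / k)"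
    by (rule absorb_remainder[OF _ _ _ _ k X0 Br0 _ Bmk Brd X2 B]) (use Am0 Ar0 D0 A in simp_all)
  then show ?thesis using D0 by (simp add: k_def)
qed

text \<open>Mollification raises neither the mass nor \<open>A\<close> nor \<open>D\<close>, and the
  bound is monotone in \<open>A\<close> and \<open>D\<close>; so all mollified pairs share one bound
  and Fatou's lemma finishes. This is also where the quartic integral of an arbitrary pair is seen
  to be finite.\<close>

lemma rigidity:
  assumes u: "wgT u G" and v: "wgT v H" and s: "(LINT z|TT. (u z)\<^sup>2) + (LINT z|TT. (v z)\<^sup>2) = s" "s > 0"
  defines "A \<equiv> (LINT z|TT. (norm (fst (G z)))\<^sup>2) + (LINT z|TT. (norm (fst (H z)))\<^sup>2)"
    and "D \<equiv> (LINT z|TT. (snd (G z))\<^sup>2) + (LINT z|TT. (snd (H z))\<^sup>2)"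
  shows "integrable TT (\<lambda>z. ((u z)\<^sup>2 + (v z)\<^sup>2)\<^sup>2)"
    "(LINT z|TT. ((u z)\<^sup>2 + (v z)\<^sup>2)\<^sup>2) \<le> sqrt A ^ 3 * (kap * sqrt s + 157079088 * D / (kap * sqrt s))"
proof -
  have L: "L2T u" "L2T v" using u v by (auto simp: wgT_def)
  note [measurable] = L[THEN L2T_measurable]
  let ?u = "\<lambda>n. conv u (mol (hseq n))" and ?v = "\<lambda>n. conv v (mol (hseq n))"
  let ?C = "sqrt A ^ 3 * (kap * sqrt s + 157079088 * D / (kap * sqrt s))"
  have b: "(LINT z|TT. ((?u n z)\<^sup>2 + (?v n z)\<^sup>2)\<^sup>2) \<le> ?C" for n
  proof -
    note S1 = smoothT_mol[OF u hseq, of n] and S2 = smoothT_mol[OF v hseq, of n]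
    let ?A = "(LINT z|TT. (norm (fst (molP G (hseq n) z)))\<^sup>2) + (LINT z|TT. (norm (fst (molP H (hseq n) z)))\<^sup>2)"
    let ?D = "(LINT z|TT. (snd (molP G (hseq n) z))\<^sup>2) + (LINT z|TT. (snd (molP H (hseq n) z))\<^sup>2)"
    have "(LINT z|TT. (?u n z)\<^sup>2) + (LINT z|TT. (?v n z)\<^sup>2) \<le> s"
      using conv_L2(2)[OF L(1) hseq(1), of n] conv_L2(2)[OF L(2) hseq(1), of n] s(1) by linarith
    from rigidity_smooth[OF S1(1) S2(1) this s(2)]
    have "(LINT z|TT. ((?u n z)\<^sup>2 + (?v n z)\<^sup>2)\<^sup>2) \<le> sqrt ?A ^ 3 * (kap * sqrt s + 157079088 * ?D / (kap * sqrt s))" .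
    also have "\<dots> \<le> ?C"
    proof (intro mult_mono power_mono add_left_mono divide_right_mono mult_left_mono real_sqrt_le_mono)
      show "?A \<le> A" unfolding A_def by (intro add_mono S1 S2)
      show "?D \<le> D" unfolding D_def by (intro add_mono S1 S2)
    qed (use kap s in \<open>auto simp: A_def\<close>)
    finally show ?thesis .
  qed
  have lim: "AE z in TT. (\<lambda>n. ((?u n z)\<^sup>2 + (?v n z)\<^sup>2)\<^sup>2) \<longlonglongrightarrow> ((u z)\<^sup>2 + (v z)\<^sup>2)\<^sup>2"
    using conv_hseq_tendsto[OF u] conv_hseq_tendsto[OF v] by eventually_elim (intro tendsto_intros)
  have i: "integrable TT (\<lambda>z. ((?u n z)\<^sup>2 + (?v n z)\<^sup>2)\<^sup>2)" for n
    by (rule smoothT_quart_integrable[OF smoothT_mol(1)[OF u hseq] smoothT_mol(1)[OF v hseq]])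
  note F = fatou_bound[where M=TT and f="\<lambda>n z. ((?u n z)\<^sup>2 + (?v n z)\<^sup>2)\<^sup>2" and F="\<lambda>z. ((u z)\<^sup>2 + (v z)\<^sup>2)\<^sup>2" and C="?C", OF i _ lim b]
  show "integrable TT (\<lambda>z. ((u z)\<^sup>2 + (v z)\<^sup>2)\<^sup>2)" by (rule F) auto
  show "(LINT z|TT. ((u z)\<^sup>2 + (v z)\<^sup>2)\<^sup>2) \<le> ?C" by (rule F) auto
qed

section \<open>Scaling and the threshold\<close>

abbreviation massT :: "(pt \<Rightarrow> real) \<Rightarrow> real" where "massT u \<equiv> LINT z|TT. (u z)\<^sup>2"
abbreviation xen :: "(pt \<Rightarrow> pt) \<Rightarrow> real" where "xen G \<equiv> LINT z|TT. (norm (fst (G z)))\<^sup>2"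
abbreviation yen :: "(pt \<Rightarrow> pt) \<Rightarrow> real" where "yen G \<equiv> LINT z|TT. (snd (G z))\<^sup>2"

definition quartT :: "(pt \<Rightarrow> real) \<Rightarrow> (pt \<Rightarrow> real) \<Rightarrow> real" where
  "quartT u v = (LINT z|TT. ((u z)\<^sup>2 + (v z)\<^sup>2)\<^sup>2)"

lemma H1T_wgT: "u \<in> H1T \<Longrightarrow> wgT u (gradT u)"
proof -
  assume u: "u \<in> H1T"
  let ?P = "\<lambda>G. weak_grad u G \<and> periodic_y G \<and> G \<in> borel_measurable lborel \<and> set_integrable lborel cell (\<lambda>z. (norm (G z))^2)"
  have P: "?P (gradT u)" unfolding gradT_def by (rule someI_ex[of ?P]) (use u in \<open>simp add: H1T_def\<close>)
  have [measurable]: "u \<in> borel_measurable borel" "gradT u \<in> borel_measurable borel" using u P by (auto simp: H1T_def)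
  have "integrable TT (\<lambda>z. (u z)\<^sup>2)" using u by (subst set_integrable_TT[symmetric]) (simp_all add: H1T_def)
  moreover have "integrable TT (\<lambda>z. (norm (gradT u z))\<^sup>2)" using P by (subst set_integrable_TT[symmetric]) simp_all
  ultimately show ?thesis using u P by (simp add: wgT_def L2T_def H1T_def)
qed

text \<open>By uniqueness of weak gradients the energies of the chosen \<open>gradT u\<close> agree
  with those of any explicit gradient, which makes trial functions and dilated pairs
  computable.\<close>

lemma wgT_H1T:
  assumes w: "wgT u G" shows "u \<in> H1T" "xen (gradT u) = xen G" "yen (gradT u) = yen G"
proof -
  have [measurable]: "u \<in> borel_measurable borel" "G \<in> borel_measurable borel" using w by (auto simp: wgT_def L2T_def)
  have "set_integrable lborel cell (\<lambda>z. (u z)\<^sup>2)" using w by (subst set_integrable_TT) (simp_all add: wgT_def L2T_def)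
  moreover have "set_integrable lborel cell (\<lambda>z. (norm (G z))\<^sup>2)" using w by (subst set_integrable_TT) (simp_all add: wgT_def)
  ultimately show u: "u \<in> H1T" using w unfolding H1T_def by (auto simp: wgT_def L2T_def)
  note W = H1T_wgT[OF u]
  have [measurable]: "gradT u \<in> borel_measurable borel" using W by (simp add: wgT_def)
  note ae = AE_TT[OF wgT_unique[OF W w]]
  have "AE z in TT. (norm (fst (gradT u z)))\<^sup>2 = (norm (fst (G z)))\<^sup>2" using ae by eventually_elim simp
  then show "xen (gradT u) = xen G" by (intro integral_cong_AE) measurable
  have "AE z in TT. (snd (gradT u z))\<^sup>2 = (snd (G z))\<^sup>2" using ae by eventually_elim simp
  then show "yen (gradT u) = yen G" by (intro integral_cong_AE) measurable
qed

lemma IQ_T: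
  assumes u: "wgT u G" and v: "wgT v H"
  shows "I_T u v = (xen G + xen H) / 2 + (yen G + yen H) / 2 - quartT u v / 4"
    "Q_T u v = (xen G + xen H) - 3 / 4 * quartT u v"
proof -
  have e: "\<bar>a\<bar> ^ 4 + 2 * \<bar>a\<bar>\<^sup>2 * \<bar>b\<bar>\<^sup>2 + \<bar>b\<bar> ^ 4 = (a\<^sup>2 + b\<^sup>2)\<^sup>2" for a b :: real
    by (simp add: power2_eq_square power4_eq_xxxx algebra_simps)
  note U = wgT_H1T[OF u] and V = wgT_H1T[OF v]
  note U' = H1T_wgT[OF U(1)] and V' = H1T_wgT[OF V(1)]
  have [measurable]: "u \<in> borel_measurable borel" "v \<in> borel_measurable borel"
    "gradT u \<in> borel_measurable borel" "gradT v \<in> borel_measurable borel" using U' V' by (auto simp: wgT_def L2T_def)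
  have i: "integrable TT (\<lambda>z. (norm (gradT u z))\<^sup>2)" "integrable TT (\<lambda>z. (norm (gradT v z))\<^sup>2)" using U' V' by (auto simp: wgT_def)
  note P = parts_integrable[OF _ i(1)] parts_integrable[OF _ i(2)]
  have 1: "intT (\<lambda>z. (norm (gradT u z))\<^sup>2 + (norm (gradT v z))\<^sup>2) = (xen G + xen H) + (yen G + yen H)"
    unfolding norm_pt_split using P by (subst intT_TT) (simp_all add: U V)
  have 2: "intT (\<lambda>z. (norm (fst (gradT u z)))\<^sup>2 + (norm (fst (gradT v z)))\<^sup>2) = xen G + xen H"
    using P by (subst intT_TT) (simp_all add: U V)
  have 3: "intT (\<lambda>z. ((u z)\<^sup>2 + (v z)\<^sup>2)\<^sup>2) = quartT u v" unfolding quartT_def by (rule intT_TT) measurable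
  show "I_T u v = (xen G + xen H) / 2 + (yen G + yen H) / 2 - quartT u v / 4"
    unfolding I_T_def e 1 3 by (simp add: field_simps)
  show "Q_T u v = (xen G + xen H) - 3 / 4 * quartT u v"
    unfolding Q_T_def e 2 3 by simp
qed

text \<open>The bound in \<open>rigidity\<close> contains the factor \<open>sqrt A ^ 3\<close>, so a
  vanishing x-energy would force the quartic integral, and with it the pair, to vanish.\<close>

lemma quartT_pos:
  assumes u: "wgT u G" and v: "wgT v H" and m: "massT u + massT v > 0"
  shows "quartT u v > 0" "xen G + xen H > 0"
proof -
  note R = rigidity[OF u v refl m]
  have [measurable]: "u \<in> borel_measurable borel" "v \<in> borel_measurable borel" using u v by (auto simp: wgT_def L2T_def)
  have "quartT u v \<noteq> 0"
  proof
    assume "quartT u v = 0"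
    then have "AE x in TT. ((u x)\<^sup>2 + (v x)\<^sup>2)\<^sup>2 = 0"
      unfolding quartT_def using integral_nonneg_eq_0_iff_AE[OF R(1)] by auto
    then have "AE x in TT. u x = 0 \<and> v x = 0"
      by eventually_elim (simp add: sum_power2_eq_zero_iff)
    then have "massT u = (LINT x|TT. 0)" "massT v = (LINT x|TT. 0)"
      by (intro integral_cong_AE; (measurable | (eventually_elim, simp)))+
    then show False using m by simp
  qed
  moreover have "quartT u v \<ge> 0" by (simp add: quartT_def)
  ultimately show b: "quartT u v > 0" by simp
  have "xen G + xen H \<noteq> 0"
  proof
    assume "xen G + xen H = 0"
    then show False using R(2) b by (simp add: quartT_def)
  qed
  moreover have "xen G + xen H \<ge> 0" by simp
  ultimately show "xen G + xen H > 0" by linarith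
qed

section \<open>Dilation in x on the cell\<close>

definition xdil :: "real \<Rightarrow> pt \<Rightarrow> real" where "xdil t b = (if b = (0, 1) then 1 else t)"

lemma dil_xdil: "dil (xdil t) z = (t *\<^sub>R fst z, snd z)"
proof (rule euclidean_eqI)
  fix b :: pt assume b: "b \<in> Basis"
  then consider (x) j where "j \<in> Basis" "b = (j, 0)" | (y) "b = (0, 1)" by (auto simp: Basis_prod_def)
  then show "dil (xdil t) z \<bullet> b = (t *\<^sub>R fst z, snd z) \<bullet> b"
    unfolding dil_inner[OF b] by cases (auto simp: xdil_def inner_prod_def)
qed

lemma prod_xdil: "prod (xdil t) Basis = t ^ 3"
proof -
  have B: "(Basis :: pt set) = insert (0, 1) ((\<lambda>j. (j, 0)) ` Basis)" by (auto simp: Basis_prod_def)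
  have i: "inj_on (\<lambda>j. (j, 0::real)) (Basis :: (real^3) set)" by (auto simp: inj_on_def)
  have "prod (xdil t) Basis = xdil t (0, 1) * (\<Prod>j\<in>Basis. xdil t (j::real^3, 0))"
    unfolding B by (subst prod.insert) (auto simp: prod.reindex[OF i] o_def)
  then show ?thesis by (simp add: xdil_def)
qed

lemma TT_dil:
  fixes f :: "pt \<Rightarrow> real"
  assumes t: "t > 0" and [measurable]: "f \<in> borel_measurable borel"
  shows "(LINT z|TT. f (t *\<^sub>R fst z, snd z)) = (LINT z|TT. f z) / t ^ 3"
    "integrable TT (\<lambda>z. f (t *\<^sub>R fst z, snd z)) \<longleftrightarrow> integrable TT f"
proof -
  have p: "xdil t j > 0" for j using t by (simp add: xdil_def)
  have [measurable]: "(\<lambda>z. f (t *\<^sub>R fst z, snd z)) \<in> borel_measurable borel"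
    unfolding dil_xdil[symmetric] by measurable
  \<comment> \<open>The dilation does not move y, so the cell is invariant and the change of
    variables on R^4 restricts to it.\<close>
  have c: "indicator cell (dil (xdil t) z) = (indicator cell z :: real)" for z
    by (cases z) (simp add: dil_xdil cell_def indicator_def)
  have e: "intT g = (LINT z|lborel. indicator cell z *\<^sub>R g z)" "set_integrable lborel cell g = integrable lborel (\<lambda>z. indicator cell z *\<^sub>R g z)" for g :: "pt \<Rightarrow> real"
    by (simp_all add: intT_def set_lebesgue_integral_def set_integrable_def)
  note I = dil_integral[of "xdil t" "\<lambda>z. indicator cell z *\<^sub>R f z", OF p, unfolded c prod_xdil, unfolded dil_xdil]
  show "(LINT z|TT. f (t *\<^sub>R fst z, snd z)) = (LINT z|TT. f z) / t ^ 3"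
    using I(1) by (simp add: intT_TT[symmetric] e)
  show "integrable TT (\<lambda>z. f (t *\<^sub>R fst z, snd z)) \<longleftrightarrow> integrable TT f"
    using I(2) by (simp add: set_integrable_TT[symmetric] e)
qed

lemma wgT_dil:
  fixes k :: real
  assumes w: "wgT u G" and t: "t > 0"
  defines "u' \<equiv> \<lambda>z. k * u (t *\<^sub>R fst z, snd z)"
    and "G' \<equiv> \<lambda>z. ((k * t) *\<^sub>R fst (G (t *\<^sub>R fst z, snd z)), k * snd (G (t *\<^sub>R fst z, snd z)))"
  shows "wgT u' G'" "massT u' = k\<^sup>2 * massT u / t ^ 3" "xen G' = k\<^sup>2 * xen G / t" "yen G' = k\<^sup>2 * yen G / t ^ 3"
proof -
  have [measurable]: "u \<in> borel_measurable borel" "G \<in> borel_measurable borel"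
    and i: "integrable TT (\<lambda>z. (u z)\<^sup>2)" "integrable TT (\<lambda>z. (norm (G z))\<^sup>2)" using w by (auto simp: wgT_def L2T_def)
  note P = parts_integrable[OF \<open>G \<in> _\<close> i(2)]
  have d[measurable]: "(\<lambda>z::pt. (t *\<^sub>R fst z, snd z)) \<in> borel_measurable borel"
    unfolding dil_xdil[symmetric] by measurable
  have mu[measurable]: "u' \<in> borel_measurable borel" unfolding u'_def by measurable
  have f1[measurable]: "(\<lambda>z. fst (G (t *\<^sub>R fst z, snd z))) \<in> borel_measurable borel"
    "(\<lambda>z. snd (G (t *\<^sub>R fst z, snd z))) \<in> borel_measurable borel" by measurable
  have mG[measurable]: "G' \<in> borel_measurable borel"
  proof -
    have "G' \<in> borel \<rightarrow>\<^sub>M (borel \<Otimes>\<^sub>M borel)" unfolding G'_def by measurable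
    then show ?thesis by (simp add: borel_prod)
  qed
  have I1: "integrable TT (\<lambda>z. (u (t *\<^sub>R fst z, snd z))\<^sup>2)" using TT_dil(2)[OF t, of "\<lambda>z. (u z)\<^sup>2"] i by simp
  have I2: "integrable TT (\<lambda>z. (norm (fst (G (t *\<^sub>R fst z, snd z))))\<^sup>2)"
    using TT_dil(2)[OF t, of "\<lambda>z. (norm (fst (G z)))\<^sup>2"] P by simp
  have I3: "integrable TT (\<lambda>z. (snd (G (t *\<^sub>R fst z, snd z)))\<^sup>2)"
    using TT_dil(2)[OF t, of "\<lambda>z. (snd (G z))\<^sup>2"] P by simp
  have iG: "integrable TT (\<lambda>z. (norm (G' z))\<^sup>2)"
    unfolding norm_pt_split G'_def using I2 I3 by (simp add: power_mult_distrib)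
  have wd: "wderiv u' (\<lambda>z. G' z \<bullet> b) b" if b: "b \<in> Basis" for b
  proof -
    have "xdil t j > 0" for j using t by (simp add: xdil_def)
    from wderiv_dil[of "xdil t", OF this wgT_component(2)[OF w b] b, of k]
    have "wderiv u' (\<lambda>z. k * xdil t b * (G (t *\<^sub>R fst z, snd z) \<bullet> b)) b"
      by (simp add: dil_xdil u'_def)
    moreover have "k * xdil t b * (G (t *\<^sub>R fst z, snd z) \<bullet> b) = G' z \<bullet> b" for z
      using b by (auto simp: G'_def xdil_def inner_prod_def Basis_prod_def)
    ultimately show ?thesis by simp
  qed
  show "wgT u' G'"
    unfolding wgT_def weak_grad_iff L2T_def
    using wd iG I1 w by (auto simp: u'_def G'_def periodic_y_def wgT_def L2T_def power_mult_distrib mu[unfolded u'_def] mG[unfolded G'_def])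
  show "massT u' = k\<^sup>2 * massT u / t ^ 3"
    unfolding u'_def using TT_dil(1)[OF t, of "\<lambda>z. (u z)\<^sup>2"] by (simp add: power_mult_distrib)
  show "yen G' = k\<^sup>2 * yen G / t ^ 3"
    unfolding G'_def using TT_dil(1)[OF t, of "\<lambda>z. (snd (G z))\<^sup>2"] by (simp add: power_mult_distrib)
  have "xen G' = (LINT z|TT. (k * t)\<^sup>2 * (norm (fst (G (t *\<^sub>R fst z, snd z))))\<^sup>2)"
    unfolding G'_def by (simp only: fst_conv norm_scaleR power_mult_distrib power2_abs)
  also have "\<dots> = (k * t)\<^sup>2 * (xen G / t ^ 3)"
    using TT_dil(1)[OF t, of "\<lambda>z. (norm (fst (G z)))\<^sup>2"] by simp
  finally show "xen G' = k\<^sup>2 * xen G / t" using t by (simp add: power2_eq_square power3_eq_cube field_simps)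
qed

section \<open>The constraint set and its comparison values\<close>

lemma S_T_iff: "\<Theta> > 0 \<Longrightarrow> u \<in> S_T \<Theta> \<longleftrightarrow> u \<in> H1T \<and> massT u = \<Theta>\<^sup>2"
proof -
  assume \<Theta>: "\<Theta> > 0"
  have "intT (\<lambda>z. (u z)\<^sup>2) = massT u" if "u \<in> H1T"
    using that by (intro intT_TT borel_measurable_power) (simp add: H1T_def)
  moreover have "sqrt (massT u) = \<Theta> \<longleftrightarrow> massT u = \<Theta>\<^sup>2" using \<Theta> by (auto simp: real_sqrt_unique)
  ultimately show ?thesis by (auto simp: S_T_def)
qed

lemma V_T_elem:
  assumes "(u, v) \<in> V_T \<Theta>" "\<Theta> > 0"
  shows "wgT u (gradT u)" "wgT v (gradT v)" "massT u = \<Theta>\<^sup>2" "massT v = \<Theta>\<^sup>2"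
    "quartT u v = 4 / 3 * (xen (gradT u) + xen (gradT v))"
    "I_T u v = (xen (gradT u) + xen (gradT v)) / 6 + (yen (gradT u) + yen (gradT v)) / 2"
proof -
  have m: "u \<in> S_T \<Theta>" "v \<in> S_T \<Theta>" "Q_T u v = 0" using assms by (auto simp: V_T_def)
  show u: "wgT u (gradT u)" and v: "wgT v (gradT v)" and "massT u = \<Theta>\<^sup>2" "massT v = \<Theta>\<^sup>2"
    using m assms(2) by (auto simp: S_T_iff intro: H1T_wgT)
  show q: "quartT u v = 4 / 3 * (xen (gradT u) + xen (gradT v))" using m(3) IQ_T(2)[OF u v] by simp
  show "I_T u v = (xen (gradT u) + xen (gradT v)) / 6 + (yen (gradT u) + yen (gradT v)) / 2"
    unfolding IQ_T(1)[OF u v] q by (simp add: field_simps)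
qed

lemma bdd_V_T: "\<Theta> > 0 \<Longrightarrow> bdd_below ((\<lambda>(u, v). I_T u v) ` V_T \<Theta>)"
proof (rule bdd_belowI2[where m=0])
  fix x assume \<Theta>: "\<Theta> > 0" and x: "x \<in> V_T \<Theta>"
  obtain u v where "x = (u, v)" by (cases x)
  then show "0 \<le> (case x of (u, v) \<Rightarrow> I_T u v)" using V_T_elem(6)[of u v \<Theta>] x \<Theta> by simp
qed

lemma m_T_le: "(u, v) \<in> V_T \<Theta> \<Longrightarrow> \<Theta> > 0 \<Longrightarrow> m_T \<Theta> \<le> I_T u v"
  unfolding m_T_def by (rule cInf_lower[OF _ bdd_V_T]) auto

text \<open>As in \<open>admR_scaled\<close>, since \<open>Q_T\<close> does not see the y-energy.
  That energy scales like the mass, by the factor \<open>k^2 / t^3 = \<Theta>^2 / p\<close>.\<close>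

lemma V_T_scaled:
  assumes u: "wgT u G" and v: "wgT v H" and p: "massT u = p" "massT v = p" "p > 0" and \<Theta>: "\<Theta> > 0"
  defines "A \<equiv> xen G + xen H" and "B \<equiv> quartT u v" and "D \<equiv> yen G + yen H"
  shows "\<exists>u' v'. (u', v') \<in> V_T \<Theta> \<and> I_T u' v' = 8/27 * A ^ 3 * p / (B\<^sup>2 * \<Theta>\<^sup>2) + \<Theta>\<^sup>2 * D / (2 * p)"
proof -
  have a: "A > 0" and b: "B > 0" using quartT_pos[OF u v] p by (simp_all add: A_def B_def)
  define t where "t = 4 * A * p / (3 * B * \<Theta>\<^sup>2)"
  define k where "k = sqrt (t ^ 3 * \<Theta>\<^sup>2 / p)"
  have t: "t > 0" using a b p \<Theta> by (simp add: t_def)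
  have k2: "k\<^sup>2 = t ^ 3 * \<Theta>\<^sup>2 / p" using t p \<Theta> by (simp add: k_def)
  let ?u = "\<lambda>z. k * u (t *\<^sub>R fst z, snd z)" and ?v = "\<lambda>z. k * v (t *\<^sub>R fst z, snd z)"
  note U = wgT_dil[OF u t, of k] and V = wgT_dil[OF v t, of k]
  have [measurable]: "u \<in> borel_measurable borel" "v \<in> borel_measurable borel" using u v by (auto simp: wgT_def L2T_def)
  have q: "quartT ?u ?v = k\<^sup>2 * k\<^sup>2 * B / t ^ 3"
  proof -
    have "quartT ?u ?v = (LINT z|TT. k\<^sup>2 * k\<^sup>2 * ((u (t *\<^sub>R fst z, snd z))\<^sup>2 + (v (t *\<^sub>R fst z, snd z))\<^sup>2)\<^sup>2)"
      unfolding quartT_def by (simp add: power2_eq_square algebra_simps)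
    also have "\<dots> = k\<^sup>2 * k\<^sup>2 * B / t ^ 3"
      using TT_dil(1)[OF t, of "\<lambda>z. ((u z)\<^sup>2 + (v z)\<^sup>2)\<^sup>2"] by (simp add: B_def quartT_def)
    finally show ?thesis .
  qed
  have m: "massT ?u = \<Theta>\<^sup>2" "massT ?v = \<Theta>\<^sup>2" unfolding U(2) V(2) k2 using p t by simp_all
  define A' where "A' = t\<^sup>2 * \<Theta>\<^sup>2 * A / p"
  have q': "quartT ?u ?v = t ^ 3 * \<Theta> ^ 4 * B / p\<^sup>2"
    unfolding q k2 using t p by (simp add: power2_eq_square power3_eq_cube power4_eq_xxxx field_simps)
  have tb: "t * \<Theta>\<^sup>2 * B = 4 / 3 * A * p" using b \<Theta> by (simp add: t_def field_simps)
  have "t ^ 3 * \<Theta> ^ 4 * B / p\<^sup>2 = t\<^sup>2 * \<Theta>\<^sup>2 * (t * \<Theta>\<^sup>2 * B) / p\<^sup>2"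
    by (simp add: power2_eq_square power3_eq_cube power4_eq_xxxx)
  also have "\<dots> = 4 / 3 * A'" unfolding tb A'_def using p by (simp add: power2_eq_square)
  finally have qa: "quartT ?u ?v = 4 / 3 * A'" using q' by simp
  have xa: "k\<^sup>2 * xen G / t + k\<^sup>2 * xen H / t = A'"
    unfolding k2 A'_def A_def using t p by (simp add: power2_eq_square power3_eq_cube field_simps)
  have ya: "k\<^sup>2 * yen G / t ^ 3 + k\<^sup>2 * yen H / t ^ 3 = \<Theta>\<^sup>2 * D / p"
    unfolding k2 D_def using t p by (simp add: field_simps)
  have Q: "Q_T ?u ?v = 0" unfolding IQ_T(2)[OF U(1) V(1)] U(3) V(3) xa qa by simp
  have "I_T ?u ?v = A' / 6 + \<Theta>\<^sup>2 * D / p / 2"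
    unfolding IQ_T(1)[OF U(1) V(1)] U(3,4) V(3,4) xa qa ya by (simp add: field_simps)
  also have "A' / 6 = 8/27 * A ^ 3 * p / (B\<^sup>2 * \<Theta>\<^sup>2)"
    unfolding A'_def t_def using a b p \<Theta> by (simp add: power2_eq_square power3_eq_cube field_simps)
  finally have I: "I_T ?u ?v = 8/27 * A ^ 3 * p / (B\<^sup>2 * \<Theta>\<^sup>2) + \<Theta>\<^sup>2 * D / (2 * p)" by (simp add: mult.commute)
  have "(?u, ?v) \<in> V_T \<Theta>"
    unfolding V_T_def using m Q wgT_H1T(1)[OF U(1)] wgT_H1T(1)[OF V(1)] \<Theta> by (simp add: S_T_iff)
  with I show ?thesis by blast
qed

text \<open>One factor \<open>2*pi\<close> is the length of the circle, the other comes from the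
  mass \<open>\<Theta>^2 / (2*pi)\<close> on R^3.\<close>

definition cR :: real where "cR = 4 * pi\<^sup>2 * m_R 1"

lemma cR_eq: "\<Theta> > 0 \<Longrightarrow> 2 * pi * m_R (\<Theta> / sqrt (2 * pi)) = cR / \<Theta>\<^sup>2"
  by (subst m_R_scaling) (simp_all add: cR_def power_divide power2_eq_square)

text \<open>On the constraint \<open>B = 4A/3\<close>, so \<open>rigidity\<close> bounds
  \<open>A\<close> from below, with a loss linear in \<open>D\<close> that competes with the
  \<open>D/2\<close> in the energy. It is used twice: for large \<open>\<Theta>\<close> the
  coefficient of \<open>D\<close> is nonnegative, and for \<open>D = 0\<close> the y-independent
  level results at every \<open>\<Theta>\<close>.\<close>

lemma V_T_lower:
  assumes V: "(u, v) \<in> V_T \<Theta>" and \<Theta>: "\<Theta> > 0"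
  defines "D \<equiv> yen (gradT u) + yen (gradT v)"
  shows "cR / \<Theta>\<^sup>2 + D * (1 / 2 - 157079088 * cR / (kap\<^sup>2 * \<Theta> ^ 4)) \<le> I_T u v"
proof -
  note E = V_T_elem[OF V \<Theta>]
  define A where "A = xen (gradT u) + xen (gradT v)"
  define C :: real where "C = 157079088"
  define k where "k = kap * sqrt (2 * \<Theta>\<^sup>2)"
  have mass: "massT u + massT v = 2 * \<Theta>\<^sup>2" using E(3,4) by simp
  have s: "2 * \<Theta>\<^sup>2 > 0" using \<Theta> by simp
  have A: "A > 0" using quartT_pos(2)[OF E(1,2)] mass s by (simp add: A_def)
  have D0: "D \<ge> 0" by (simp add: D_def)
  have k: "k > 0" using kap \<Theta> by (simp add: k_def)
  have k2: "k\<^sup>2 = 2 * \<Theta>\<^sup>2 * kap\<^sup>2" using \<Theta> by (simp add: k_def power_mult_distrib)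
  have mu: "m_R 1 > 0" by (rule m_R_pos)
  \<comment> \<open>For \<open>D = 0\<close> the bound reads \<open>A \<ge> 16 / (9 k^2)\<close>; a
    sixth of this is exactly the y-independent level.\<close>
  have ck: "8 / (27 * k\<^sup>2) = cR / \<Theta>\<^sup>2"
    unfolding k2 kap(2) cR_def using mu \<Theta> by (simp add: field_simps)
  have "quartT u v \<le> sqrt A ^ 3 * (k + C * D / k)"
    using rigidity(2)[OF E(1,2) mass s] by (simp add: quartT_def A_def D_def k_def C_def)
  then have "4 / 3 * A \<le> A * (sqrt A * (k + C * D / k))"
    unfolding E(5) A_def[symmetric] using A by (simp add: power3_eq_cube)
  then have "A * (4 / 3) \<le> A * (sqrt A * (k + C * D / k))" by (simp only: mult.commute)
  then have "4 / 3 \<le> sqrt A * (k + C * D / k)" by (rule mult_left_le_imp_le[OF _ A])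
  then have "(4 / 3)\<^sup>2 \<le> (sqrt A * (k + C * D / k))\<^sup>2" by (rule power_mono) simp
  then have "16 / 9 \<le> A * (k + C * D / k)\<^sup>2" using A by (simp add: power_mult_distrib power_divide)
  moreover define q where "q = C * D / k\<^sup>2"
  have q0: "q \<ge> 0" using D0 by (simp add: q_def C_def)
  have "k + C * D / k = k * (1 + q)" using k by (simp add: q_def power2_eq_square field_simps)
  ultimately have m: "16 / 9 \<le> A * k\<^sup>2 * (1 + q)\<^sup>2" by (simp add: power_mult_distrib)
  \<comment> \<open>Linearisation of \<open>(1 + q)^-2\<close>, from
    \<open>(1 + q)^2 (1 - 2q) = 1 - 3q^2 - 2q^3\<close>.\<close>
  have "(16 / 9) * (1 - 2 * q) \<le> A * k\<^sup>2"
  proof (cases "1 - 2 * q \<le> 0")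
    case True
    then have "(16 / 9) * (1 - 2 * q) \<le> 0" by simp
    moreover have "A * k\<^sup>2 \<ge> 0" using A by simp
    ultimately show ?thesis by linarith
  next
    case False
    have "(16 / 9) * (1 - 2 * q) \<le> A * k\<^sup>2 * (1 + q)\<^sup>2 * (1 - 2 * q)" using False by (intro mult_right_mono[OF m]) simp
    also have "\<dots> = A * k\<^sup>2 * (1 - (3 * q\<^sup>2 + 2 * q ^ 3))"
      by (simp add: power2_eq_square power3_eq_cube algebra_simps)
    also have "\<dots> \<le> A * k\<^sup>2 * 1"
    proof (rule mult_left_mono)
      have "0 \<le> 3 * q\<^sup>2 + 2 * q ^ 3" using q0 by (intro add_nonneg_nonneg) simp_all
      then show "1 - (3 * q\<^sup>2 + 2 * q ^ 3) \<le> 1" by linarith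
    qed (use A in simp)
    finally show ?thesis by simp
  qed
  then have "8 / (27 * k\<^sup>2) * (1 - 2 * q) \<le> A / 6" using k by (simp add: field_simps)
  then have "cR / \<Theta>\<^sup>2 * (1 - 2 * q) + D / 2 \<le> I_T u v"
    unfolding ck E(6) A_def[symmetric] D_def[symmetric] by simp
  also have "cR / \<Theta>\<^sup>2 * (1 - 2 * q) + D / 2 = cR / \<Theta>\<^sup>2 + D * (1 / 2 - C * cR / (kap\<^sup>2 * \<Theta> ^ 4))"
    unfolding q_def k2 using kap \<Theta> by (simp add: power2_eq_square power4_eq_xxxx field_simps)
  finally show ?thesis by (simp add: C_def)
qed

text \<open>Trial pairs \<open>(f h, g h)\<close> with \<open>(f, g)\<close> admissible on R^3 at
  norm 1 and a profile \<open>h\<close> in y, projected onto the constraint. Only moments of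
  \<open>h\<close> survive; they are kept general because both \<open>h = 1\<close> and
  \<open>h = cos\<close> are used.\<close>

lemma trial_bound:
  assumes \<Theta>: "\<Theta> > 0" and h: "C1dir h h' (1::real)" and per: "\<And>y. h (y + 2*pi) = h y" "\<And>y. h' (y + 2*pi) = h' y"
    and H: "(LINT y|tau. (h y)\<^sup>2) = h2" "(LINT y|tau. h y ^ 4) = h4" "(LINT y|tau. (h' y)\<^sup>2) = hq"
    and pos: "h2 > 0" "h4 > 0"
  shows "m_T \<Theta> \<le> h2 ^ 4 / h4\<^sup>2 * m_R 1 / \<Theta>\<^sup>2 + \<Theta>\<^sup>2 * hq / h2" and "V_T \<Theta> \<noteq> {}"
proof -
  have ch: "continuous_on UNIV h" "continuous_on UNIV h'" using h by (auto simp: C1dir_def)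
  have ih: "integrable tau (\<lambda>y. (h y)\<^sup>2)" "integrable tau (\<lambda>y. h y ^ 4)" "integrable tau (\<lambda>y. (h' y)\<^sup>2)"
    by (intro integral_tau_continuous(2) continuous_intros ch)+
  have *: "\<exists>u v. (u, v) \<in> V_T \<Theta> \<and> I_T u v = h2 ^ 4 / h4\<^sup>2 * x / \<Theta>\<^sup>2 + \<Theta>\<^sup>2 * hq / h2" if x: "x \<in> admR 1" for x
  proof -
    obtain f F g G where w: "wgR f F" "wgR g G" "sqint f = 1\<^sup>2" "sqint g = 1\<^sup>2"
      and xe: "x = (sqint F + sqint G) / 6" and b: "quartR f g = 4 / 3 * (sqint F + sqint G)"
      using admR_elem[OF x] by blast
    have i: "integrable lborel (\<lambda>x. (f x)\<^sup>2)" "integrable lborel (\<lambda>x. (g x)\<^sup>2)"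
      "integrable lborel (\<lambda>x. (norm (F x))\<^sup>2)" "integrable lborel (\<lambda>x. (norm (G x))\<^sup>2)" using w by (auto simp: wgR_def)
    define a where "a = sqint F + sqint G"
    have a: "a > 0" using quartR_pos[OF w(1,2)] w by (simp add: a_def)
    let ?u = "\<lambda>z::pt. f (fst z) * h (snd z)" and ?v = "\<lambda>z::pt. g (fst z) * h (snd z)"
    let ?U = "\<lambda>z::pt. (h (snd z) *\<^sub>R F (fst z), f (fst z) * h' (snd z))" and ?V = "\<lambda>z::pt. (h (snd z) *\<^sub>R G (fst z), g (fst z) * h' (snd z))"
    note u = wgT_product[OF w(1) h per] and v = wgT_product[OF w(2) h per]
    have m: "massT ?u = h2" "massT ?v = h2"
      using TT_product(2)[OF i(1) ih(1)] TT_product(2)[OF i(2) ih(1)] w(3,4) by (simp_all add: power_mult_distrib H)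
    have xu: "xen ?U + xen ?V = h2 * a"
      using TT_product(2)[OF i(3) ih(1)] TT_product(2)[OF i(4) ih(1)]
      by (simp add: power_mult_distrib H a_def mult.commute distrib_left)
    have yu: "yen ?U + yen ?V = 2 * hq"
      using TT_product(2)[OF i(1) ih(3)] TT_product(2)[OF i(2) ih(3)] w(3,4) by (simp add: power_mult_distrib H)
    have "quartT ?u ?v = (LINT z|TT. ((f (fst z))\<^sup>2 + (g (fst z))\<^sup>2)\<^sup>2 * h (snd z) ^ 4)"
      unfolding quartT_def by (simp add: power2_eq_square power4_eq_xxxx algebra_simps)
    also have "\<dots> = quartR f g * h4"
      using TT_product(2)[OF quartR_integrable[OF w(1,2)] ih(2)] by (simp add: quartR_def H)
    finally have qu: "quartT ?u ?v = 4 / 3 * a * h4" by (simp add: b a_def)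
    obtain u' v' where 1: "(u', v') \<in> V_T \<Theta>" and
      2: "I_T u' v' = 8/27 * (xen ?U + xen ?V) ^ 3 * h2 / ((quartT ?u ?v)\<^sup>2 * \<Theta>\<^sup>2) + \<Theta>\<^sup>2 * (yen ?U + yen ?V) / (2 * h2)"
      using V_T_scaled[OF u v m pos(1) \<Theta>] by blast
    have "I_T u' v' = h2 ^ 4 / h4\<^sup>2 * x / \<Theta>\<^sup>2 + \<Theta>\<^sup>2 * hq / h2"
      unfolding 2 xu yu qu xe a_def[symmetric] using a pos \<Theta> by (simp add: power2_eq_square power3_eq_cube power4_eq_xxxx field_simps)
    with 1 show ?thesis by blast
  qed
  show "V_T \<Theta> \<noteq> {}" using * admR_nonempty[of 1] by fastforce
  define c where "c = h2 ^ 4 / h4\<^sup>2 / \<Theta>\<^sup>2"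
  have c: "c > 0" using pos \<Theta> by (simp add: c_def)
  \<comment> \<open>The bound is affine and increasing in the value \<open>x\<close>; solved for
    \<open>x\<close>, it passes to the infimum.\<close>
  have "(m_T \<Theta> - \<Theta>\<^sup>2 * hq / h2) / c \<le> m_R 1"
    unfolding m_R_admR
  proof (rule cInf_greatest[OF admR_nonempty])
    fix x assume "x \<in> admR 1"
    then obtain u v where "(u, v) \<in> V_T \<Theta>" "I_T u v = h2 ^ 4 / h4\<^sup>2 * x / \<Theta>\<^sup>2 + \<Theta>\<^sup>2 * hq / h2" using * by blast
    then have "m_T \<Theta> \<le> c * x + \<Theta>\<^sup>2 * hq / h2" using m_T_le[of u v \<Theta>] \<Theta> by (simp add: c_def)
    then show "(m_T \<Theta> - \<Theta>\<^sup>2 * hq / h2) / c \<le> x" using c by (simp add: divide_le_eq mult.commute)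
  qed simp
  then have "m_T \<Theta> - \<Theta>\<^sup>2 * hq / h2 \<le> m_R 1 * c" using c by (simp add: divide_le_eq)
  then show "m_T \<Theta> \<le> h2 ^ 4 / h4\<^sup>2 * m_R 1 / \<Theta>\<^sup>2 + \<Theta>\<^sup>2 * hq / h2" by (simp add: c_def mult.commute)
qed

lemma m_T_le_cR: assumes \<Theta>: "\<Theta> > 0" shows "m_T \<Theta> \<le> cR / \<Theta>\<^sup>2" "V_T \<Theta> \<noteq> {}"
proof -
  have h: "C1dir (\<lambda>_::real. 1::real) (\<lambda>_. 0) 1" by (simp add: C1dir_def)
  note T = trial_bound[OF \<Theta> h, of "2*pi" "2*pi" 0]
  show "V_T \<Theta> \<noteq> {}" by (rule T(2)) (use tau_integrals(4) in simp_all)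
  have "m_T \<Theta> \<le> (2*pi) ^ 4 / (2*pi)\<^sup>2 * m_R 1 / \<Theta>\<^sup>2 + \<Theta>\<^sup>2 * 0 / (2*pi)"
    by (rule T(1)) (use tau_integrals(4) in simp_all)
  also have "\<dots> = cR / \<Theta>\<^sup>2" by (simp add: cR_def power2_eq_square power4_eq_xxxx)
  finally show "m_T \<Theta> \<le> cR / \<Theta>\<^sup>2" .
qed

text \<open>The leading factor \<open>h2^4 / h4^2\<close> drops from \<open>4 pi^2\<close> for
  constants to \<open>16 pi^2 / 9\<close>, a ratio of 4/9, at the price of the y-energy
  \<open>\<Theta>^2\<close>, which is negligible for small \<open>\<Theta>\<close>.\<close>

lemma m_T_le_cos: assumes \<Theta>: "\<Theta> > 0" shows "m_T \<Theta> \<le> 4 / 9 * cR / \<Theta>\<^sup>2 + \<Theta>\<^sup>2"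
proof -
  have h: "C1dir (cos :: real \<Rightarrow> real) (\<lambda>y. - sin y) 1"
    unfolding C1dir_def by (auto intro!: continuous_intros derivative_eq_intros)
  have "m_T \<Theta> \<le> pi ^ 4 / (3 * pi / 4)\<^sup>2 * m_R 1 / \<Theta>\<^sup>2 + \<Theta>\<^sup>2 * pi / pi"
    by (rule trial_bound(1)[OF \<Theta> h]) (use tau_integrals in simp_all)
  also have "\<dots> = 4 / 9 * cR / \<Theta>\<^sup>2 + \<Theta>\<^sup>2" by (simp add: cR_def power2_eq_square power4_eq_xxxx)
  finally show ?thesis .
qed

text \<open>For a pair already on the constraint, \<open>B = 4A/3\<close> simplifies the scaling
  quotient: \<open>\<Theta>^2 I\<close> keeps its x-part, and the y-part varies with the fourth
  power of \<open>\<Theta>'\<close>.\<close>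

lemma rescale_mass:
  assumes V: "(u, v) \<in> V_T \<Theta>" and \<Theta>: "\<Theta> > 0" "\<Theta>' > 0"
  defines "A \<equiv> xen (gradT u) + xen (gradT v)" and "D \<equiv> yen (gradT u) + yen (gradT v)"
  shows "\<Theta>'\<^sup>2 * m_T \<Theta>' \<le> \<Theta>\<^sup>2 * A / 6 + \<Theta>' ^ 4 * D / (2 * \<Theta>\<^sup>2)"
proof -
  note E = V_T_elem[OF V \<Theta>(1)]
  have p: "\<Theta>\<^sup>2 > 0" using \<Theta> by simp
  have A: "A > 0" using quartT_pos(2)[OF E(1,2)] p unfolding E(3,4) A_def by simp
  obtain u' v' where 1: "(u', v') \<in> V_T \<Theta>'" and
    2: "I_T u' v' = 8/27 * A ^ 3 * \<Theta>\<^sup>2 / ((quartT u v)\<^sup>2 * \<Theta>'\<^sup>2) + \<Theta>'\<^sup>2 * D / (2 * \<Theta>\<^sup>2)"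
    using V_T_scaled[OF E(1-4) p \<Theta>(2)] unfolding A_def D_def by blast
  have "\<Theta>'\<^sup>2 * m_T \<Theta>' \<le> \<Theta>'\<^sup>2 * I_T u' v'" by (intro mult_left_mono m_T_le[OF 1 \<Theta>(2)]) simp
  also have "\<dots> = \<Theta>\<^sup>2 * A / 6 + \<Theta>' ^ 4 * D / (2 * \<Theta>\<^sup>2)"
    unfolding 2 E(5) A_def[symmetric] using A \<Theta> by (simp add: power2_eq_square power3_eq_cube power4_eq_xxxx field_simps)
  finally show ?thesis .
qed

text \<open>\<open>dy_zero\<close> speaks of almost every point of R^4, \<open>yen\<close> of a
  single cell; periodicity bridges the two.\<close>

lemma yen_zero_iff_dy_zero:
  assumes u: "u \<in> H1T" shows "yen (gradT u) = 0 \<longleftrightarrow> dy_zero u"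
proof
  note w = H1T_wgT[OF u]
  have [measurable]: "gradT u \<in> borel_measurable borel" and p: "periodic_y (gradT u)" using w by (auto simp: wgT_def)
  note i = parts_integrable(2)[of "gradT u"]
  {
    assume "dy_zero u"
    then have "AE z in TT. snd (gradT u z) = 0" unfolding dy_zero_def by (rule AE_TT)
    then have "AE z in TT. (snd (gradT u z))\<^sup>2 = 0" by eventually_elim simp
    then have "yen (gradT u) = (LINT z|TT. 0)" by (intro integral_cong_AE) measurable
    then show "yen (gradT u) = 0" by simp
  next
    assume "yen (gradT u) = 0"
    moreover have "integrable TT (\<lambda>z. (snd (gradT u z))\<^sup>2)" using w by (intro i) (auto simp: wgT_def)
    ultimately have z: "(\<integral>\<^sup>+z. ennreal ((snd (gradT u z))\<^sup>2) \<partial>TT) = 0"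
      by (simp add: nn_integral_eq_integral)
    \<comment> \<open>The factor \<open>top\<close> turns finiteness of the integral over bounded sets into vanishing.\<close>
    let ?g = "\<lambda>z. top * ennreal ((snd (gradT u z))\<^sup>2)"
    have [measurable]: "cball (0::pt) r \<in> sets borel" for r by simp
    have pg: "periodic_y ?g" using p by (simp add: periodic_y_def)
    have "(\<integral>\<^sup>+z. ?g z \<partial>TT) < \<infinity>" using z by (simp add: nn_integral_cmult)
    from nn_integral_strip_finite[OF _ pg this]
    have "(\<integral>\<^sup>+z. top * (ennreal ((snd (gradT u z))\<^sup>2) * indicator (cball 0 r) z) \<partial>lborel) < \<infinity>" for r
      by (simp add: mult.assoc)
    then have "top * (\<integral>\<^sup>+z. ennreal ((snd (gradT u z))\<^sup>2) * indicator (cball 0 r) z \<partial>lborel) < \<infinity>" for r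
      by (subst (asm) nn_integral_cmult) auto
    then have "(\<integral>\<^sup>+z. ennreal ((snd (gradT u z))\<^sup>2) * indicator (cball 0 r) z \<partial>lborel) = 0" for r
      by (auto simp: ennreal_mult_less_top)
    then have ae: "AE z in lborel. ennreal ((snd (gradT u z))\<^sup>2) * indicator (cball 0 r) z = 0" for r
      by (subst (asm) nn_integral_0_iff_AE) auto
    have "AE z in lborel. \<forall>n::nat. ennreal ((snd (gradT u z))\<^sup>2) * indicator (cball 0 (real n)) z = 0"
      by (subst AE_all_countable) (use ae in blast)
    then show "dy_zero u"
      unfolding dy_zero_def
    proof eventually_elim
      fix z assume a: "\<forall>n::nat. ennreal ((snd (gradT u z))\<^sup>2) * indicator (cball 0 (real n)) z = 0"
      obtain n :: nat where "norm z \<le> real n" using real_arch_simple by blast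
      then show "snd (gradT u z) = 0" using a[rule_format, of n] by (simp add: indicator_def)
    qed
  }
qed

theorem theorem1p2:
  shows "\<exists>\<Theta>0::real. 0 < \<Theta>0 \<and>
    (\<forall>\<Theta>. 0 < \<Theta> \<and> \<Theta> < \<Theta>0 \<longrightarrow>
        m_T \<Theta> < 2 * pi * m_R (\<Theta> / sqrt (2 * pi)) \<and>
        (\<forall>u v. minimizer_T \<Theta> u v \<longrightarrow> \<not> (dy_zero u \<and> dy_zero v))) \<and>
    (\<forall>\<Theta>. \<Theta> > \<Theta>0 \<longrightarrow>
        m_T \<Theta> = 2 * pi * m_R (\<Theta> / sqrt (2 * pi)) \<and>
        (\<forall>u v. minimizer_T \<Theta> u v \<longrightarrow> dy_zero u \<and> dy_zero v))"
proof -
  have c0: "cR > 0" using m_R_pos by (simp add: cR_def)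
  define S where "S = {\<Theta>. 0 < \<Theta> \<and> \<Theta>\<^sup>2 * m_T \<Theta> < cR}"
  have S_iff: "\<Theta> \<in> S \<longleftrightarrow> m_T \<Theta> < cR / \<Theta>\<^sup>2" if "\<Theta> > 0" for \<Theta>
    using that by (simp add: S_def pos_less_divide_eq mult.commute)
  \<comment> \<open>Then \<open>\<epsilon>^4 \<le> \<epsilon> \<le> cR / 3\<close>, and
    \<open>4/9 + 1/3 < 1\<close>.\<close>
  define \<epsilon> where "\<epsilon> = min 1 (cR / 3)"
  have \<epsilon>: "\<epsilon> > 0" "\<epsilon> \<le> 1" "\<epsilon> \<le> cR / 3" using c0 by (auto simp: \<epsilon>_def)
  have "\<epsilon> \<in> S"
  proof -
    have "\<epsilon>\<^sup>2 * m_T \<epsilon> \<le> \<epsilon>\<^sup>2 * (4 / 9 * cR / \<epsilon>\<^sup>2 + \<epsilon>\<^sup>2)"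
      by (intro mult_left_mono m_T_le_cos[OF \<epsilon>(1)]) simp
    also have "\<dots> = 4 / 9 * cR + \<epsilon> ^ 4" using \<epsilon> by (simp add: field_simps power2_eq_square power4_eq_xxxx)
    also have "\<epsilon> ^ 4 \<le> \<epsilon> ^ 1" using \<epsilon> by (intro power_decreasing) auto
    finally have "\<epsilon>\<^sup>2 * m_T \<epsilon> \<le> 4 / 9 * cR + \<epsilon>" by simp
    then have "\<epsilon>\<^sup>2 * m_T \<epsilon> < cR" using \<epsilon> c0 by linarith
    then show ?thesis using \<epsilon> by (simp add: S_def)
  qed
  \<comment> \<open>Beyond this value the coefficient of \<open>D\<close> in
    \<open>V_T_lower\<close> is nonnegative; the 1 in the maximum allows
    \<open>\<Theta> \<le> \<Theta>^4\<close>.\<close>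
  define \<Theta>1 where "\<Theta>1 = max 1 (2 * 157079088 * cR / kap\<^sup>2)"
  have bound: "\<Theta> \<le> \<Theta>1" if "\<Theta> \<in> S" for \<Theta>
  proof (rule ccontr)
    assume "\<not> \<Theta> \<le> \<Theta>1"
    then have t: "\<Theta> > 1" "2 * 157079088 * cR / kap\<^sup>2 < \<Theta>" by (auto simp: \<Theta>1_def)
    have "\<Theta> ^ 1 \<le> \<Theta> ^ 4" using t by (intro power_increasing) auto
    then have "2 * 157079088 * cR / kap\<^sup>2 < \<Theta> ^ 4" using t by simp
    then have "2 * 157079088 * cR < \<Theta> ^ 4 * kap\<^sup>2" using kap(1) by (subst (asm) pos_divide_less_eq) auto
    then have h: "157079088 * cR / (kap\<^sup>2 * \<Theta> ^ 4) \<le> 1 / 2"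
      using kap(1) t by (subst pos_divide_le_eq) (auto simp: mult.commute)
    have "cR / \<Theta>\<^sup>2 \<le> m_T \<Theta>"
      unfolding m_T_def
    proof (rule cInf_greatest)
      show "(\<lambda>(u, v). I_T u v) ` V_T \<Theta> \<noteq> {}" using m_T_le_cR(2)[of \<Theta>] t by simp
      fix x assume "x \<in> (\<lambda>(u, v). I_T u v) ` V_T \<Theta>"
      then obtain u v where V: "(u, v) \<in> V_T \<Theta>" and x: "x = I_T u v" by auto
      have "0 \<le> (yen (gradT u) + yen (gradT v)) * (1 / 2 - 157079088 * cR / (kap\<^sup>2 * \<Theta> ^ 4))"
        using h by (intro mult_nonneg_nonneg) auto
      then show "cR / \<Theta>\<^sup>2 \<le> x" using V_T_lower[OF V] t x by linarith
    qed
    then show False using that S_iff[of \<Theta>] t by simp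
  qed
  have down: "\<Theta>' \<in> S" if "\<Theta> \<in> S" "0 < \<Theta>'" "\<Theta>' < \<Theta>" for \<Theta> \<Theta>'
  proof -
    have \<Theta>: "\<Theta> > 0" "m_T \<Theta> < cR / \<Theta>\<^sup>2" using that S_iff by (auto simp: S_def)
    \<comment> \<open>The infimum may not be attained; any pair strictly below the y-independent
      level will do, and lowering the mass keeps it below.\<close>
    obtain u v where V: "(u, v) \<in> V_T \<Theta>" and I: "I_T u v < cR / \<Theta>\<^sup>2"
      using cInf_lessD[OF _ \<Theta>(2)[unfolded m_T_def]] m_T_le_cR(2)[OF \<Theta>(1)] by auto
    let ?A = "xen (gradT u) + xen (gradT v)" and ?D = "yen (gradT u) + yen (gradT v)"
    have "\<Theta>' ^ 4 * ?D / (2 * \<Theta>\<^sup>2) \<le> \<Theta> ^ 4 * ?D / (2 * \<Theta>\<^sup>2)"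
      using that by (intro divide_right_mono mult_right_mono power_mono) auto
    also have "\<dots> = \<Theta>\<^sup>2 * ?D / 2" using \<Theta> by (simp add: power2_eq_square power4_eq_xxxx)
    finally have "\<Theta>'\<^sup>2 * m_T \<Theta>' \<le> \<Theta>\<^sup>2 * ?A / 6 + \<Theta>\<^sup>2 * ?D / 2"
      using rescale_mass[OF V \<Theta>(1) that(2)] by linarith
    also have "\<dots> = \<Theta>\<^sup>2 * I_T u v" unfolding V_T_elem(6)[OF V \<Theta>(1)] by (simp add: algebra_simps)
    also have "\<dots> < cR" using I \<Theta> by (simp add: pos_less_divide_eq mult.commute)
    finally show ?thesis using that by (simp add: S_def)
  qed
  define \<Theta>0 where "\<Theta>0 = Sup S"
  have bdd: "bdd_above S" using bound by (rule bdd_aboveI)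
  have "\<epsilon> \<le> \<Theta>0" unfolding \<Theta>0_def by (rule cSup_upper[OF \<open>\<epsilon> \<in> S\<close> bdd])
  then have pos: "\<Theta>0 > 0" using \<epsilon> by linarith
  have small: "\<Theta> \<in> S" if "0 < \<Theta>" "\<Theta> < \<Theta>0" for \<Theta>
  proof -
    have "S \<noteq> {}" "\<Theta> < Sup S" using \<open>\<epsilon> \<in> S\<close> that(2) by (auto simp: \<Theta>0_def)
    then obtain \<Theta>2 where "\<Theta>2 \<in> S" "\<Theta> < \<Theta>2" using less_cSup_iff[OF _ bdd, of \<Theta>] by auto
    then show ?thesis using down that by blast
  qed
  have large: "\<Theta> \<notin> S" if "\<Theta> > \<Theta>0" for \<Theta>
    using cSup_upper[OF _ bdd, of \<Theta>] that unfolding \<Theta>0_def by auto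
  have minH: "u \<in> H1T \<and> v \<in> H1T \<and> (u, v) \<in> V_T \<Theta> \<and> I_T u v = m_T \<Theta>" if "minimizer_T \<Theta> u v" for \<Theta> u v
    using that by (auto simp: minimizer_T_def V_T_def S_T_def)
  show ?thesis
  proof (intro exI[of _ \<Theta>0] conjI allI impI, rule pos)
    fix \<Theta> assume t: "0 < \<Theta> \<and> \<Theta> < \<Theta>0"
    then have lt: "m_T \<Theta> < cR / \<Theta>\<^sup>2" using small S_iff by blast
    then show "m_T \<Theta> < 2 * pi * m_R (\<Theta> / sqrt (2 * pi))" using t by (simp add: cR_eq)
    fix u v assume "minimizer_T \<Theta> u v"
    note M = minH[OF this]
    show "\<not> (dy_zero u \<and> dy_zero v)"
    proof
      assume "dy_zero u \<and> dy_zero v"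
      then have "yen (gradT u) = 0" "yen (gradT v) = 0" using M yen_zero_iff_dy_zero by auto
      then have "cR / \<Theta>\<^sup>2 \<le> I_T u v" using V_T_lower[of u v \<Theta>] M t by simp
      then show False using M lt by simp
    qed
  next
    fix \<Theta> assume t: "\<Theta> > \<Theta>0"
    then have t0: "\<Theta> > 0" using pos by simp
    have "\<not> m_T \<Theta> < cR / \<Theta>\<^sup>2" using large[OF t] S_iff[OF t0] by blast
    then have eq: "m_T \<Theta> = cR / \<Theta>\<^sup>2" using m_T_le_cR(1)[OF t0] by linarith
    then show "m_T \<Theta> = 2 * pi * m_R (\<Theta> / sqrt (2 * pi))" using t0 by (simp add: cR_eq)
    fix u v assume "minimizer_T \<Theta> u v"
    note M = minH[OF this]
    then have V: "(u, v) \<in> V_T \<Theta>" by blast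
    let ?A = "xen (gradT u) + xen (gradT v)" and ?D = "yen (gradT u) + yen (gradT v)"
    have D0: "?D \<ge> 0" by simp
    have "?D = 0"
    proof (rule ccontr)
      assume "?D \<noteq> 0"
      then have D: "?D > 0" using D0 by linarith
      \<comment> \<open>Strictly between the threshold and \<open>\<Theta>\<close>: a positive
        y-energy would put the rescaled pair strictly below the y-independent level there, although
        \<open>\<Theta>'\<close> exceeds the supremum of \<open>S\<close>.\<close>
      define \<Theta>' where "\<Theta>' = (\<Theta> + \<Theta>0) / 2"
      have t': "0 < \<Theta>'" "\<Theta>0 < \<Theta>'" "\<Theta>' < \<Theta>" using t pos by (auto simp: \<Theta>'_def)
      have "\<Theta>' ^ 4 < \<Theta> ^ 4" using t' by (intro power_strict_mono) auto
      then have "\<Theta>' ^ 4 * ?D / (2 * \<Theta>\<^sup>2) < \<Theta> ^ 4 * ?D / (2 * \<Theta>\<^sup>2)"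
        using D t0 by (intro divide_strict_right_mono mult_strict_right_mono) auto
      also have "\<dots> = \<Theta>\<^sup>2 * ?D / 2" using t0 by (simp add: power2_eq_square power4_eq_xxxx)
      finally have "\<Theta>'\<^sup>2 * m_T \<Theta>' < \<Theta>\<^sup>2 * ?A / 6 + \<Theta>\<^sup>2 * ?D / 2"
        using rescale_mass[OF V t0 t'(1)] by linarith
      also have "\<dots> = \<Theta>\<^sup>2 * I_T u v" unfolding V_T_elem(6)[OF V t0] by (simp add: algebra_simps)
      also have "\<dots> = cR" using M eq t0 by simp
      finally have "\<Theta>' \<in> S" using t' by (simp add: S_def)
      then show False using large[OF t'(2)] by simp
    qed
    moreover have "yen (gradT u) \<ge> 0" "yen (gradT v) \<ge> 0" by simp_all
    ultimately have "yen (gradT u) = 0" "yen (gradT v) = 0" by linarith+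
    then show "dy_zero u" "dy_zero v" using M yen_zero_iff_dy_zero by auto
  qed
qed

end
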